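(* Let $G$ be a compact Abelian group, $f\in C(G)$, $X,Y$ Banach spaces, $T\in L(X,Y)$ and $0<s\le r<\infty$. If the operators $\star f: M(G)\to C(G)$ and $T: X\to Y$ can be factored through $S_{r,s}$-operators, then the operator $T_f: M(G,X)\to C(G,Y)$ can also be factored through an $S_{r,s}$-operator.
   Context: All Banach spaces are complex, and (standing assumption) all operators under consideration are not identically zero. $M(G)=C(G)^*$ is the space of finite regular Borel complex measures on $G$; $M(G,X)$ is the Banach space of regular Borel $X$-valued measures of bounded variation; $C(G,Y)$ is the space of continuous $Y$-valued functions on $G$ with the sup norm. The convolution operator is $(\star f)(\mu)(g)=\int_G f(g-h)\,d\mu(h)$. The operator $T_f$ is $T_f(\overline\mu)(g)=\int_G f(g-t)\,d(T\overline\mu)(t)$, $\overline\mu\in M(G,X)$, where $(T\overline\mu)(E)=T(\overline\mu(E))$. For a Hilbert space $H$ and $0<r,s<\infty$, the Lorentz–Schatten class $S_{r,s}(H)$ consists of compact operators on $H$ whose singular numbers $(s_n)$ satisfy $\sum_n n^{s/r-1}s_n^s<\infty$. An operator $S\in L(Z,W)$ can be factored through an $S_{r,s}$-operator if there are a Hilbert space $H$, $U\in S_{r,s}(H)$ and bounded $A: Z\to H$, $B: H\to W$ with $S=BUA$. *)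

theory Defs
  imports "HOL-Analysis.Analysis"
begin

section \<open>Complex normed spaces, Banach spaces and Hilbert spaces\<close>

class complex_vector = real_vector +
  fixes scaleC :: "complex \<Rightarrow> 'a \<Rightarrow> 'a"  (infixr \<open>*\<^sub>C\<close> 75)
  assumes scaleC_add_right: "a *\<^sub>C (x + y) = a *\<^sub>C x + a *\<^sub>C y"
    and scaleC_add_left: "(a + b) *\<^sub>C x = a *\<^sub>C x + b *\<^sub>C x"
    and scaleC_scaleC: "a *\<^sub>C (b *\<^sub>C x) = (a * b) *\<^sub>C x"
    and scaleC_one: "1 *\<^sub>C x = x"
    and scaleR_scaleC: "t *\<^sub>R x = complex_of_real t *\<^sub>C x"

global_interpretation complex_vector: vector_space "scaleC :: complex \<Rightarrow> 'a \<Rightarrow> 'a::complex_vector"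
  defines cdim = complex_vector.dim
  by unfold_locales (simp_all add: scaleC_add_right scaleC_add_left scaleC_scaleC scaleC_one)

class complex_normed_vector = complex_vector + real_normed_vector +
  assumes norm_scaleC: "norm (a *\<^sub>C x) = cmod a * norm x"

class cbanach = complex_normed_vector + banach

class complex_inner = complex_normed_vector +
  fixes cinner :: "'a \<Rightarrow> 'a \<Rightarrow> complex"
  assumes cinner_commute: "cinner x y = cnj (cinner y x)"
    and cinner_add_left: "cinner (x + y) z = cinner x z + cinner y z"
    and cinner_scaleC_left: "cinner (a *\<^sub>C x) y = a * cinner x y"
    and cinner_self: "cinner x x = complex_of_real ((norm x)\<^sup>2)"

class chilbert_space = complex_inner + cbanach

definition bounded_clinear :: "('a::complex_normed_vector \<Rightarrow> 'b::complex_normed_vector) \<Rightarrow> bool" where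
  "bounded_clinear T \<longleftrightarrow> bounded_linear T \<and> (\<forall>c x. T (c *\<^sub>C x) = c *\<^sub>C T x)"

instantiation complex :: cbanach
begin
definition scaleC_complex :: "complex \<Rightarrow> complex \<Rightarrow> complex" where
  "scaleC_complex = (*)"
instance
  by standard (simp_all add: scaleC_complex_def algebra_simps scaleR_conv_of_real norm_mult)
end


section \<open>The space \<open>C(G,Y)\<close>\<close>

text \<open>On a compact space every continuous function is bounded, so the type of bounded continuous
  functions is \<open>C(G,Y)\<close> with the sup norm.\<close>

lemma bounded_linear_scaleC: "bounded_linear (\<lambda>x::'a::complex_normed_vector. c *\<^sub>C x)"
proof (rule bounded_linear_intro[where K = "cmod c"])
  show "c *\<^sub>C (x + y) = c *\<^sub>C x + c *\<^sub>C y" for x y :: 'a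
    by (rule scaleC_add_right)
  show "c *\<^sub>C (t *\<^sub>R x) = t *\<^sub>R (c *\<^sub>C x)" for t and x :: 'a
    by (simp add: scaleR_scaleC scaleC_scaleC mult.commute)
  show "norm (c *\<^sub>C x) \<le> norm x * cmod c" for x :: 'a
    by (simp add: norm_scaleC mult.commute)
qed

unbundle bcontfun.lifting

lemma scaleC_cont: "g \<in> bcontfun \<Longrightarrow> (\<lambda>x. c *\<^sub>C g x) \<in> bcontfun"
  for g :: "'a::topological_space \<Rightarrow> 'b::complex_normed_vector"
  unfolding bcontfun_def
  by (auto intro!: bounded_linear.continuous_on[OF bounded_linear_scaleC]
      bounded_linear_image[OF _ bounded_linear_scaleC, where S = "range g", unfolded image_image])

instantiation bcontfun :: (topological_space, complex_normed_vector) complex_normed_vector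
begin
lift_definition scaleC_bcontfun :: "complex \<Rightarrow> ('a \<Rightarrow>\<^sub>C 'b) \<Rightarrow> 'a \<Rightarrow>\<^sub>C 'b"
  is "\<lambda>c g x. c *\<^sub>C g x" by (rule scaleC_cont)
instance
proof
  fix a b :: complex and t :: real and x y :: "'a \<Rightarrow>\<^sub>C 'b"
  show "a *\<^sub>C (x + y) = a *\<^sub>C x + a *\<^sub>C y" by transfer (simp add: scaleC_add_right)
  show "(a + b) *\<^sub>C x = a *\<^sub>C x + b *\<^sub>C x" by transfer (simp add: scaleC_add_left)
  show "a *\<^sub>C (b *\<^sub>C x) = (a * b) *\<^sub>C x" by transfer (simp add: scaleC_scaleC)
  show "1 *\<^sub>C x = x" by transfer (simp add: scaleC_one)
  show "t *\<^sub>R x = complex_of_real t *\<^sub>C x" by transfer (simp add: scaleR_scaleC)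
  have le: "norm (c *\<^sub>C z) \<le> cmod c * norm z" for c and z :: "'a \<Rightarrow>\<^sub>C 'b"
    by (rule norm_bound)
      (simp add: scaleC_bcontfun.rep_eq norm_scaleC mult_left_mono norm_bounded)
  show "norm (a *\<^sub>C x) = cmod a * norm x"
  proof (cases "a = 0")
    case True
    then show ?thesis using le[of 0 x] by simp
  next
    case False
    have "inverse a *\<^sub>C (a *\<^sub>C x) = x"
      using False by transfer (simp add: scaleC_scaleC scaleC_one)
    then have "norm x \<le> cmod (inverse a) * norm (a *\<^sub>C x)"
      using le[of "inverse a" "a *\<^sub>C x"] by simp
    then have "cmod a * norm x \<le> norm (a *\<^sub>C x)"
      using False by (simp add: norm_divide field_simps)
    then show ?thesis using le[of a x] by simp
  qed
qed
end


section \<open>The space \<open>M(G,X)\<close>\<close>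

definition variation :: "('g::topological_space set \<Rightarrow> 'x::real_normed_vector) \<Rightarrow> 'g set \<Rightarrow> ennreal" where
  "variation \<mu> E =
    (SUP P \<in> {P. finite P \<and> P \<subseteq> sets borel \<and> partition_on E P}. \<Sum>A\<in>P. ennreal (norm (\<mu> A)))"

definition regular_vm :: "('g::topological_space set \<Rightarrow> 'x::real_normed_vector) \<Rightarrow> bool" where
  "regular_vm \<mu> \<longleftrightarrow> (\<forall>E\<in>sets borel. \<forall>e>0. \<exists>K V. compact K \<and> K \<subseteq> E \<and> open V \<and> E \<subseteq> V \<and>
     variation \<mu> (V - K) < ennreal e)"

definition countably_additive_vm :: "('g::topological_space set \<Rightarrow> 'x::real_normed_vector) \<Rightarrow> bool" where
  "countably_additive_vm \<mu> \<longleftrightarrow> (\<forall>A::nat \<Rightarrow> 'g set.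
     range A \<subseteq> sets borel \<and> disjoint_family A \<longrightarrow> (\<lambda>n. \<mu> (A n)) sums \<mu> (\<Union>n. A n))"

lemma variation_mono:
  assumes "E \<subseteq> F" "E \<in> sets borel" "F \<in> sets borel"
  shows "variation \<mu> E \<le> variation \<mu> F"
  unfolding variation_def
proof (rule SUP_least)
  fix P assume "P \<in> {P. finite P \<and> P \<subseteq> sets borel \<and> partition_on E P}"
  then have P: "finite P" "P \<subseteq> sets borel" "partition_on E P" by auto
  define Q where "Q = (if F - E = {} then P else insert (F - E) P)"
  have "finite Q" "Q \<subseteq> sets borel" using P assms by (auto simp: Q_def)
  moreover have "partition_on F Q"
    using P(3) assms(1) unfolding Q_def partition_on_def disjoint_def by (auto split: if_splits)
  moreover have "(\<Sum>A\<in>P. ennreal (norm (\<mu> A))) \<le> (\<Sum>A\<in>Q. ennreal (norm (\<mu> A)))"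
    by (rule sum_mono2) (use P in \<open>auto simp: Q_def\<close>)
  ultimately show "(\<Sum>A\<in>P. ennreal (norm (\<mu> A))) \<le>
    (SUP P \<in> {P. finite P \<and> P \<subseteq> sets borel \<and> partition_on F P}. \<Sum>A\<in>P. ennreal (norm (\<mu> A)))"
    by (intro SUP_upper2[of Q]) auto
qed

lemma norm_le_variation:
  assumes "E \<in> sets borel" "\<mu> {} = 0"
  shows "ennreal (norm (\<mu> E)) \<le> variation \<mu> E"
proof (cases "E = {}")
  case False
  then show ?thesis unfolding variation_def
    by (intro SUP_upper2[of "{E}"]) (use assms in \<open>auto simp: partition_on_def\<close>)
qed (use assms in simp)

lemma variation_add: "variation (\<lambda>E. \<mu> E + \<nu> E) E \<le> variation \<mu> E + variation \<nu> E"
proof -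
  have "(\<Sum>A\<in>P. ennreal (norm (\<mu> A + \<nu> A))) \<le> variation \<mu> E + variation \<nu> E"
    if "finite P" "P \<subseteq> sets borel" "partition_on E P" for P
  proof -
    have "(\<Sum>A\<in>P. ennreal (norm (\<mu> A + \<nu> A))) \<le>
        (\<Sum>A\<in>P. ennreal (norm (\<mu> A)) + ennreal (norm (\<nu> A)))"
      by (intro sum_mono) (simp add: norm_triangle_ineq flip: ennreal_plus)
    also have "\<dots> = (\<Sum>A\<in>P. ennreal (norm (\<mu> A))) + (\<Sum>A\<in>P. ennreal (norm (\<nu> A)))"
      by (rule sum.distrib)
    also have "\<dots> \<le> variation \<mu> E + variation \<nu> E"
      unfolding variation_def using that by (intro add_mono SUP_upper) auto
    finally show ?thesis .
  qed
  then show ?thesis by (subst variation_def) (auto intro!: SUP_least)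
qed

lemma variation_scaleC:
  fixes \<mu> :: "'g::topological_space set \<Rightarrow> 'x::complex_normed_vector"
  shows "variation (\<lambda>E. c *\<^sub>C \<mu> E) E = ennreal (cmod c) * variation \<mu> E"
proof -
  have "(\<Sum>A\<in>P. ennreal (norm (c *\<^sub>C \<mu> A))) = ennreal (cmod c) * (\<Sum>A\<in>P. ennreal (norm (\<mu> A)))" for P
    unfolding sum_distrib_left by (rule sum.cong) (simp_all only: norm_scaleC ennreal_mult norm_ge_zero)
  then show ?thesis
    unfolding variation_def SUP_mult_left_ennreal by (intro arg_cong[where f = Sup] image_cong refl)
qed

text \<open>A measure is represented by its set function on the Borel sets, put to \<open>0\<close> on all other sets
  in order to make the representation unique.  \<open>M(G)\<close> is the case \<open>'x = complex\<close>.\<close>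

typedef (overloaded) ('g::t2_space, 'x::complex_normed_vector) vmeasure =
  "{\<mu> :: 'g set \<Rightarrow> 'x. (\<forall>E. E \<notin> sets borel \<longrightarrow> \<mu> E = 0) \<and> countably_additive_vm \<mu> \<and>
     variation \<mu> UNIV < \<infinity> \<and> regular_vm \<mu>}"
  morphisms measure_of_vm Abs_vmeasure
proof -
  have [simp]: "variation (\<lambda>_. 0::'x) E = 0" for E :: "'g set"
    by (auto simp: variation_def bot_ennreal intro!: antisym SUP_least)
  have "regular_vm (\<lambda>_::'g set. 0::'x)"
    unfolding regular_vm_def by (intro ballI allI impI exI[of _ "{}"] exI[of _ UNIV]) simp
  then show ?thesis
    by (intro exI[of _ "\<lambda>_. 0"]) (simp add: countably_additive_vm_def)
qed

setup_lifting type_definition_vmeasure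

lemma regular_vm_add:
  fixes \<mu> \<nu> :: "'g::t2_space set \<Rightarrow> 'x::real_normed_vector"
  assumes "regular_vm \<mu>" "regular_vm \<nu>"
  shows "regular_vm (\<lambda>E. \<mu> E + \<nu> E)"
  unfolding regular_vm_def
proof (intro ballI allI impI)
  fix E :: "'g set" and e :: real assume E: "E \<in> sets borel" and e: "e > 0"
  obtain K1 V1 where 1: "compact K1" "K1 \<subseteq> E" "open V1" "E \<subseteq> V1"
    "variation \<mu> (V1 - K1) < ennreal (e / 2)"
    using assms(1) E e unfolding regular_vm_def by (meson half_gt_zero)
  obtain K2 V2 where 2: "compact K2" "K2 \<subseteq> E" "open V2" "E \<subseteq> V2"
    "variation \<nu> (V2 - K2) < ennreal (e / 2)"
    using assms(2) E e unfolding regular_vm_def by (meson half_gt_zero)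
  let ?K = "K1 \<union> K2" and ?V = "V1 \<inter> V2"
  have B: "V1 - K1 \<in> sets borel" "V2 - K2 \<in> sets borel" "?V - ?K \<in> sets borel"
    using 1 2 by (simp_all add: borel_open borel_closed compact_imp_closed sets.Diff sets.Un sets.Int)
  have "variation (\<lambda>E. \<mu> E + \<nu> E) (?V - ?K) \<le> variation \<mu> (?V - ?K) + variation \<nu> (?V - ?K)"
    by (rule variation_add)
  also have "\<dots> \<le> variation \<mu> (V1 - K1) + variation \<nu> (V2 - K2)"
    using B by (intro add_mono variation_mono) auto
  also have "\<dots> < ennreal (e / 2) + ennreal (e / 2)"
    using 1(5) 2(5) by (rule add_strict_mono)
  also have "\<dots> = ennreal e" using e by (simp flip: ennreal_plus)
  finally have "variation (\<lambda>E. \<mu> E + \<nu> E) (?V - ?K) < ennreal e" .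
  then show "\<exists>K V. compact K \<and> K \<subseteq> E \<and> open V \<and> E \<subseteq> V \<and> variation (\<lambda>E. \<mu> E + \<nu> E) (V - K) < ennreal e"
    using 1 2 by (intro exI[of _ ?K] exI[of _ ?V]) auto
qed

lemma regular_vm_scaleC:
  fixes \<mu> :: "'g::t2_space set \<Rightarrow> 'x::complex_normed_vector"
  assumes "regular_vm \<mu>"
  shows "regular_vm (\<lambda>E. c *\<^sub>C \<mu> E)"
  unfolding regular_vm_def
proof (intro ballI allI impI)
  fix E :: "'g set" and e :: real assume E: "E \<in> sets borel" and e: "e > 0"
  define d where "d = e / (cmod c + 1)"
  have d: "d > 0" "cmod c * d < e"
    using e by (auto simp: d_def field_simps add_pos_nonneg)
  obtain K V where KV: "compact K" "K \<subseteq> E" "open V" "E \<subseteq> V" "variation \<mu> (V - K) < ennreal d"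
    using assms E d unfolding regular_vm_def by meson
  have "ennreal (cmod c) * variation \<mu> (V - K) \<le> ennreal (cmod c) * ennreal d"
    using KV by (intro mult_left_mono) auto
  also have "\<dots> < ennreal e" using d e by (simp add: ennreal_lessI flip: ennreal_mult)
  finally show "\<exists>K V. compact K \<and> K \<subseteq> E \<and> open V \<and> E \<subseteq> V \<and> variation (\<lambda>E. c *\<^sub>C \<mu> E) (V - K) < ennreal e"
    using KV by (auto simp: variation_scaleC)
qed

instantiation vmeasure :: (t2_space, complex_normed_vector) complex_normed_vector
begin

lift_definition zero_vmeasure :: "('a, 'b) vmeasure" is "\<lambda>_. 0"
proof -
  have [simp]: "variation (\<lambda>_. 0::'b) E = 0" for E :: "'a set"
    by (auto simp: variation_def bot_ennreal intro!: antisym SUP_least)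
  have "regular_vm (\<lambda>_::'a set. 0::'b)"
    unfolding regular_vm_def by (intro ballI allI impI exI[of _ "{}"] exI[of _ UNIV]) simp
  then show "(\<forall>E. E \<notin> sets borel \<longrightarrow> (0::'b) = 0) \<and> countably_additive_vm (\<lambda>_::'a set. 0::'b) \<and>
      variation (\<lambda>_::'a set. 0::'b) UNIV < \<infinity> \<and> regular_vm (\<lambda>_::'a set. 0::'b)"
    by (simp add: countably_additive_vm_def)
qed

lift_definition plus_vmeasure :: "('a, 'b) vmeasure \<Rightarrow> ('a, 'b) vmeasure \<Rightarrow> ('a, 'b) vmeasure"
  is "\<lambda>\<mu> \<nu> E. \<mu> E + \<nu> E"
proof -
  fix \<mu> \<nu> :: "'a set \<Rightarrow> 'b"
  assume a: "(\<forall>E. E \<notin> sets borel \<longrightarrow> \<mu> E = 0) \<and> countably_additive_vm \<mu> \<and> variation \<mu> UNIV < \<infinity> \<and> regular_vm \<mu>"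
    and b: "(\<forall>E. E \<notin> sets borel \<longrightarrow> \<nu> E = 0) \<and> countably_additive_vm \<nu> \<and> variation \<nu> UNIV < \<infinity> \<and> regular_vm \<nu>"
  have "countably_additive_vm (\<lambda>E. \<mu> E + \<nu> E)"
    using a b by (auto simp: countably_additive_vm_def intro!: sums_add)
  moreover have "variation (\<lambda>E. \<mu> E + \<nu> E) UNIV < \<infinity>"
    using a b by (intro order.strict_trans1[OF variation_add]) (simp add: ennreal_add_less_top)
  ultimately show "(\<forall>E. E \<notin> sets borel \<longrightarrow> \<mu> E + \<nu> E = 0) \<and> countably_additive_vm (\<lambda>E. \<mu> E + \<nu> E) \<and>
      variation (\<lambda>E. \<mu> E + \<nu> E) UNIV < \<infinity> \<and> regular_vm (\<lambda>E. \<mu> E + \<nu> E)"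
    using a b by (auto intro: regular_vm_add)
qed

lift_definition scaleC_vmeasure :: "complex \<Rightarrow> ('a, 'b) vmeasure \<Rightarrow> ('a, 'b) vmeasure"
  is "\<lambda>c \<mu> E. c *\<^sub>C \<mu> E"
proof -
  fix c and \<mu> :: "'a set \<Rightarrow> 'b"
  assume a: "(\<forall>E. E \<notin> sets borel \<longrightarrow> \<mu> E = 0) \<and> countably_additive_vm \<mu> \<and> variation \<mu> UNIV < \<infinity> \<and> regular_vm \<mu>"
  have "countably_additive_vm (\<lambda>E. c *\<^sub>C \<mu> E)"
    using a by (auto simp: countably_additive_vm_def intro!: bounded_linear.sums[OF bounded_linear_scaleC])
  then show "(\<forall>E. E \<notin> sets borel \<longrightarrow> c *\<^sub>C \<mu> E = 0) \<and> countably_additive_vm (\<lambda>E. c *\<^sub>C \<mu> E) \<and>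
      variation (\<lambda>E. c *\<^sub>C \<mu> E) UNIV < \<infinity> \<and> regular_vm (\<lambda>E. c *\<^sub>C \<mu> E)"
    using a by (auto simp: variation_scaleC ennreal_mult_less_top intro: regular_vm_scaleC)
qed

definition "uminus_vmeasure (\<mu>::('a,'b) vmeasure) = (-1) *\<^sub>C \<mu>"
definition "minus_vmeasure (\<mu>::('a,'b) vmeasure) \<nu> = \<mu> + - \<nu>"
definition "scaleR_vmeasure t (\<mu>::('a,'b) vmeasure) = complex_of_real t *\<^sub>C \<mu>"
definition "norm_vmeasure (\<mu>::('a,'b) vmeasure) = enn2real (variation (measure_of_vm \<mu>) UNIV)"
definition "sgn_vmeasure (\<mu>::('a,'b) vmeasure) = inverse (norm \<mu>) *\<^sub>R \<mu>"
definition "dist_vmeasure (\<mu>::('a,'b) vmeasure) \<nu> = norm (\<mu> - \<nu>)"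
definition "uniformity_vmeasure =
  (INF e\<in>{0 <..}. principal {(x::('a,'b) vmeasure, y). dist x y < e})"
definition "open_vmeasure (S::('a,'b) vmeasure set) \<longleftrightarrow>
  (\<forall>x\<in>S. \<forall>\<^sub>F (x', y) in uniformity. x' = x \<longrightarrow> y \<in> S)"

instance
proof
  fix \<mu> \<nu> \<rho> :: "('a, 'b) vmeasure" and a b :: complex and t u :: real
  have m1: "(-1) *\<^sub>C x = - x" for x :: 'b
    using scaleR_scaleC[of "-1" x] by simp
  show "\<mu> + \<nu> + \<rho> = \<mu> + (\<nu> + \<rho>)" by transfer (simp add: add.assoc)
  show "\<mu> + \<nu> = \<nu> + \<mu>" by transfer (simp add: add.commute)
  show "0 + \<mu> = \<mu>" by transfer simp
  show "- \<mu> + \<mu> = 0" unfolding uminus_vmeasure_def by transfer (simp add: m1)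
  show "\<mu> - \<nu> = \<mu> + - \<nu>" by (rule minus_vmeasure_def)
  show R: "t *\<^sub>R \<mu> = complex_of_real t *\<^sub>C \<mu>" for t and \<mu> :: "('a, 'b) vmeasure" by (rule scaleR_vmeasure_def)
  show C1: "a *\<^sub>C (\<mu> + \<nu>) = a *\<^sub>C \<mu> + a *\<^sub>C \<nu>" for a by transfer (simp add: scaleC_add_right)
  show C2: "(a + b) *\<^sub>C \<mu> = a *\<^sub>C \<mu> + b *\<^sub>C \<mu>" for a b by transfer (simp add: scaleC_add_left)
  show C3: "a *\<^sub>C (b *\<^sub>C \<mu>) = (a * b) *\<^sub>C \<mu>" for a b by transfer (simp add: scaleC_scaleC)
  show C4: "1 *\<^sub>C \<mu> = \<mu>" by transfer (simp add: scaleC_one)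
  show "t *\<^sub>R (\<mu> + \<nu>) = t *\<^sub>R \<mu> + t *\<^sub>R \<nu>" "(t + u) *\<^sub>R \<mu> = t *\<^sub>R \<mu> + u *\<^sub>R \<mu>"
    "t *\<^sub>R u *\<^sub>R \<mu> = (t * u) *\<^sub>R \<mu>" "1 *\<^sub>R \<mu> = \<mu>"
    by (simp_all add: R C1 C2 C3 C4)
  show "dist \<mu> \<nu> = norm (\<mu> - \<nu>)" by (rule dist_vmeasure_def)
  show "sgn \<mu> = inverse (norm \<mu>) *\<^sub>R \<mu>" by (rule sgn_vmeasure_def)
  show "uniformity = (INF e\<in>{0 <..}. principal {(x::('a,'b) vmeasure, y). dist x y < e})"
    by (rule uniformity_vmeasure_def)
  show "open S \<longleftrightarrow> (\<forall>x\<in>S. \<forall>\<^sub>F (x', y) in uniformity. x' = x \<longrightarrow> y \<in> S)" for S :: "('a,'b) vmeasure set"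
    by (rule open_vmeasure_def)
  have fin: "variation (measure_of_vm \<mu>) UNIV < top" for \<mu> :: "('a, 'b) vmeasure"
    using measure_of_vm[of \<mu>] by simp
  show NC: "norm (a *\<^sub>C \<mu>) = cmod a * norm \<mu>" for a
    by (simp add: norm_vmeasure_def scaleC_vmeasure.rep_eq variation_scaleC enn2real_mult)
  show "norm (t *\<^sub>R \<mu>) = \<bar>t\<bar> * norm \<mu>" by (simp add: R NC)
  show "norm (\<mu> + \<nu>) \<le> norm \<mu> + norm \<nu>"
  proof -
    have "norm (\<mu> + \<nu>) \<le> enn2real (variation (measure_of_vm \<mu>) UNIV + variation (measure_of_vm \<nu>) UNIV)"
      unfolding norm_vmeasure_def plus_vmeasure.rep_eq
      using fin[of \<mu>] fin[of \<nu>] by (intro enn2real_mono variation_add) (simp add: ennreal_add_less_top)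
    also have "\<dots> = norm \<mu> + norm \<nu>"
      using fin[of \<mu>] fin[of \<nu>] by (simp add: norm_vmeasure_def enn2real_plus)
    finally show ?thesis .
  qed
  show "norm \<mu> = 0 \<longleftrightarrow> \<mu> = 0"
  proof
    assume "norm \<mu> = 0"
    then have v: "variation (measure_of_vm \<mu>) UNIV = 0"
      using fin[of \<mu>] by (auto simp: norm_vmeasure_def enn2real_eq_0_iff)
    have "(\<lambda>n::nat. measure_of_vm \<mu> {}) sums measure_of_vm \<mu> (\<Union>n::nat. {})"
      using measure_of_vm[of \<mu>] by (auto simp: countably_additive_vm_def disjoint_family_on_def)
    then have "summable (\<lambda>n::nat. measure_of_vm \<mu> {})" by (rule sums_summable)
    then have e: "measure_of_vm \<mu> {} = 0"
      using summable_LIMSEQ_zero LIMSEQ_const_iff by blast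
    have "measure_of_vm \<mu> E = 0" for E
    proof (cases "E \<in> sets borel")
      case True
      have "ennreal (norm (measure_of_vm \<mu> E)) \<le> variation (measure_of_vm \<mu>) UNIV"
        using norm_le_variation[OF True, of "measure_of_vm \<mu>"] variation_mono[of E UNIV "measure_of_vm \<mu>"] True e
        by (auto intro: order_trans)
      then show ?thesis using v by simp
    next
      case False
      then show ?thesis using measure_of_vm[of \<mu>] by simp
    qed
    then show "\<mu> = 0" by transfer auto
  next
    assume "\<mu> = 0"
    moreover have "variation (\<lambda>_. 0::'b) (UNIV::'a set) = 0"
      by (auto simp: variation_def bot_ennreal intro!: antisym SUP_least)
    ultimately show "norm \<mu> = 0" by (simp add: norm_vmeasure_def zero_vmeasure.rep_eq)
  qed
qed
end


section \<open>The operators \<open>\<star>f\<close> and \<open>T\<^sub>f\<close>\<close>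

text \<open>Integrals of scalar functions against a vector measure: the limit of the integrals of any
  sequence of simple functions converging uniformly to the integrand (such sequences exist for
  every bounded Borel function, and the limit does not depend on the sequence).\<close>

definition simple_vm_integral ::
    "('g::topological_space set \<Rightarrow> 'x::complex_normed_vector) \<Rightarrow> ('g \<Rightarrow> complex) \<Rightarrow> 'x" where
  "simple_vm_integral \<mu> \<phi> = (\<Sum>c\<in>range \<phi>. c *\<^sub>C \<mu> (\<phi> -` {c}))"

definition has_vm_integral ::
    "('g::topological_space set \<Rightarrow> 'x::complex_normed_vector) \<Rightarrow> ('g \<Rightarrow> complex) \<Rightarrow> 'x \<Rightarrow> bool" where
  "has_vm_integral \<mu> \<phi> I \<longleftrightarrow> (\<exists>\<psi>. (\<forall>n. simple_function borel (\<psi> n)) \<and>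
     uniform_limit UNIV \<psi> \<phi> sequentially \<and> (\<lambda>n. simple_vm_integral \<mu> (\<psi> n)) \<longlonglongrightarrow> I)"

definition vm_integral ::
    "('g::topological_space set \<Rightarrow> 'x::complex_normed_vector) \<Rightarrow> ('g \<Rightarrow> complex) \<Rightarrow> 'x" where
  "vm_integral \<mu> \<phi> = (THE I. has_vm_integral \<mu> \<phi> I)"

definition convolution_op :: "('g::{topological_ab_group_add,t2_space} \<Rightarrow>\<^sub>C complex) \<Rightarrow>
    ('g, complex) vmeasure \<Rightarrow> ('g \<Rightarrow>\<^sub>C complex)" where
  "convolution_op f \<mu> = Bcontfun (\<lambda>g. vm_integral (measure_of_vm \<mu>) (\<lambda>h. f (g - h)))"

definition vector_convolution_op :: "('x::complex_normed_vector \<Rightarrow> 'y::complex_normed_vector) \<Rightarrow>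
    ('g::{topological_ab_group_add,t2_space} \<Rightarrow>\<^sub>C complex) \<Rightarrow> ('g, 'x) vmeasure \<Rightarrow> ('g \<Rightarrow>\<^sub>C 'y)" where
  "vector_convolution_op T f \<mu> =
    Bcontfun (\<lambda>g. vm_integral (\<lambda>E. T (measure_of_vm \<mu> E)) (\<lambda>t. f (g - t)))"


section \<open>Lorentz--Schatten classes\<close>

definition cadjoint :: "('h::chilbert_space \<Rightarrow> 'h) \<Rightarrow> 'h \<Rightarrow> 'h" where
  "cadjoint U = (SOME V. \<forall>x y. cinner (U x) y = cinner x (V y))"

definition compact_op :: "('h::chilbert_space \<Rightarrow> 'h) \<Rightarrow> bool" where
  "compact_op U \<longleftrightarrow> bounded_clinear U \<and> compact (closure (U ` cball 0 1))"

text \<open>The singular numbers of \<open>U\<close> are the square roots of the eigenvalues of \<open>U\<^sup>*U\<close>, arranged in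
  decreasing order, repeated according to multiplicity, and continued by \<open>0\<close> if there are only finitely
  many positive ones.  The sequence is indexed from \<open>0\<close>: \<open>\<sigma> n\<close> is the \<open>(n+1)\<close>-st singular number.\<close>

definition singular_numbers :: "('h::chilbert_space \<Rightarrow> 'h) \<Rightarrow> (nat \<Rightarrow> real) \<Rightarrow> bool" where
  "singular_numbers U \<sigma> \<longleftrightarrow> decseq \<sigma> \<and> (\<forall>n. 0 \<le> \<sigma> n) \<and> \<sigma> \<longlonglongrightarrow> 0 \<and>
     (\<forall>a>0. card {n. \<sigma> n = a} = cdim {x. cadjoint U (U x) = a\<^sup>2 *\<^sub>R x})"

definition lorentz_schatten :: "real \<Rightarrow> real \<Rightarrow> ('h::chilbert_space \<Rightarrow> 'h) set" where
  "lorentz_schatten r s = {U. compact_op U \<and>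
     (\<exists>\<sigma>. singular_numbers U \<sigma> \<and> summable (\<lambda>n. real (Suc n) powr (s / r - 1) * \<sigma> n powr s))}"

text \<open>The Hilbert space through which \<open>S\<close> factors is passed as a type, since one cannot quantify over
  types inside a formula.\<close>

definition factors_through_lorentz_schatten ::
    "real \<Rightarrow> real \<Rightarrow> 'h::chilbert_space itself \<Rightarrow>
     ('z::complex_normed_vector \<Rightarrow> 'w::complex_normed_vector) \<Rightarrow> bool" where
  "factors_through_lorentz_schatten r s (H::'h itself) S \<longleftrightarrow>
    (\<exists>(A::'z \<Rightarrow> 'h) (U::'h \<Rightarrow> 'h) (B::'h \<Rightarrow> 'w).
       bounded_clinear A \<and> U \<in> lorentz_schatten r s \<and> bounded_clinear B \<and> S = B \<circ> U \<circ> A)"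


section \<open>The Hilbert space \<open>\<ell>\<^sub>2\<close>\<close>

text \<open>Factoring through an operator of the class on some Hilbert space is the same as factoring
  through one on \<open>\<ell>\<^sub>2\<close>: a compact operator vanishes on the orthogonal complement of a separable
  subspace, has separable range, and separable Hilbert spaces embed isometrically into \<open>\<ell>\<^sub>2\<close>.\<close>

typedef ell2 = "{x :: nat \<Rightarrow> complex. summable (\<lambda>n. (cmod (x n))\<^sup>2)}"
  morphisms ell2_coord Abs_ell2
  by (intro exI[of _ "\<lambda>_. 0"]) simp

setup_lifting type_definition_ell2

lemma ell2_add_bound:
  assumes "summable (\<lambda>n. (cmod (x n))\<^sup>2)" "summable (\<lambda>n. (cmod (y n))\<^sup>2)"
  shows "summable (\<lambda>n. (cmod (x n + y n))\<^sup>2)"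
    and "sqrt (\<Sum>n. (cmod (x n + y n))\<^sup>2) \<le> sqrt (\<Sum>n. (cmod (x n))\<^sup>2) + sqrt (\<Sum>n. (cmod (y n))\<^sup>2)"
      (is "_ \<le> ?b")
proof -
  have part: "(\<Sum>n<N. (cmod (x n + y n))\<^sup>2) \<le> ?b\<^sup>2" for N
  proof -
    have "L2_set (\<lambda>n. cmod (x n + y n)) {..<N} \<le> L2_set (\<lambda>n. cmod (x n) + cmod (y n)) {..<N}"
      by (rule L2_set_mono) (auto simp: norm_triangle_ineq)
    also have "\<dots> \<le> L2_set (\<lambda>n. cmod (x n)) {..<N} + L2_set (\<lambda>n. cmod (y n)) {..<N}"
      by (rule L2_set_triangle_ineq)
    also have "\<dots> \<le> ?b"
      unfolding L2_set_def using assms by (intro add_mono real_sqrt_le_mono sum_le_suminf) auto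
    finally have "(L2_set (\<lambda>n. cmod (x n + y n)) {..<N})\<^sup>2 \<le> ?b\<^sup>2"
      by (intro power_mono) auto
    then show ?thesis by (simp add: L2_set_def sum_nonneg)
  qed
  show s: "summable (\<lambda>n. (cmod (x n + y n))\<^sup>2)"
    by (rule summableI_nonneg_bounded[OF _ part]) simp
  have "(\<Sum>n. (cmod (x n + y n))\<^sup>2) \<le> ?b\<^sup>2"
    by (rule suminf_le_const[OF s part])
  moreover have "0 \<le> ?b" using assms by (intro add_nonneg_nonneg real_sqrt_ge_zero suminf_nonneg) auto
  ultimately show "sqrt (\<Sum>n. (cmod (x n + y n))\<^sup>2) \<le> ?b"
    by (metis real_sqrt_abs abs_of_nonneg real_sqrt_le_mono)
qed

lemma ell2_summable_mult:
  assumes "summable (\<lambda>n. (cmod (x n))\<^sup>2)" "summable (\<lambda>n. (cmod (y n))\<^sup>2)"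
  shows "summable (\<lambda>n. x n * cnj (y n))"
proof (rule summable_comparison_test[OF _ summable_add[OF assms]], intro exI allI impI)
  fix n
  have "0 \<le> (cmod (x n) - cmod (y n))\<^sup>2" "0 \<le> cmod (x n) * cmod (y n)" by simp_all
  then show "norm (x n * cnj (y n)) \<le> (cmod (x n))\<^sup>2 + (cmod (y n))\<^sup>2"
    unfolding norm_mult complex_mod_cnj power2_diff by linarith
qed

instantiation ell2 :: complex_inner
begin

lift_definition zero_ell2 :: ell2 is "\<lambda>_. 0" by simp
lift_definition plus_ell2 :: "ell2 \<Rightarrow> ell2 \<Rightarrow> ell2" is "\<lambda>x y n. x n + y n"
  by (rule ell2_add_bound)
lift_definition scaleC_ell2 :: "complex \<Rightarrow> ell2 \<Rightarrow> ell2" is "\<lambda>c x n. c * x n"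
  by (simp add: norm_mult power_mult_distrib summable_mult)
lift_definition uminus_ell2 :: "ell2 \<Rightarrow> ell2" is "\<lambda>x n. - x n" by simp
lift_definition cinner_ell2 :: "ell2 \<Rightarrow> ell2 \<Rightarrow> complex" is "\<lambda>x y. \<Sum>n. x n * cnj (y n)" .
lift_definition norm_ell2 :: "ell2 \<Rightarrow> real" is "\<lambda>x. sqrt (\<Sum>n. (cmod (x n))\<^sup>2)" .
definition "minus_ell2 (x::ell2) y = x + - y"
definition "scaleR_ell2 t (x::ell2) = complex_of_real t *\<^sub>C x"
definition "sgn_ell2 (x::ell2) = inverse (norm x) *\<^sub>R x"
definition "dist_ell2 (x::ell2) y = norm (x - y)"
definition "uniformity_ell2 = (INF e\<in>{0 <..}. principal {(x::ell2, y). dist x y < e})"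
definition "open_ell2 (S::ell2 set) \<longleftrightarrow> (\<forall>x\<in>S. \<forall>\<^sub>F (x', y) in uniformity. x' = x \<longrightarrow> y \<in> S)"

instance
proof
  fix x y z :: ell2 and a b :: complex and t u :: real
  show "x + y + z = x + (y + z)" by transfer (simp add: add.assoc)
  show "x + y = y + x" by transfer (simp add: add.commute)
  show "0 + x = x" by transfer simp
  show "- x + x = 0" by transfer simp
  show "x - y = x + - y" by (rule minus_ell2_def)
  show R: "t *\<^sub>R x = complex_of_real t *\<^sub>C x" for t by (rule scaleR_ell2_def)
  show C1: "a *\<^sub>C (x + y) = a *\<^sub>C x + a *\<^sub>C y" for a by transfer (simp add: algebra_simps)
  show C2: "(a + b) *\<^sub>C x = a *\<^sub>C x + b *\<^sub>C x" for a b by transfer (simp add: algebra_simps)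
  show C3: "a *\<^sub>C (b *\<^sub>C x) = (a * b) *\<^sub>C x" for a b by transfer (simp add: algebra_simps)
  show C4: "1 *\<^sub>C x = x" by transfer simp
  show "t *\<^sub>R (x + y) = t *\<^sub>R x + t *\<^sub>R y" "(t + u) *\<^sub>R x = t *\<^sub>R x + u *\<^sub>R x" "1 *\<^sub>R x = x"
    unfolding scaleR_ell2_def by (simp_all add: C1 C2 C4)
  show "t *\<^sub>R u *\<^sub>R x = (t * u) *\<^sub>R x"
    unfolding scaleR_ell2_def by (simp add: C3)
  show "dist x y = norm (x - y)" by (rule dist_ell2_def)
  show "sgn x = inverse (norm x) *\<^sub>R x" by (rule sgn_ell2_def)
  show "uniformity = (INF e\<in>{0 <..}. principal {(x::ell2, y). dist x y < e})"
    by (rule uniformity_ell2_def)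
  show "open S \<longleftrightarrow> (\<forall>x\<in>S. \<forall>\<^sub>F (x', y) in uniformity. x' = x \<longrightarrow> y \<in> S)" for S :: "ell2 set"
    by (rule open_ell2_def)
  show NC: "norm (a *\<^sub>C x) = cmod a * norm x" for a
    by transfer (simp add: norm_mult power_mult_distrib suminf_mult real_sqrt_mult)
  show "norm (t *\<^sub>R x) = \<bar>t\<bar> * norm x" by (simp add: R NC)
  show "norm (x + y) \<le> norm x + norm y" by transfer (rule ell2_add_bound)
  show "norm x = 0 \<longleftrightarrow> x = 0" by transfer (auto simp: suminf_eq_zero_iff)
  show "cinner x y = cnj (cinner y x)"
  proof transfer
    fix x y :: "nat \<Rightarrow> complex"
    assume "summable (\<lambda>n. (cmod (x n))\<^sup>2)" "summable (\<lambda>n. (cmod (y n))\<^sup>2)"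
    then have "(\<lambda>n. y n * cnj (x n)) sums (\<Sum>n. y n * cnj (x n))"
      by (intro summable_sums ell2_summable_mult)
    then have "(\<lambda>n. cnj (y n * cnj (x n))) sums cnj (\<Sum>n. y n * cnj (x n))"
      by (simp only: sums_cnj)
    then have "(\<lambda>n. x n * cnj (y n)) sums cnj (\<Sum>n. y n * cnj (x n))"
      by (simp add: mult.commute)
    then show "(\<Sum>n. x n * cnj (y n)) = cnj (\<Sum>n. y n * cnj (x n))"
      by (rule sums_unique[symmetric])
  qed
  show "cinner (x + y) z = cinner x z + cinner y z"
    by transfer (simp add: distrib_right suminf_add ell2_summable_mult)
  show "cinner (a *\<^sub>C x) y = a * cinner x y"
    by transfer (simp add: mult.assoc suminf_mult ell2_summable_mult)
  show "cinner x x = complex_of_real ((norm x)\<^sup>2)"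
  proof transfer
    fix x :: "nat \<Rightarrow> complex" assume x: "summable (\<lambda>n. (cmod (x n))\<^sup>2)"
    have "(\<Sum>n. x n * cnj (x n)) = (\<Sum>n. complex_of_real ((cmod (x n))\<^sup>2))"
      by (simp only: complex_norm_square)
    also have "\<dots> = complex_of_real (\<Sum>n. (cmod (x n))\<^sup>2)"
      by (rule suminf_of_real[OF x, symmetric])
    also have "\<dots> = complex_of_real ((sqrt (\<Sum>n. (cmod (x n))\<^sup>2))\<^sup>2)"
      using suminf_nonneg[OF x] by simp
    finally show "(\<Sum>n. x n * cnj (x n)) = complex_of_real ((sqrt (\<Sum>n. (cmod (x n))\<^sup>2))\<^sup>2)" .
  qed
qed
end

instance ell2 :: chilbert_space
proof
  fix X :: "nat \<Rightarrow> ell2" assume X: "Cauchy X"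
  have diff: "ell2_coord (u - v) n = ell2_coord u n - ell2_coord v n" for u v n
    by (simp only: minus_ell2_def plus_ell2.rep_eq uminus_ell2.rep_eq diff_conv_add_uminus)
  have summ: "summable (\<lambda>n. (cmod (ell2_coord u n))\<^sup>2)" for u
    using ell2_coord[of u] by simp
  have part: "(\<Sum>n<N. (cmod (ell2_coord u n))\<^sup>2) \<le> (norm u)\<^sup>2" for u N
    using sum_le_suminf[OF summ[of u], of "{..<N}"] suminf_nonneg[OF summ[of u]]
    by (simp add: norm_ell2.rep_eq)
  have coord: "cmod (ell2_coord u n) \<le> norm u" for u n
  proof -
    have "(cmod (ell2_coord u n))\<^sup>2 \<le> (\<Sum>n<Suc n. (cmod (ell2_coord u n))\<^sup>2)"
      by (simp add: sum_nonneg)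
    also have "\<dots> \<le> (norm u)\<^sup>2" by (rule part)
    finally show ?thesis by (rule power2_le_imp_le) simp
  qed
  have "\<exists>l. (\<lambda>k. ell2_coord (X k) n) \<longlonglongrightarrow> l" for n
  proof -
    have "Cauchy (\<lambda>k. ell2_coord (X k) n)"
    proof (rule metric_CauchyI)
      fix e :: real assume "e > 0"
      then obtain M where "\<forall>m\<ge>M. \<forall>k\<ge>M. dist (X m) (X k) < e" using X metric_CauchyD by blast
      moreover have "dist (ell2_coord (X m) n) (ell2_coord (X k) n) \<le> dist (X m) (X k)" for m k
        using coord[of "X m - X k" n] by (simp only: dist_norm diff)
      ultimately show "\<exists>M. \<forall>m\<ge>M. \<forall>k\<ge>M. dist (ell2_coord (X m) n) (ell2_coord (X k) n) < e"
        by (meson le_less_trans)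
    qed
    then show ?thesis by (simp add: Cauchy_convergent_iff convergent_def)
  qed
  then obtain l where l: "\<And>n. (\<lambda>k. ell2_coord (X k) n) \<longlonglongrightarrow> l n" by metis
  have bound: "\<exists>M. \<forall>m\<ge>M. \<forall>N. (\<Sum>n<N. (cmod (ell2_coord (X m) n - l n))\<^sup>2) \<le> e\<^sup>2" if "e > 0" for e :: real
  proof -
    obtain M where M: "\<forall>m\<ge>M. \<forall>k\<ge>M. dist (X m) (X k) < e" using X \<open>e > 0\<close> metric_CauchyD by blast
    have "(\<Sum>n<N. (cmod (ell2_coord (X m) n - l n))\<^sup>2) \<le> e\<^sup>2" if "m \<ge> M" for m N
    proof (rule LIMSEQ_le_const2)
      show "(\<lambda>k. \<Sum>n<N. (cmod (ell2_coord (X m) n - ell2_coord (X k) n))\<^sup>2) \<longlonglongrightarrow>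
          (\<Sum>n<N. (cmod (ell2_coord (X m) n - l n))\<^sup>2)"
        by (intro tendsto_intros l)
      have "(\<Sum>n<N. (cmod (ell2_coord (X m) n - ell2_coord (X k) n))\<^sup>2) \<le> e\<^sup>2" if "k \<ge> M" for k
      proof -
        have "norm (X m - X k) \<le> e" using M \<open>m \<ge> M\<close> that by (simp add: dist_norm less_imp_le)
        then have "(norm (X m - X k))\<^sup>2 \<le> e\<^sup>2" by (intro power_mono) auto
        then show ?thesis using part[of "X m - X k" N] by (simp add: diff)
      qed
      then show "\<exists>M. \<forall>k\<ge>M. (\<Sum>n<N. (cmod (ell2_coord (X m) n - ell2_coord (X k) n))\<^sup>2) \<le> e\<^sup>2" by blast
    qed
    then show ?thesis by blast
  qed
  obtain M1 where M1: "\<And>N. (\<Sum>n<N. (cmod (ell2_coord (X M1) n - l n))\<^sup>2) \<le> 1\<^sup>2"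
    using bound[of 1] by auto
  have s1: "summable (\<lambda>n. (cmod (ell2_coord (X M1) n - l n))\<^sup>2)"
    by (rule summableI_nonneg_bounded[OF _ M1]) simp
  then have "summable (\<lambda>n. (cmod (l n - ell2_coord (X M1) n))\<^sup>2)"
    by (simp add: norm_minus_commute)
  from ell2_add_bound(1)[OF this summ[of "X M1"]] have sl: "summable (\<lambda>n. (cmod (l n))\<^sup>2)" by simp
  define L where "L = Abs_ell2 l"
  have L: "ell2_coord L = l" using sl by (simp add: L_def Abs_ell2_inverse)
  have "X \<longlonglongrightarrow> L"
  proof (rule metric_LIMSEQ_I)
    fix e :: real assume "e > 0"
    then obtain M where M: "\<And>m N. m \<ge> M \<Longrightarrow> (\<Sum>n<N. (cmod (ell2_coord (X m) n - l n))\<^sup>2) \<le> (e/2)\<^sup>2"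
      using bound[of "e/2"] by auto
    have "dist (X m) L < e" if "m \<ge> M" for m
    proof -
      have "(\<Sum>n. (cmod (ell2_coord (X m - L) n))\<^sup>2) \<le> (e/2)\<^sup>2"
        by (rule suminf_le_const[OF summ]) (use M[OF that] in \<open>simp add: diff L\<close>)
      then have "norm (X m - L) \<le> e/2"
        using \<open>e > 0\<close> unfolding norm_ell2.rep_eq by (intro real_le_lsqrt) auto
      then show ?thesis using \<open>e > 0\<close> by (simp add: dist_norm)
    qed
    then show "\<exists>M. \<forall>m\<ge>M. dist (X m) L < e" by blast
  qed
  then show "convergent X" by (rule convergentI)
qed

end

theory Submission
  imports Defs
begin

text \<open>
  By the singular value decomposition, an operator that factors through \<open>S\<^sub>r\<^sub>,\<^sub>s\<close> factors through a
  diagonal operator on \<open>\<ell>\<^sub>2\<close>, say \<open>\<star>f = B\<^sub>1 D\<^sub>\<sigma> A\<^sub>1\<close> and \<open>T = B\<^sub>2 D\<^sub>\<tau> A\<^sub>2\<close>.  Then \<open>T\<^sub>f = B D A\<close> on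
  \<open>\<ell>\<^sub>2(\<nat> \<times> \<nat>)\<close>, where \<open>D\<close> is diagonal with entries \<open>\<sigma>\<^sub>i \<tau>\<^sub>j\<close>, \<open>A \<mu>\<close> has the coordinates \<open>(A\<^sub>1 \<mu>\<^sub>j)\<^sub>i\<close>
  with \<open>\<mu>\<^sub>j\<close> the \<open>j\<close>-th coordinate of the \<open>\<ell>\<^sub>2\<close>-valued measure \<open>A\<^sub>2 \<circ> \<mu>\<close>, and \<open>B z\<close> at \<open>g\<close> is \<open>B\<^sub>2\<close> applied
  to the sequence \<open>(B\<^sub>1 z\<^sub>\<bullet>\<^sub>j)(g)\<close>.  Boundedness of \<open>A\<close> rests on \<open>\<Sum>\<^sub>j \<parallel>\<mu>\<^sub>j\<parallel>\<^sup>2 \<le> \<parallel>A\<^sub>2 \<circ> \<mu>\<parallel>\<^sup>2\<close>.  The decreasing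
  rearrangement of \<open>(\<sigma>\<^sub>i \<tau>\<^sub>j)\<close> stays in the Lorentz sequence space because for \<open>s \<le> r\<close> the weights
  \<open>n\<^bsup>s/r-1\<^esup>\<close> decrease and their partial sums are submultiplicative up to a constant.
\<close>

section \<open>Complex Hilbert spaces\<close>

text \<open>For general \<open>X\<close> a measure in \<open>M(G,X)\<close> need not be approximable
  in variation by sums of scalar measures times vectors, so \<open>T\<^sub>f\<close> cannot simply
  be read as a tensor product of the two operators. Composing with \<open>A\<^sub>2\<close> leads to
  \<open>\<ell>\<^sub>2\<close>-valued measures, which have scalar coordinates. \<open>A\<close> and
  \<open>B\<close> are bounded for opposite reasons: the variation is an L1-type norm, so
  Minkowski's inequality applies on the domain side, while the sup norm allows fixing
  \<open>g\<close> on the target side, where evaluation after \<open>B\<^sub>1\<close> is one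
  functional applied to every row. As \<open>\<tau>\<^sub>j\<close> is constant on row
  \<open>j\<close>, \<open>D\<close> acts there as \<open>\<tau>\<^sub>j D\<^sub>\<sigma>\<close>,
  and \<open>B\<^sub>1\<close> turns the row back into a convolution. The pairs come in no monotone
  order, but \<open>singular_numbers\<close> prescribes only the multiplicities of positive values,
  so any decreasing null sequence with the same multiplicities serves. Since \<open>card\<close> and
  \<open>cdim\<close> are 0 on infinite sets and infinite-dimensional spaces, finite multiplicity
  has to be proved before these equations carry information.\<close>

lemma bounded_clinear_add: "bounded_clinear T \<Longrightarrow> T (x + y) = T x + T y"
  and bounded_clinear_diff: "bounded_clinear T \<Longrightarrow> T (x - y) = T x - T y"
  and bounded_clinear_zero: "bounded_clinear T \<Longrightarrow> T 0 = 0"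
  and bounded_clinear_sum: "bounded_clinear T \<Longrightarrow> T (sum f A) = (\<Sum>a\<in>A. T (f a))"
  and bounded_clinear_scaleC: "bounded_clinear T \<Longrightarrow> T (c *\<^sub>C x) = c *\<^sub>C T x"
  by (auto simp: bounded_clinear_def linear_simps linear_sum bounded_linear.linear)

lemma bounded_clinear_bound:
  assumes "bounded_clinear T"
  obtains K where "0 < K" "\<And>x. norm (T x) \<le> K * norm x"
  using assms bounded_linear.pos_bounded[of T] unfolding bounded_clinear_def
  by (metis mult.commute)

lemma bounded_clinearI:
  assumes "\<And>x y. T (x + y) = T x + T y" "\<And>c x. T (c *\<^sub>C x) = c *\<^sub>C T x"
    and "\<And>x. norm (T x) \<le> K * norm x"
  shows "bounded_clinear T"
  unfolding bounded_clinear_def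
proof
  show "bounded_linear T"
    by (rule bounded_linear_intro[where K = K])
      (simp_all add: assms scaleR_scaleC mult.commute[of _ K])
qed (use assms in simp)

lemma bounded_clinear_compose:
  "bounded_clinear S \<Longrightarrow> bounded_clinear T \<Longrightarrow> bounded_clinear (\<lambda>x. S (T x))"
  by (simp add: bounded_clinear_def bounded_linear_compose)

lemma scaleC_minus_one: "(-1) *\<^sub>C x = - x" for x :: "'a::complex_vector"
  using scaleR_scaleC[of "-1" x] by simp

lemma bounded_linear_scaleC_left: "bounded_linear (\<lambda>u::complex. u *\<^sub>C w)"
  for w :: "'a::complex_normed_vector"
  by (rule bounded_linear_intro[where K = "norm w"])
    (simp_all add: scaleC_add_left scaleR_scaleC scaleC_scaleC norm_scaleC scaleC_complex_def)

lemma cinner_add_right: "cinner z (x + y) = cinner z x + cinner z y"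
  by (metis cinner_add_left cinner_commute complex_cnj_add)

lemma cinner_scaleC_right: "cinner x (a *\<^sub>C y) = cnj a * cinner x y"
  by (metis cinner_scaleC_left cinner_commute complex_cnj_mult)

lemma cinner_zero_left [simp]: "cinner 0 x = 0"
  using cinner_add_left[of 0 0 x] by simp

lemma cinner_zero_right [simp]: "cinner x 0 = 0"
  using cinner_add_right[of x 0 0] by simp

lemma cinner_minus_left: "cinner (- x) y = - cinner x y"
  using cinner_scaleC_left[of "-1" x y] by (simp add: scaleC_minus_one)

lemma cinner_minus_right: "cinner x (- y) = - cinner x y"
  using cinner_scaleC_right[of x "-1" y] by (simp add: scaleC_minus_one)

lemma cinner_diff_left: "cinner (x - y) z = cinner x z - cinner y z"
  using cinner_add_left[of x "- y" z] by (simp add: cinner_minus_left)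

lemma cinner_diff_right: "cinner z (x - y) = cinner z x - cinner z y"
  using cinner_add_right[of z x "- y"] by (simp add: cinner_minus_right)

lemma cinner_sum_left: "cinner (sum f A) y = (\<Sum>a\<in>A. cinner (f a) y)"
  by (induction A rule: infinite_finite_induct) (simp_all add: cinner_add_left)

lemma cinner_sum_right: "cinner y (sum f A) = (\<Sum>a\<in>A. cinner y (f a))"
  by (induction A rule: infinite_finite_induct) (simp_all add: cinner_add_right)

lemma Re_cinner_self: "Re (cinner x x) = (norm x)\<^sup>2"
  by (simp add: cinner_self)

lemma Re_cinner_commute: "Re (cinner y x) = Re (cinner x y)"
  by (subst cinner_commute) simp

lemma norm_add_sq: "(norm (x + y))\<^sup>2 = (norm x)\<^sup>2 + 2 * Re (cinner x y) + (norm y)\<^sup>2"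
  for x y :: "'a::complex_inner"
  using Re_cinner_commute[of y x]
  by (simp add: cinner_add_left cinner_add_right flip: Re_cinner_self)

lemma norm_diff_sq: "(norm (x - y))\<^sup>2 = (norm x)\<^sup>2 - 2 * Re (cinner x y) + (norm y)\<^sup>2"
  for x y :: "'a::complex_inner"
  using Re_cinner_commute[of y x]
  by (simp add: cinner_diff_left cinner_diff_right flip: Re_cinner_self)

lemma cinner_eq_zero_iff: "cinner x x = 0 \<longleftrightarrow> x = 0"
  by (simp add: cinner_self)

lemma mult_cinner_self: "a * cnj a = complex_of_real ((cmod a)\<^sup>2)"
  by (simp only: complex_norm_square)

lemma cinner_Cauchy_Schwarz: "cmod (cinner x y) \<le> norm x * norm y"
proof (cases "y = 0")
  case False
  define c where "c = cinner x y"
  define t where "t = c / complex_of_real ((norm y)\<^sup>2)"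
  have ny: "(norm y)\<^sup>2 > 0" using False by simp
  have "0 \<le> (norm (x - t *\<^sub>C y))\<^sup>2" by simp
  also have "\<dots> = (norm x)\<^sup>2 - 2 * Re (cnj t * c) + (cmod t)\<^sup>2 * (norm y)\<^sup>2"
    unfolding norm_diff_sq by (simp add: cinner_scaleC_right norm_scaleC power_mult_distrib c_def)
  also have "cnj t * c = complex_of_real ((cmod c)\<^sup>2 / (norm y)\<^sup>2)"
    unfolding t_def using mult_cinner_self[of c] by (simp add: mult.commute)
  also have "(cmod t)\<^sup>2 * (norm y)\<^sup>2 = (cmod c)\<^sup>2 / (norm y)\<^sup>2"
    unfolding t_def using False
    by (simp add: norm_divide norm_power power_divide) (simp add: power2_eq_square power4_eq_xxxx)
  finally have "(cmod c)\<^sup>2 \<le> (norm x * norm y)\<^sup>2"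
    using ny by (simp add: field_simps power_mult_distrib)
  then show ?thesis unfolding c_def by (rule power2_le_imp_le) simp
qed simp

lemma bounded_linear_cinner_left: "bounded_linear (\<lambda>x. cinner x y)"
  by (rule bounded_linear_intro[where K = "norm y"])
    (simp_all add: cinner_add_left scaleR_scaleC cinner_scaleC_left cinner_Cauchy_Schwarz scaleC_complex_def)

lemma bounded_clinear_cinner: "bounded_clinear (\<lambda>x. cinner x y)"
  unfolding bounded_clinear_def using bounded_linear_cinner_left
  by (simp add: cinner_scaleC_left scaleC_complex_def)

text \<open>The representing vector minimises \<open>\<parallel>x\<parallel>\<^sup>2 - 2 Re \<phi>(x)\<close>.\<close>

lemma riesz_representation:
  fixes \<phi> :: "'h::chilbert_space \<Rightarrow> complex"
  assumes \<phi>: "bounded_clinear \<phi>"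
  shows "\<exists>y. \<forall>x. \<phi> x = cinner x y"
proof -
  define J where "J x = (norm x)\<^sup>2 - 2 * Re (\<phi> x)" for x
  obtain K where K: "0 < K" "\<And>x. cmod (\<phi> x) \<le> K * norm x"
    using bounded_clinear_bound[OF \<phi>] by blast
  have "- K\<^sup>2 \<le> J x" for x
  proof -
    have "Re (\<phi> x) \<le> K * norm x" using K(2)[of x] complex_Re_le_cmod order_trans by blast
    moreover have "0 \<le> (norm x - K)\<^sup>2" by simp
    ultimately show ?thesis unfolding J_def power2_diff by (simp add: mult.commute)
  qed
  then have bdd: "bdd_below (range J)" by (intro bdd_belowI2)
  define m where "m = Inf (range J)"
  have mJ: "m \<le> J x" for x unfolding m_def by (rule cInf_lower[OF _ bdd]) simp
  have "\<exists>x. J x < m + 1 / real (Suc n)" for n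
    using cInf_lessD[of "range J" "m + 1 / real (Suc n)"] by (auto simp: m_def)
  then obtain X where X: "\<And>n. J (X n) < m + 1 / real (Suc n)" by metis
  \<comment> \<open>The linear part of \<open>J\<close> cancels in the parallelogram law, so nearly
    minimal points are close together and a minimising sequence is Cauchy.\<close>
  have J_par: "(norm (x - y))\<^sup>2 = 2 * J x + 2 * J y - 4 * J ((1/2) *\<^sub>R (x + y))" for x y
  proof -
    have "(1/2) *\<^sub>R (x + y) = (1/2) *\<^sub>C (x + y)" by (simp add: scaleR_scaleC)
    then have "\<phi> ((1/2) *\<^sub>R (x + y)) = (1/2) * (\<phi> x + \<phi> y)"
      by (simp only: bounded_clinear_add[OF \<phi>] bounded_clinear_scaleC[OF \<phi>] scaleC_complex_def)
    from arg_cong[OF this, of Re]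
    have "Re (\<phi> ((1/2) *\<^sub>R (x + y))) = (Re (\<phi> x) + Re (\<phi> y)) / 2" by simp
    then have "4 * J ((1/2) *\<^sub>R (x + y)) = (norm (x + y))\<^sup>2 - 4 * Re (\<phi> x) - 4 * Re (\<phi> y)"
      by (simp add: J_def power_divide)
    then show ?thesis unfolding J_def norm_add_sq norm_diff_sq by simp
  qed
  have "Cauchy X"
  proof (rule metric_CauchyI)
    fix e :: real assume "e > 0"
    then obtain N where N: "4 / e\<^sup>2 < real N" using reals_Archimedean2 by blast
    have "dist (X i) (X j) < e" if "i \<ge> N" "j \<ge> N" for i j
    proof -
      have "0 < real N" using N \<open>e > 0\<close> by (smt (verit) divide_pos_pos zero_less_power)
      then have i: "1 / real (Suc k) \<le> 1 / real N" if "k \<ge> N" for k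
        using that by (intro divide_left_mono) auto
      have "(norm (X i - X j))\<^sup>2 < 2 * (m + 1 / real N) + 2 * (m + 1 / real N) - 4 * m"
        unfolding J_par using X[of i] X[of j] i[OF that(1)] i[OF that(2)]
          mJ[of "(1/2) *\<^sub>R (X i + X j)"] by argo
      also have "\<dots> = 4 / real N" by simp
      also have "\<dots> < e\<^sup>2" using N \<open>e > 0\<close> \<open>0 < real N\<close> by (simp add: field_simps)
      finally show ?thesis unfolding dist_norm by (rule power2_less_imp_less) (use \<open>e > 0\<close> in simp)
    qed
    then show "\<exists>M. \<forall>m\<ge>M. \<forall>n\<ge>M. dist (X m) (X n) < e" by blast
  qed
  then obtain z where z: "X \<longlonglongrightarrow> z" using Cauchy_convergent convergent_def by blast
  have "(\<lambda>n. J (X n)) \<longlonglongrightarrow> J z"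
    unfolding J_def using \<phi>
    by (intro tendsto_intros z bounded_linear.tendsto[of \<phi>]) (simp_all add: bounded_clinear_def)
  moreover have "(\<lambda>n. m + 1 / real (Suc n)) \<longlonglongrightarrow> m + 0"
    by (intro tendsto_intros LIMSEQ_Suc[OF lim_1_over_n])
  ultimately have "J z \<le> m + 0"
    using X by (intro LIMSEQ_le) (auto intro: less_imp_le)
  then have Jz: "J z \<le> J x" for x using mJ[of x] by simp
  have "\<phi> v = cinner v z" for v
  proof -
    define w where "w = cinner v z - \<phi> v"
    \<comment> \<open>\<open>t\<close> steps along \<open>v\<close> against the gradient
      \<open>w\<close>. The linear term drops by \<open>2 * s * (cmod w)\<^sup>2\<close>, and
      \<open>s * (norm v)\<^sup>2 \<le> 1\<close> keeps the quadratic term at half of that, so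
      minimality forces \<open>w = 0\<close>.\<close>
    define s where "s = 1 / (1 + (norm v)\<^sup>2)"
    define t where "t = - (complex_of_real s * cnj w)"
    have s: "s > 0" "s * (norm v)\<^sup>2 \<le> 1" unfolding s_def by (auto simp: field_simps add_pos_nonneg)
    have "Re (cinner z (t *\<^sub>C v)) = Re (t * cinner v z)"
      unfolding Re_cinner_commute[of z] by (simp add: cinner_scaleC_left)
    then have "J (z + t *\<^sub>C v) = J z + 2 * Re (t * w) + (cmod t)\<^sup>2 * (norm v)\<^sup>2"
      unfolding J_def norm_add_sq bounded_clinear_add[OF \<phi>] bounded_clinear_scaleC[OF \<phi>]
      by (simp add: w_def scaleC_complex_def norm_scaleC power_mult_distrib algebra_simps)
    moreover have "t * w = complex_of_real (- s * (cmod w)\<^sup>2)"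
      unfolding t_def using mult_cinner_self[of w] by (simp add: ac_simps)
    moreover have "(cmod t)\<^sup>2 * (norm v)\<^sup>2 = (s * (norm v)\<^sup>2) * (s * (cmod w)\<^sup>2)"
      unfolding t_def using s by (simp add: norm_mult power_mult_distrib power2_eq_square)
    moreover have "(s * (norm v)\<^sup>2) * (s * (cmod w)\<^sup>2) \<le> 1 * (s * (cmod w)\<^sup>2)"
      using s by (intro mult_right_mono) auto
    ultimately have "s * (cmod w)\<^sup>2 \<le> 0" using Jz[of "z + t *\<^sub>C v"] by simp
    then have "w = 0" using s by (simp add: mult_le_0_iff)
    then show ?thesis by (simp add: w_def)
  qed
  then show ?thesis by blast
qed

text \<open>Riesz, applied to \<open>\<lambda>x. cinner (U x) y\<close> for each \<open>y\<close>,
  shows that the \<open>SOME\<close> in \<open>cadjoint\<close> really picks an adjoint.\<close>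

lemma cinner_cadjoint:
  assumes U: "bounded_clinear U"
  shows "cinner (U x) y = cinner x (cadjoint U y)"
proof -
  have "\<exists>v. \<forall>x. cinner (U x) y = cinner x v" for y
    by (rule riesz_representation) (rule bounded_clinear_compose[OF bounded_clinear_cinner U])
  then have "\<exists>V. \<forall>x y. cinner (U x) y = cinner x (V y)" by metis
  then have "\<forall>x y. cinner (U x) y = cinner x (cadjoint U y)"
    unfolding cadjoint_def by (rule someI_ex)
  then show ?thesis by blast
qed

lemma cinner_ext:
  assumes "\<And>x. cinner x y = cinner x z"
  shows "y = z"
  using assms[of "y - z"] cinner_eq_zero_iff[of "y - z"] by (simp add: cinner_diff_right)

lemma cadjoint_eqI:
  assumes "bounded_clinear U" "\<And>x y. cinner (U x) y = cinner x (V y)"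
  shows "cadjoint U = V"
  by (rule ext, rule cinner_ext) (metis assms cinner_cadjoint)

lemma bounded_clinear_cadjoint:
  assumes U: "bounded_clinear U"
  shows "bounded_clinear (cadjoint U)"
proof -
  obtain K where K: "0 < K" "\<And>x. norm (U x) \<le> K * norm x"
    using bounded_clinear_bound[OF U] by blast
  show ?thesis
  proof (rule bounded_clinearI)
    show "cadjoint U (x + y) = cadjoint U x + cadjoint U y" for x y
      by (rule cinner_ext) (simp add: cinner_add_right flip: cinner_cadjoint[OF U])
    show "cadjoint U (c *\<^sub>C x) = c *\<^sub>C cadjoint U x" for c x
      by (rule cinner_ext) (simp add: cinner_scaleC_right flip: cinner_cadjoint[OF U])
    show "norm (cadjoint U y) \<le> K * norm y" for y
    proof (cases "cadjoint U y = 0")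
      case False
      let ?v = "cadjoint U y"
      have "(norm ?v)\<^sup>2 = cmod (cinner (U ?v) y)"
        unfolding cinner_cadjoint[OF U] cinner_self by (simp only: norm_of_real abs_of_nonneg zero_le_power2)
      also have "\<dots> \<le> K * norm ?v * norm y"
        by (rule order_trans[OF cinner_Cauchy_Schwarz]) (use K in \<open>simp add: mult_right_mono\<close>)
      finally show ?thesis using False by (simp add: power2_eq_square ac_simps)
    qed (use K in simp)
  qed
qed

section \<open>Orthogonal systems\<close>

lemma norm_sum_orthogonal:
  fixes e :: "'i \<Rightarrow> 'h::complex_inner"
  assumes "finite F" "\<And>m n. m \<in> F \<Longrightarrow> n \<in> F \<Longrightarrow> m \<noteq> n \<Longrightarrow> cinner (e m) (e n) = 0"
  shows "(norm (\<Sum>n\<in>F. c n *\<^sub>C e n))\<^sup>2 = (\<Sum>n\<in>F. (cmod (c n))\<^sup>2 * (norm (e n))\<^sup>2)"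
  using assms
proof (induction F)
  case (insert k F)
  have "cinner (c k *\<^sub>C e k) (\<Sum>n\<in>F. c n *\<^sub>C e n) = 0"
    unfolding cinner_sum_right cinner_scaleC_right cinner_scaleC_left
    using insert.hyps insert.prems by (intro sum.neutral ballI) force
  then show ?case using insert by (simp add: norm_add_sq norm_scaleC power_mult_distrib)
qed simp

definition orthonormal :: "'h::complex_inner set \<Rightarrow> bool" where
  "orthonormal S \<longleftrightarrow> (\<forall>x\<in>S. \<forall>y\<in>S. cinner x y = (if x = y then 1 else 0))"

text \<open>Subtracting from a vector of \<open>E\<close> its projection onto \<open>S\<close>
  leaves a vector of \<open>E\<close> orthogonal to \<open>S\<close>, which is 0 by maximality; so
  \<open>S\<close> is a basis. This computes the dimensions in \<open>singular_numbers\<close>, both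
  for a given compact operator and for diagonal ones.\<close>

lemma cdim_eq_card_orthonormal:
  fixes S :: "'h::complex_inner set"
  assumes S: "orthonormal S" "finite S" "S \<subseteq> E" and E: "complex_vector.subspace E"
    and max: "\<And>x. x \<in> E \<Longrightarrow> (\<And>y. y \<in> S \<Longrightarrow> cinner x y = 0) \<Longrightarrow> x = 0"
  shows "cdim E = card S"
proof (rule complex_vector.dim_eq_card)
  have coeff: "cinner (\<Sum>v\<in>S. u v *\<^sub>C v) y = u y" if "y \<in> S" for u y
  proof -
    have "cinner (\<Sum>v\<in>S. u v *\<^sub>C v) y = (\<Sum>v\<in>S. if v = y then u v else 0)"
      unfolding cinner_sum_left using S that
      by (intro sum.cong) (auto simp: cinner_scaleC_left orthonormal_def)
    then show ?thesis using S that by simp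
  qed
  show "complex_vector.independent S"
    unfolding complex_vector.dependent_finite[OF S(2)] using coeff by (metis cinner_zero_left)
  have "x \<in> complex_vector.span S" if "x \<in> E" for x
  proof -
    let ?p = "\<Sum>v\<in>S. cinner x v *\<^sub>C v"
    have "x - ?p = 0"
    proof (rule max)
      show "x - ?p \<in> E"
        using E that S by (intro complex_vector.subspace_diff complex_vector.subspace_sum
            complex_vector.subspace_scale) auto
    qed (simp add: cinner_diff_left coeff)
    moreover have "?p \<in> complex_vector.span S"
      by (intro complex_vector.span_sum complex_vector.span_scale complex_vector.span_base)
    ultimately show ?thesis by simp
  qed
  then have "E \<subseteq> complex_vector.span S" by blast
  moreover have "complex_vector.span E = E" using E by (simp add: complex_vector.span_eq_iff)
  moreover have "complex_vector.span S \<subseteq> complex_vector.span E"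
    by (rule complex_vector.span_mono[OF S(3)])
  ultimately show "complex_vector.span S = complex_vector.span E" by blast
qed

definition suborthonormal :: "(nat \<Rightarrow> 'h::complex_inner) \<Rightarrow> bool" where
  "suborthonormal e \<longleftrightarrow> (\<forall>m n. m \<noteq> n \<longrightarrow> cinner (e m) (e n) = 0) \<and> (\<forall>n. norm (e n) \<le> 1)"

lemma norm_sum_suborthonormal_le:
  assumes "suborthonormal e" "finite F"
  shows "(norm (\<Sum>n\<in>F. c n *\<^sub>C e n))\<^sup>2 \<le> (\<Sum>n\<in>F. (cmod (c n))\<^sup>2)"
proof -
  have "(cmod (c n))\<^sup>2 * (norm (e n))\<^sup>2 \<le> (cmod (c n))\<^sup>2 * 1" for n
    using assms(1) by (intro mult_left_mono) (auto simp: suborthonormal_def power_le_one)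
  then show ?thesis
    using assms norm_sum_orthogonal[OF assms(2), of e c] by (auto simp: suborthonormal_def intro!: sum_mono)
qed

lemma bessel_inequality:
  assumes "suborthonormal e" "finite F"
  shows "(\<Sum>n\<in>F. (cmod (cinner x (e n)))\<^sup>2) \<le> (norm x)\<^sup>2"
proof -
  \<comment> \<open>With some \<open>e n\<close> shorter than 1, \<open>p\<close> need not be a
    projection, but its squared norm is still at most \<open>Re (cinner x p)\<close>, which suffices
    when \<open>norm (x - p)\<close> is expanded.\<close>
  define p where "p = (\<Sum>n\<in>F. cinner x (e n) *\<^sub>C e n)"
  have "cinner x p = (\<Sum>n\<in>F. complex_of_real ((cmod (cinner x (e n)))\<^sup>2))"
    unfolding p_def cinner_sum_right cinner_scaleC_right
    by (intro sum.cong refl) (metis mult_cinner_self mult.commute)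
  then have "Re (cinner x p) = (\<Sum>n\<in>F. (cmod (cinner x (e n)))\<^sup>2)"
    by (simp only: Re_sum Re_complex_of_real)
  moreover have "(norm p)\<^sup>2 \<le> (\<Sum>n\<in>F. (cmod (cinner x (e n)))\<^sup>2)"
    unfolding p_def by (rule norm_sum_suborthonormal_le[OF assms])
  moreover have "0 \<le> (norm (x - p))\<^sup>2" by simp
  ultimately show ?thesis unfolding norm_diff_sq by simp
qed

lemma bessel_summable:
  assumes "suborthonormal e"
  shows "summable (\<lambda>n. (cmod (cinner x (e n)))\<^sup>2)" "(\<Sum>n. (cmod (cinner x (e n)))\<^sup>2) \<le> (norm x)\<^sup>2"
proof -
  show "summable (\<lambda>n. (cmod (cinner x (e n)))\<^sup>2)"
    by (rule summableI_nonneg_bounded[where x = "(norm x)\<^sup>2"]) (simp_all add: bessel_inequality assms)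
  then show "(\<Sum>n. (cmod (cinner x (e n)))\<^sup>2) \<le> (norm x)\<^sup>2"
    by (rule suminf_le_const) (simp add: bessel_inequality assms)
qed

lemma suborthonormal_series:
  fixes e :: "nat \<Rightarrow> 'h::chilbert_space"
  assumes e: "suborthonormal e" and c: "summable (\<lambda>n. (cmod (c n))\<^sup>2)"
  shows "summable (\<lambda>n. c n *\<^sub>C e n)" "(norm (\<Sum>n. c n *\<^sub>C e n))\<^sup>2 \<le> (\<Sum>n. (cmod (c n))\<^sup>2)"
proof -
  show s: "summable (\<lambda>n. c n *\<^sub>C e n)"
    unfolding summable_Cauchy
  proof (intro allI impI)
    fix d :: real assume "d > 0"
    then obtain N where N: "\<And>m n. m \<ge> N \<Longrightarrow> norm (\<Sum>k\<in>{m..<n}. (cmod (c k))\<^sup>2) < d\<^sup>2"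
      using c unfolding summable_Cauchy by (meson zero_less_power)
    have "norm (\<Sum>k\<in>{m..<n}. c k *\<^sub>C e k) < d" if "m \<ge> N" for m n
    proof (rule power2_less_imp_less)
      show "(norm (\<Sum>k\<in>{m..<n}. c k *\<^sub>C e k))\<^sup>2 < d\<^sup>2"
        using norm_sum_suborthonormal_le[OF e, of "{m..<n}" c] N[OF that, of n] by simp
    qed (use \<open>d > 0\<close> in simp)
    then show "\<exists>N. \<forall>m\<ge>N. \<forall>n. norm (\<Sum>k\<in>{m..<n}. c k *\<^sub>C e k) < d" by blast
  qed
  show "(norm (\<Sum>n. c n *\<^sub>C e n))\<^sup>2 \<le> (\<Sum>n. (cmod (c n))\<^sup>2)"
  proof (rule LIMSEQ_le_const2)
    show "(\<lambda>n. (norm (\<Sum>k<n. c k *\<^sub>C e k))\<^sup>2) \<longlonglongrightarrow> (norm (\<Sum>n. c n *\<^sub>C e n))\<^sup>2"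
      by (intro tendsto_intros summable_LIMSEQ s)
    have "(norm (\<Sum>k<n. c k *\<^sub>C e k))\<^sup>2 \<le> (\<Sum>n. (cmod (c n))\<^sup>2)" for n
      by (rule order_trans[OF norm_sum_suborthonormal_le[OF e]]) (auto intro!: sum_le_suminf c)
    then show "\<exists>N. \<forall>n\<ge>N. (norm (\<Sum>k<n. c k *\<^sub>C e k))\<^sup>2 \<le> (\<Sum>n. (cmod (c n))\<^sup>2)" by blast
  qed
qed

section \<open>Singular value decomposition\<close>

text \<open>Equal finite multiplicities give a bijection on each level set, and these glue because a
  point determines its level. Cardinality equations for singular numbers and rearrangements thereby
  become matchings of indices.\<close>

lemma bij_betw_level_sets:
  fixes f :: "'i \<Rightarrow> real" and g :: "'j \<Rightarrow> real"
  assumes "\<And>a. a > 0 \<Longrightarrow> finite {i\<in>F. f i = a}" "\<And>a. a > 0 \<Longrightarrow> finite {j\<in>G. g j = a}"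
    and "\<And>a. a > 0 \<Longrightarrow> card {i\<in>F. f i = a} = card {j\<in>G. g j = a}"
  obtains p where "bij_betw p {i\<in>F. f i > 0} {j\<in>G. g j > 0}"
    "\<And>i. i \<in> F \<Longrightarrow> f i > 0 \<Longrightarrow> g (p i) = f i"
proof -
  define h where "h a = (SOME h. bij_betw h {i\<in>F. f i = a} {j\<in>G. g j = a})" for a
  have h: "bij_betw (h a) {i\<in>F. f i = a} {j\<in>G. g j = a}" if "a > 0" for a
    unfolding h_def using finite_same_card_bij[OF assms(1)[OF that] assms(2)[OF that] assms(3)[OF that]] by (rule someI_ex)
  define p where "p i = h (f i) i" for i
  have p: "p i \<in> G \<and> g (p i) = f i" if "i \<in> F" "f i > 0" for i
    using bij_betwE[OF h[OF that(2)]] that by (auto simp: p_def)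
  have "inj_on p {i\<in>F. f i > 0}"
  proof (rule inj_onI)
    fix i k assume *: "i \<in> {i\<in>F. f i > 0}" "k \<in> {i\<in>F. f i > 0}" "p i = p k"
    then have "f i = f k" using p[of i] p[of k] by auto
    then show "i = k"
      using * bij_betw_imp_inj_on[OF h[of "f i"]] by (auto simp: p_def dest: inj_onD)
  qed
  moreover have "p ` {i\<in>F. f i > 0} = {j\<in>G. g j > 0}"
  proof (intro equalityI subsetI)
    fix j assume j: "j \<in> {j\<in>G. g j > 0}"
    then have "j \<in> h (g j) ` {i\<in>F. f i = g j}"
      using bij_betw_imp_surj_on[OF h[of "g j"]] by auto
    then obtain i where "i \<in> F" "f i = g j" "j = p i" by (auto simp: p_def)
    then show "j \<in> p ` {i\<in>F. f i > 0}" using j by auto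
  qed (use p in auto)
  ultimately have "bij_betw p {i\<in>F. f i > 0} {j\<in>G. g j > 0}" by (simp add: bij_betw_def)
  then show ?thesis by (rule that) (use p in blast)
qed

lemma finite_level_set:
  fixes f :: "nat \<Rightarrow> real"
  assumes "f \<longlonglongrightarrow> 0" "a > 0"
  shows "finite {n. f n > a}" "finite {n. f n \<ge> a}" "finite {n. f n = a}"
proof -
  have "\<forall>\<^sub>F n in sequentially. f n < a" using assms by (rule order_tendstoD)
  then obtain N where "\<And>n. n \<ge> N \<Longrightarrow> f n < a" by (auto simp: eventually_sequentially)
  then have "{n. f n \<ge> a} \<subseteq> {..<N}" by (metis (mono_tags) lessThan_iff mem_Collect_eq not_le subsetI)
  then show "finite {n. f n \<ge> a}" by (rule finite_subset) simp
  then show "finite {n. f n > a}" "finite {n. f n = a}"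
    by (rule rev_finite_subset, force)+
qed

lemma compact_op_subsequence:
  assumes "compact_op U" "\<And>n. norm (X n) \<le> 1"
  obtains r l where "strict_mono (r :: nat \<Rightarrow> nat)" "(\<lambda>k. U (X (r k))) \<longlonglongrightarrow> l"
proof -
  have "seq_compact (closure (U ` cball 0 1))"
    using assms(1) by (simp add: compact_op_def compact_eq_seq_compact_metric)
  moreover have "\<forall>n. U (X n) \<in> closure (U ` cball 0 1)"
    using assms(2) closure_subset by fastforce
  ultimately obtain l r where "strict_mono (r :: nat \<Rightarrow> nat)" "((\<lambda>n. U (X n)) \<circ> r) \<longlonglongrightarrow> l"
    using seq_compactE[of "closure (U ` cball 0 1)" "\<lambda>n. U (X n)"] by blast
  then show ?thesis by (intro that[of r l]) (simp_all add: comp_def)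
qed

locale compact_operator =
  fixes U :: "'h::chilbert_space \<Rightarrow> 'h"
  assumes compact: "compact_op U"
begin

lemma bounded_op: "bounded_clinear U"
  using compact by (simp add: compact_op_def)

definition gram :: "'h \<Rightarrow> 'h" where "gram x = cadjoint U (U x)"

lemma bounded_gram: "bounded_clinear gram"
  unfolding gram_def by (rule bounded_clinear_compose[OF bounded_clinear_cadjoint[OF bounded_op] bounded_op])

lemma cinner_gram_right: "cinner x (gram y) = cinner (U x) (U y)"
  by (simp add: gram_def cinner_cadjoint[OF bounded_op])

lemma cinner_gram_left: "cinner (gram x) y = cinner (U x) (U y)"
  by (metis cinner_gram_right cinner_commute)

definition eigensp :: "real \<Rightarrow> 'h set" where "eigensp a = {x. gram x = a\<^sup>2 *\<^sub>R x}"

lemma eigensp_D: "x \<in> eigensp a \<Longrightarrow> gram x = complex_of_real (a\<^sup>2) *\<^sub>C x"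
  by (simp add: eigensp_def scaleR_scaleC)

lemma subspace_eigensp: "complex_vector.subspace (eigensp a)"
  unfolding complex_vector.subspace_def eigensp_def
  by (simp add: scaleR_scaleC bounded_clinear_zero[OF bounded_gram] bounded_clinear_add[OF bounded_gram]
      bounded_clinear_scaleC[OF bounded_gram] scaleC_add_right scaleC_scaleC mult.commute)

lemma cinner_U_eigensp: "y \<in> eigensp a \<Longrightarrow> cinner (U x) (U y) = complex_of_real (a\<^sup>2) * cinner x y"
  by (simp add: eigensp_D cinner_scaleC_right flip: cinner_gram_right)

lemma norm_U_eigensp:
  assumes "x \<in> eigensp a" "a > 0"
  shows "norm (U x) = a * norm x"
proof -
  have "complex_of_real ((norm (U x))\<^sup>2) = complex_of_real ((a * norm x)\<^sup>2)"
    using cinner_U_eigensp[OF assms(1), of x] by (simp add: cinner_self power_mult_distrib)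
  then show ?thesis using assms by (simp only: of_real_eq_iff power2_eq_iff_nonneg norm_ge_zero
        mult_nonneg_nonneg less_imp_le)
qed

lemma eigensp_orthogonal:
  assumes "x \<in> eigensp a" "y \<in> eigensp b" "a > 0" "b > 0" "a \<noteq> b"
  shows "cinner x y = 0"
proof -
  have "complex_of_real (a\<^sup>2) * cinner x y = complex_of_real (b\<^sup>2) * cinner x y"
    using assms(1,2) cinner_gram_left[of x y] cinner_gram_right[of x y] eigensp_D
    by (simp add: cinner_scaleC_left cinner_scaleC_right)
  moreover have "a\<^sup>2 \<noteq> b\<^sup>2" using assms by (simp add: power2_eq_iff)
  ultimately show ?thesis by (metis mult_right_cancel of_real_eq_iff)
qed

text \<open>Zorn's lemma, run over all positive eigenvalues at once, so that the spectrum is never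
  enumerated. An eigenvector orthogonal to a maximal system could be normalised and added to
  it.\<close>

lemma ex_maximal_eigenbasis:
  obtains S where "orthonormal S" "S \<subseteq> (\<Union>a\<in>{0<..}. eigensp a)"
    "\<And>x a. x \<in> eigensp a \<Longrightarrow> a > 0 \<Longrightarrow> (\<And>y. y \<in> S \<Longrightarrow> cinner x y = 0) \<Longrightarrow> x = 0"
proof -
  define A where "A = {S. orthonormal S \<and> S \<subseteq> (\<Union>a\<in>{0<..}. eigensp a)}"
  have "\<exists>M\<in>A. \<forall>X\<in>A. M \<subseteq> X \<longrightarrow> X = M"
  proof (rule subset_Zorn')
    fix C assume C: "subset.chain A C"
    then have sub: "C \<subseteq> A" and ch: "\<And>X Y. X \<in> C \<Longrightarrow> Y \<in> C \<Longrightarrow> X \<subseteq> Y \<or> Y \<subseteq> X"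
      by (auto simp: subset_chain_def)
    have "orthonormal (\<Union>C)"
      unfolding orthonormal_def
    proof (intro ballI)
      fix x y assume "x \<in> \<Union>C" "y \<in> \<Union>C"
      then obtain X where "X \<in> C" "x \<in> X" "y \<in> X" using ch by blast
      then show "cinner x y = (if x = y then 1 else 0)"
        using sub by (auto simp: A_def orthonormal_def)
    qed
    then show "\<Union>C \<in> A" using sub by (auto simp: A_def)
  qed
  then obtain S where S: "S \<in> A" and max: "\<And>X. X \<in> A \<Longrightarrow> S \<subseteq> X \<Longrightarrow> X = S" by blast
  have "x = 0" if x: "x \<in> eigensp a" "a > 0" and perp: "\<And>y. y \<in> S \<Longrightarrow> cinner x y = 0" for x a
  proof (rule ccontr)
    assume "x \<noteq> 0"
    define u where "u = complex_of_real (1 / norm x) *\<^sub>C x"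
    have u: "cinner u u = 1"
      using \<open>x \<noteq> 0\<close> by (simp add: u_def cinner_self norm_scaleC norm_divide)
    have pu: "cinner u y = 0" "cinner y u = 0" if "y \<in> S" for y
      using perp[OF that] cinner_commute[of y x] by (simp_all add: u_def cinner_scaleC_left cinner_scaleC_right)
    have "u \<in> eigensp a" unfolding u_def by (rule complex_vector.subspace_scale[OF subspace_eigensp x(1)])
    then have "insert u S \<in> A" using S pu u \<open>a > 0\<close> by (auto simp: A_def orthonormal_def)
    then have "u \<in> S" using max by blast
    then show False using pu[of u] u by simp
  qed
  then show ?thesis using that[of S] S by (auto simp: A_def)
qed

text \<open>\<open>U\<close> scales norms on \<open>eigensp a\<close> by \<open>a\<close>, so the
  images of infinitely many orthonormal eigenvectors would keep mutual distance
  \<open>a * sqrt 2\<close> and have no convergent subsequence.\<close>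

lemma finite_orthonormal_eigensp:
  assumes "orthonormal S" "a > 0"
  shows "finite (S \<inter> eigensp a)"
proof (rule ccontr)
  assume "infinite (S \<inter> eigensp a)"
  then obtain u :: "nat \<Rightarrow> 'h" where u: "inj u" "range u \<subseteq> S \<inter> eigensp a"
    using infinite_countable_subset by blast
  have uu: "cinner (u m) (u n) = (if m = n then 1 else 0)" for m n
    using u assms by (auto simp: orthonormal_def inj_def image_subset_iff)
  have "(norm (u n))\<^sup>2 = 1" for n using Re_cinner_self[of "u n"] uu[of n n] by simp
  then have n1: "norm (u n) = 1" for n by (simp add: power2_eq_1_iff) (smt (verit) norm_ge_zero)
  obtain r l where r: "strict_mono (r :: nat \<Rightarrow> nat)" "(\<lambda>k. U (u (r k))) \<longlonglongrightarrow> l"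
    using compact_op_subsequence[OF compact, of u] n1 by (metis order_refl)
  then obtain N where N: "\<And>m n. m \<ge> N \<Longrightarrow> n \<ge> N \<Longrightarrow> dist (U (u (r m))) (U (u (r n))) < a"
    using metric_CauchyD[OF LIMSEQ_imp_Cauchy[OF r(2)] assms(2)] by blast
  let ?v = "u (r N) - u (r (Suc N))"
  have "r N \<noteq> r (Suc N)" using r(1) by (simp add: strict_mono_eq)
  then have "(norm ?v)\<^sup>2 = 2" using n1 uu by (simp add: norm_diff_sq)
  moreover have "?v \<in> eigensp a" using u by (intro complex_vector.subspace_diff subspace_eigensp) auto
  ultimately have "(norm (U ?v))\<^sup>2 = a\<^sup>2 * 2" using norm_U_eigensp assms by (simp add: power_mult_distrib)
  moreover have "norm (U ?v) < a"
    using N[of N "Suc N"] by (simp add: dist_norm bounded_clinear_diff[OF bounded_op])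
  then have "(norm (U ?v))\<^sup>2 < a\<^sup>2" by (rule power_strict_mono) auto
  ultimately show False using assms by simp
qed

text \<open>A nonzero restriction of \<open>U\<close> to the complement would attain its norm at an eigenvector of \<open>U\<^sup>*U\<close>.\<close>

lemma U_eq_0_if_orthogonal:
  assumes S: "S \<subseteq> (\<Union>a\<in>{0<..}. eigensp a)"
    and max: "\<And>x a. x \<in> eigensp a \<Longrightarrow> a > 0 \<Longrightarrow> (\<And>y. y \<in> S \<Longrightarrow> cinner x y = 0) \<Longrightarrow> x = 0"
    and x: "\<And>y. y \<in> S \<Longrightarrow> cinner x y = 0"
  shows "U x = 0"
proof (rule ccontr)
  assume Ux: "U x \<noteq> 0"
  define N where "N = {x. \<forall>y\<in>S. cinner x y = 0}"
  have scaleN: "c *\<^sub>C v \<in> N" if "v \<in> N" for c v using that by (simp add: N_def cinner_scaleC_left)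
  \<comment> \<open>The complement is invariant: for an eigenvector \<open>y\<close>,
    \<open>cinner (U v) (U y)\<close> is a multiple of \<open>cinner v y\<close>. The extremal
    problem can therefore stay inside \<open>N\<close>.\<close>
  have KN: "gram v \<in> N" if "v \<in> N" for v
    unfolding N_def
  proof (intro CollectI ballI)
    fix y assume "y \<in> S"
    then obtain a where "y \<in> eigensp a" using S by blast
    then show "cinner (gram v) y = 0" using that \<open>y \<in> S\<close> by (simp add: cinner_gram_left cinner_U_eigensp N_def)
  qed
  obtain C where C: "C > 0" "\<And>v. norm (U v) \<le> C * norm v" using bounded_clinear_bound[OF bounded_op] by blast
  define B where "B = {norm (U v) | v. v \<in> N \<and> norm v \<le> 1}"
  have bdd: "bdd_above B"
  proof (rule bdd_aboveI[of _ C])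
    fix b assume "b \<in> B"
    then obtain v where "b = norm (U v)" "norm v \<le> 1" by (auto simp: B_def)
    then show "b \<le> C" using C(2)[of v] mult_left_mono[of "norm v" 1 C, OF _ less_imp_le[OF C(1)]] by linarith
  qed
  define m where "m = Sup B"
  have normalize: "norm (U v) = norm v * norm (U (complex_of_real (1 / norm v) *\<^sub>C v))" for v
    using bounded_clinear_zero[OF bounded_op]
    by (cases "v = 0") (simp_all add: bounded_clinear_scaleC[OF bounded_op] norm_scaleC norm_divide)
  have mB: "norm (U v) \<le> m * norm v" if "v \<in> N" for v
  proof -
    have "norm (U (complex_of_real (1 / norm v) *\<^sub>C v)) \<le> m"
      unfolding m_def by (rule cSup_upper[OF _ bdd])
        (unfold B_def, use scaleN[OF that] in \<open>force simp: norm_scaleC norm_divide\<close>)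
    then have "norm v * norm (U (complex_of_real (1 / norm v) *\<^sub>C v)) \<le> norm v * m"
      by (rule mult_left_mono) simp
    then show ?thesis by (simp only: normalize[of v, symmetric] mult.commute)
  qed
  have "x \<in> N" using x by (simp add: N_def)
  then have "0 < m" using mB[of x] Ux by (smt (verit) norm_ge_zero zero_less_norm_iff mult_nonpos_nonneg)
  have "B \<noteq> {}" unfolding B_def N_def by (auto intro!: exI[of _ 0])
  then have "\<exists>v. v \<in> N \<and> norm v \<le> 1 \<and> norm (U v) > m - 1 / real (Suc n)" for n
    using less_cSupD[of B "m - 1 / real (Suc n)"] by (auto simp: m_def B_def)
  then obtain X where X: "\<And>n. X n \<in> N" "\<And>n. norm (X n) \<le> 1" "\<And>n. norm (U (X n)) > m - 1 / real (Suc n)"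
    by metis
  have up: "norm (U (X n)) \<le> m" for n
    using mB[OF X(1)[of n]] mult_left_mono[OF X(2)[of n] less_imp_le[OF \<open>0 < m\<close>]] by simp
  have "(\<lambda>n. norm (U (X n))) \<longlonglongrightarrow> m"
  proof (rule tendsto_sandwich)
    show "(\<lambda>n. m - 1 / real (Suc n)) \<longlonglongrightarrow> m"
      using tendsto_diff[OF tendsto_const LIMSEQ_Suc[OF lim_1_over_n]] by force
    show "\<forall>\<^sub>F n in sequentially. m - 1 / real (Suc n) \<le> norm (U (X n))"
      using X(3) by (auto intro!: always_eventually less_imp_le)
  qed (use up in auto)
  moreover obtain r y where r: "strict_mono (r :: nat \<Rightarrow> nat)" "(\<lambda>k. U (X (r k))) \<longlonglongrightarrow> y"
    using compact_op_subsequence[OF compact, of X] X(2) by metis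
  ultimately have lm: "(\<lambda>k. norm (U (X (r k)))) \<longlonglongrightarrow> m"
    using LIMSEQ_subseq_LIMSEQ[of "\<lambda>n. norm (U (X n))" m r] by (simp add: comp_def)
  define w where "w = cadjoint U y"
  have Kw: "(\<lambda>k. gram (X (r k))) \<longlonglongrightarrow> w"
    unfolding gram_def w_def using bounded_clinear_cadjoint[OF bounded_op]
    by (intro bounded_linear.tendsto[OF _ r(2)]) (simp add: bounded_clinear_def)
  \<comment> \<open>Invariance of \<open>N\<close> permits the bound \<open>m\<close> to be used for
    both \<open>v\<close> and \<open>gram v\<close>.\<close>
  have normK: "norm (gram v) \<le> m\<^sup>2 * norm v" if "v \<in> N" for v
  proof (cases "gram v = 0")
    case False
    have "(norm (gram v))\<^sup>2 = cmod (cinner (U v) (U (gram v)))"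
      unfolding cinner_gram_left[symmetric] cinner_self by (simp only: norm_of_real abs_of_nonneg zero_le_power2)
    also have "\<dots> \<le> norm (U v) * norm (U (gram v))" by (rule cinner_Cauchy_Schwarz)
    also have "\<dots> \<le> (m * norm v) * (m * norm (gram v))"
      using mB[OF that] mB[OF KN[OF that]] \<open>0 < m\<close> by (intro mult_mono) auto
    finally show ?thesis using False by (simp add: power2_eq_square ac_simps)
  qed simp
  \<comment> \<open>Expanding the square and inserting \<open>normK\<close> bounds the defect by a
    quantity that vanishes as \<open>norm (U v)\<close> tends to \<open>m\<close>: a maximising
    sequence consists asymptotically of eigenvectors.\<close>
  have "(\<lambda>k. gram (X (r k)) - m\<^sup>2 *\<^sub>R X (r k)) \<longlonglongrightarrow> 0"
  proof (rule Lim_null_comparison)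
    have "(\<lambda>k. sqrt (2 * m^4 - 2 * m\<^sup>2 * (norm (U (X (r k))))\<^sup>2)) \<longlonglongrightarrow> sqrt (2 * m^4 - 2 * m\<^sup>2 * m\<^sup>2)"
      by (intro tendsto_intros lm)
    also have "2 * m^4 - 2 * m\<^sup>2 * m\<^sup>2 = 0" by (simp add: power2_eq_square power4_eq_xxxx)
    finally show "(\<lambda>k. sqrt (2 * m^4 - 2 * m\<^sup>2 * (norm (U (X (r k))))\<^sup>2)) \<longlonglongrightarrow> 0" by simp
    have "norm (gram v - m\<^sup>2 *\<^sub>R v) \<le> sqrt (2 * m^4 - 2 * m\<^sup>2 * (norm (U v))\<^sup>2)"
      if "v \<in> N" "norm v \<le> 1" for v
    proof (rule real_le_rsqrt)
      have "(norm (gram v - m\<^sup>2 *\<^sub>R v))\<^sup>2 = (norm (gram v))\<^sup>2 - 2 * m\<^sup>2 * (norm (U v))\<^sup>2 + (m\<^sup>2 * norm v)\<^sup>2"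
        unfolding norm_diff_sq scaleR_scaleC
        by (simp add: cinner_scaleC_right cinner_gram_left cinner_self norm_scaleC norm_power)
      moreover have "norm (gram v) \<le> m\<^sup>2" "m\<^sup>2 * norm v \<le> m\<^sup>2"
        using normK[OF that(1)] mult_left_mono[OF that(2), of "m\<^sup>2"] by simp_all
      then have "(norm (gram v))\<^sup>2 \<le> (m\<^sup>2)\<^sup>2" "(m\<^sup>2 * norm v)\<^sup>2 \<le> (m\<^sup>2)\<^sup>2"
        by (simp_all only: power_mono norm_ge_zero mult_nonneg_nonneg zero_le_power2)
      ultimately show "(norm (gram v - m\<^sup>2 *\<^sub>R v))\<^sup>2 \<le> 2 * m^4 - 2 * m\<^sup>2 * (norm (U v))\<^sup>2"
        by simp
    qed
    then show "\<forall>\<^sub>F k in sequentially. norm (gram (X (r k)) - m\<^sup>2 *\<^sub>R X (r k)) \<le>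
        sqrt (2 * m^4 - 2 * m\<^sup>2 * (norm (U (X (r k))))\<^sup>2)"
      using X(1,2) by (simp add: always_eventually)
  qed
  \<comment> \<open>Compactness only gives convergence of the images; with the vanishing defect and
    \<open>0 < m\<close> the vectors \<open>X (r k)\<close> themselves converge.\<close>
  from tendsto_diff[OF Kw this] have "(\<lambda>k. m\<^sup>2 *\<^sub>R X (r k)) \<longlonglongrightarrow> w" by simp
  from tendsto_scaleR[OF tendsto_const this, of "1 / m\<^sup>2"]
  have Xz: "(\<lambda>k. X (r k)) \<longlonglongrightarrow> (1 / m\<^sup>2) *\<^sub>R w" using \<open>0 < m\<close> by simp
  define z where "z = (1 / m\<^sup>2) *\<^sub>R w"
  have "(\<lambda>k. gram (X (r k))) \<longlonglongrightarrow> gram z"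
    unfolding z_def using bounded_gram by (intro bounded_linear.tendsto[OF _ Xz]) (simp add: bounded_clinear_def)
  then have "gram z = w" using Kw by (rule LIMSEQ_unique)
  moreover have "w = m\<^sup>2 *\<^sub>R z" using \<open>0 < m\<close> by (simp add: z_def)
  ultimately have "gram z = m\<^sup>2 *\<^sub>R z" by simp
  then have zE: "z \<in> eigensp m" by (simp add: eigensp_def)
  have perp: "cinner z y = 0" if "y \<in> S" for y
  proof -
    have "(\<lambda>k. cinner (X (r k)) y) \<longlonglongrightarrow> cinner z y"
      unfolding z_def by (rule bounded_linear.tendsto[OF bounded_linear_cinner_left Xz])
    moreover have "cinner (X (r k)) y = 0" for k using X(1)[of "r k"] that by (simp add: N_def)
    ultimately show ?thesis by (simp add: LIMSEQ_const_iff)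
  qed
  have "z = 0" by (rule max[OF zE \<open>0 < m\<close> perp])
  have "(\<lambda>k. norm (U (X (r k)))) \<longlonglongrightarrow> norm (U z)"
    unfolding z_def using bounded_op
    by (intro tendsto_norm bounded_linear.tendsto[OF _ Xz]) (simp add: bounded_clinear_def)
  then have "norm (U z) = m" using lm by (rule LIMSEQ_unique)
  then show False using bounded_clinear_zero[OF bounded_op] \<open>0 < m\<close> \<open>z = 0\<close> by simp
qed

text \<open>Each positive singular number is matched with an eigenvector \<open>p n\<close> of the
  maximal system, and \<open>f n\<close> is its normalised image. Removing from \<open>x\<close> its
  projection onto the \<open>e n\<close> leaves a vector orthogonal to the whole system, on which
  \<open>U\<close> vanishes; applying \<open>U\<close> to the projection series gives the
  expansion.\<close>

lemma singular_value_decomposition: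
  assumes \<sigma>: "singular_numbers U \<sigma>"
  obtains e f where "suborthonormal e" "suborthonormal f"
    "\<And>x. (\<lambda>n. (complex_of_real (\<sigma> n) * cinner x (e n)) *\<^sub>C f n) sums U x"
proof -
  obtain S where S: "orthonormal S" "S \<subseteq> (\<Union>a\<in>{0<..}. eigensp a)"
    and max: "\<And>x a. x \<in> eigensp a \<Longrightarrow> a > 0 \<Longrightarrow> (\<And>y. y \<in> S \<Longrightarrow> cinner x y = 0) \<Longrightarrow> x = 0"
    using ex_maximal_eigenbasis by blast
  have nS: "norm x = 1" if "x \<in> S" for x
  proof -
    have "(norm x)\<^sup>2 = 1" using S(1) that Re_cinner_self[of x] by (simp add: orthonormal_def)
    then show ?thesis by (simp add: power2_eq_1_iff) (smt (verit) norm_ge_zero)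
  qed
  have level: "{x\<in>S. norm (U x) = a} = S \<inter> eigensp a" if "a > 0" for a
    using S(2) nS norm_U_eigensp that by fastforce
  have "card (S \<inter> eigensp a) = cdim (eigensp a)" if "a > 0" for a
  proof (rule cdim_eq_card_orthonormal[symmetric])
    show "orthonormal (S \<inter> eigensp a)" using S(1) by (auto simp: orthonormal_def)
    fix x assume x: "x \<in> eigensp a" "\<And>y. y \<in> S \<inter> eigensp a \<Longrightarrow> cinner x y = 0"
    \<comment> \<open>Orthogonality is given only against \<open>S \<inter> eigensp a\<close>;
      against the rest of \<open>S\<close> it is automatic, as distinct eigenspaces are
      orthogonal.\<close>
    show "x = 0"
    proof (rule max[OF x(1) that])
      fix y assume "y \<in> S"
      then obtain b where "y \<in> eigensp b" "b > 0" using S(2) by auto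
      then show "cinner x y = 0" using x eigensp_orthogonal[OF x(1)] \<open>y \<in> S\<close> that by (cases "a = b") auto
    qed
  qed (auto simp: finite_orthonormal_eigensp[OF S(1) that] subspace_eigensp)
  then have card: "card {n\<in>UNIV. \<sigma> n = a} = card {x\<in>S. norm (U x) = a}" if "a > 0" for a
    using \<sigma> that unfolding singular_numbers_def level[OF that] by (simp add: eigensp_def gram_def)
  have lim: "\<sigma> \<longlonglongrightarrow> 0" and \<sigma>0: "\<And>n. 0 \<le> \<sigma> n" using \<sigma> by (auto simp: singular_numbers_def)
  obtain p where p: "bij_betw p {n\<in>UNIV. \<sigma> n > 0} {x\<in>S. norm (U x) > 0}"
    "\<And>n. \<sigma> n > 0 \<Longrightarrow> norm (U (p n)) = \<sigma> n"
    using bij_betw_level_sets[OF _ _ card] finite_level_set(3)[OF lim] finite_orthonormal_eigensp[OF S(1)] level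
    by (auto simp del: zero_less_norm_iff)
  have pS: "p n \<in> S \<inter> eigensp (\<sigma> n)" if "\<sigma> n > 0" for n
    using bij_betwE[OF p(1)] p(2)[OF that] level[OF that] that by blast
  have pp: "cinner (p m) (p n) = (if m = n then 1 else 0)" if "\<sigma> m > 0" "\<sigma> n > 0" for m n
    using S(1) pS[OF that(1)] pS[OF that(2)] bij_betw_imp_inj_on[OF p(1)] that
    by (auto simp: orthonormal_def dest: inj_onD)
  define e where "e n = (if \<sigma> n > 0 then p n else 0)" for n
  define f where "f n = (if \<sigma> n > 0 then complex_of_real (1 / \<sigma> n) *\<^sub>C U (p n) else 0)" for n
  have e: "suborthonormal e"
    using pp pS nS by (auto simp: suborthonormal_def e_def)
  have "cinner (U (p m)) (U (p n)) = 0" if "m \<noteq> n" "\<sigma> m > 0" "\<sigma> n > 0" for m n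
    using that pp pS[of n] cinner_U_eigensp[of "p n" "\<sigma> n"] by simp
  then have f: "suborthonormal f"
    by (auto simp: suborthonormal_def f_def cinner_scaleC_left cinner_scaleC_right norm_scaleC norm_divide p(2))
  have \<sigma>f: "complex_of_real (\<sigma> n) *\<^sub>C f n = U (e n)" for n
    by (auto simp: f_def e_def scaleC_scaleC scaleC_one bounded_clinear_zero[OF bounded_op])
  have "(\<lambda>n. (complex_of_real (\<sigma> n) * cinner x (e n)) *\<^sub>C f n) sums U x" for x
  proof -
    define y where "y = (\<Sum>n. cinner x (e n) *\<^sub>C e n)"
    have y: "(\<lambda>n. cinner x (e n) *\<^sub>C e n) sums y"
      unfolding y_def by (intro summable_sums suborthonormal_series[OF e] bessel_summable[OF e])
    have "cinner (x - y) (e m) = 0" for m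
    proof -
      have "(\<lambda>n. cinner (cinner x (e n) *\<^sub>C e n) (e m)) sums cinner y (e m)"
        by (rule bounded_linear.sums[OF bounded_linear_cinner_left y])
      moreover have "cinner (cinner x (e n) *\<^sub>C e n) (e m) = (if n = m then cinner x (e m) else 0)" for n
        using e pp[of m m] by (auto simp: cinner_scaleC_left suborthonormal_def e_def)
      ultimately have "(\<lambda>n. if n = m then cinner x (e m) else 0) sums cinner y (e m)" by simp
      from sums_unique2[OF this sums_single[of m "\<lambda>_. cinner x (e m)"]] show ?thesis
        by (simp add: cinner_diff_left)
    qed
    moreover have "\<exists>n. y = e n" if "y \<in> S" for y
    proof -
      have "norm (U y) > 0" using S(2) that nS norm_U_eigensp by fastforce
      then have "y \<in> p ` {n\<in>UNIV. \<sigma> n > 0}" using bij_betw_imp_surj_on[OF p(1)] that by auto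
      then show ?thesis by (auto simp: e_def)
    qed
    ultimately have "U (x - y) = 0" by (intro U_eq_0_if_orthogonal[OF S(2) max]) auto
    then have "U x = U y" by (simp add: bounded_clinear_diff[OF bounded_op])
    have "(\<lambda>n. U (cinner x (e n) *\<^sub>C e n)) sums U y"
      using bounded_op by (intro bounded_linear.sums[OF _ y]) (simp add: bounded_clinear_def)
    moreover have "U (cinner x (e n) *\<^sub>C e n) = (complex_of_real (\<sigma> n) * cinner x (e n)) *\<^sub>C f n" for n
      unfolding bounded_clinear_scaleC[OF bounded_op] \<sigma>f[symmetric] by (simp add: scaleC_scaleC mult.commute)
    ultimately show ?thesis using \<open>U x = U y\<close> by simp
  qed
  then show ?thesis using that e f by blast
qed

end

section \<open>Products of Lorentz sequences\<close>

text \<open>A null sequence takes finitely many values above \<open>a/2\<close>, so its values below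
  \<open>a\<close> stay away from \<open>a\<close>. Allowing a whole interval of \<open>b'\<close>
  lets two sequences share one threshold.\<close>

lemma left_isolated_level:
  fixes f :: "nat \<Rightarrow> real"
  assumes "f \<longlonglongrightarrow> 0" "a > 0"
  obtains b where "0 < b" "b < a" "\<And>b'. b \<le> b' \<Longrightarrow> b' < a \<Longrightarrow> {n. f n > b'} = {n. f n \<ge> a}"
proof -
  define V where "V = insert (a/2) (f ` {n. f n > a/2} \<inter> {..<a})"
  have "finite {n. f n > a/2}" using finite_level_set(1)[OF assms(1), of "a/2"] assms(2) by simp
  then have fin: "finite V" by (simp add: V_def)
  define b where "b = Max V"
  have "b \<in> V" unfolding b_def by (rule Max_in[OF fin]) (simp add: V_def)
  then have "b < a" using assms(2) by (auto simp: V_def)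
  have "a/2 \<le> b" unfolding b_def by (rule Max_ge[OF fin]) (simp add: V_def)
  moreover have "{n. f n > b'} = {n. f n \<ge> a}" if "b \<le> b'" "b' < a" for b'
  proof -
    have "f n \<ge> a" if "f n > b'" for n
    proof (rule ccontr)
      assume "\<not> f n \<ge> a"
      then have "f n \<in> V" using that \<open>b \<le> b'\<close> \<open>a/2 \<le> b\<close> by (auto simp: V_def)
      then have "f n \<le> b" unfolding b_def by (rule Max_ge[OF fin])
      then show False using that \<open>b \<le> b'\<close> by simp
    qed
    then show ?thesis using that by force
  qed
  ultimately show ?thesis using \<open>b < a\<close> assms(2) by (intro that[of b]) auto
qed

text \<open>\<open>\<rho>\<close> is the generalised inverse of the counting function
  \<open>N\<close>: \<open>\<rho> k > a\<close> holds exactly when \<open>k < N a\<close>. So both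
  sequences have equal counts above each positive threshold, and a multiplicity is a difference of
  such counts. If \<open>c\<close> has finitely many positive terms, \<open>\<rho>\<close> ends in
  zeros.\<close>

lemma decreasing_rearrangement:
  fixes c :: "nat \<Rightarrow> real"
  assumes lim: "c \<longlonglongrightarrow> 0"
  obtains \<rho> where "decseq \<rho>" "\<And>n. 0 \<le> \<rho> n" "\<rho> \<longlonglongrightarrow> 0"
    "\<And>a. a > 0 \<Longrightarrow> card {n. \<rho> n = a} = card {n. c n = a}"
proof -
  define N where "N a = card {n. c n > a}" for a
  define A where "A k = {a. a > 0 \<and> N a \<le> k}" for k
  define \<rho> where "\<rho> k = Inf (A k)" for k
  note fin = finite_level_set(1)[OF lim]
  have anti: "N b \<le> N a" if "a > 0" "a \<le> b" for a b
    unfolding N_def by (rule card_mono[OF fin[OF that(1)]]) (use that in auto)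
  have "Bseq c" using lim convergent_imp_Bseq convergent_def by blast
  then obtain B where B: "B > 0" "\<And>n. norm (c n) \<le> B" by (auto simp: Bseq_def)
  have "\<not> c n > B" for n using B(2)[of n] by simp
  then have "{n. c n > B} = {}" by blast
  then have "N B = 0" by (simp add: N_def)
  then have "A k \<noteq> {}" for k using B by (auto simp: A_def)
  moreover have bdd: "bdd_below (A k)" for k by (rule bdd_belowI[of _ 0]) (simp add: A_def)
  ultimately have \<rho>0: "0 \<le> \<rho> k" for k unfolding \<rho>_def by (intro cInf_greatest) (auto simp: A_def)
  have iff: "\<rho> k > a \<longleftrightarrow> k < N a" if "a > 0" for a k
  proof
    assume "\<rho> k > a"
    then show "k < N a" using cInf_lower[OF _ bdd, of a k] that by (force simp: A_def \<rho>_def)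
  next
    assume k: "k < N a"
    \<comment> \<open>\<open>b\<close> is the least value of \<open>c\<close> above
      \<open>a\<close>. No threshold below \<open>b\<close> brings the count down to
      \<open>k\<close>, so the infimum stays strictly above \<open>a\<close>.\<close>
    define b where "b = Min (c ` {n. c n > a})"
    have ne: "{n. c n > a} \<noteq> {}" using k by (force simp: N_def)
    then have "b > a" unfolding b_def using fin[OF that] by (subst Min_gr_iff) auto
    have "b \<le> x" if "x \<in> A k" for x
    proof (rule ccontr)
      assume "\<not> b \<le> x"
      then have "{n. c n > a} \<subseteq> {n. c n > x}"
        using order.strict_trans2[OF _ Min_le[OF finite_imageI[OF fin[OF \<open>a > 0\<close>]] imageI]]
        unfolding b_def by (auto simp: not_le)
      then have "N a \<le> N x" unfolding N_def using that by (intro card_mono fin) (auto simp: A_def)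
      then show False using k that by (simp add: A_def)
    qed
    then have "b \<le> \<rho> k" unfolding \<rho>_def using \<open>A k \<noteq> {}\<close> by (intro cInf_greatest)
    then show "\<rho> k > a" using \<open>b > a\<close> by simp
  qed
  have dec: "decseq \<rho>"
    unfolding decseq_def \<rho>_def using \<open>\<And>k. A k \<noteq> {}\<close> bdd
    by (intro allI impI cInf_superset_mono) (auto simp: A_def)
  have lim\<rho>: "\<rho> \<longlonglongrightarrow> 0"
  proof (rule LIMSEQ_I)
    fix e :: real assume "e > 0"
    have "norm (\<rho> k - 0) < e" if "k \<ge> N (e/2)" for k
      using iff[of "e/2" k] \<rho>0[of k] \<open>e > 0\<close> that by auto
    then show "\<exists>no. \<forall>k\<ge>no. norm (\<rho> k - 0) < e" by blast
  qed
  have "card {n. \<rho> n = a} = card {n. c n = a}" if a: "a > 0" for a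
  proof -
    obtain b1 where b1: "0 < b1" "b1 < a" "\<And>b'. b1 \<le> b' \<Longrightarrow> b' < a \<Longrightarrow> {n. c n > b'} = {n. c n \<ge> a}"
      using left_isolated_level[OF lim a] by blast
    obtain b2 where b2: "0 < b2" "b2 < a" "\<And>b'. b2 \<le> b' \<Longrightarrow> b' < a \<Longrightarrow> {n. \<rho> n > b'} = {n. \<rho> n \<ge> a}"
      using left_isolated_level[OF lim\<rho> a] by blast
    have split: "card {n. f n = a} = card {n. f n \<ge> a} - card {n. f n > a}" if "f \<longlonglongrightarrow> 0" for f :: "nat \<Rightarrow> real"
    proof -
      have "{n. f n = a} = {n. f n \<ge> a} - {n. f n > a}" by auto
      then show ?thesis using finite_level_set(1)[OF that a] by (simp add: card_Diff_subset Collect_mono)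
    qed
    have count: "card {n. \<rho> n > x} = card {n. c n > x}" if "x > 0" for x
      using iff[OF that] by (simp add: N_def)
    have "card {n. \<rho> n \<ge> a} = card {n. c n \<ge> a}"
      using count[of "max b1 b2"] b1(1,2) b2(1,2) b1(3)[of "max b1 b2"] b2(3)[of "max b1 b2"]
      by (simp only: max_less_iff_conj max.cobounded1 max.cobounded2 less_max_iff_disj simp_thms)
    then show ?thesis by (simp add: split[OF lim\<rho>] split[OF lim] count[OF a])
  qed
  then show ?thesis using that dec \<rho>0 lim\<rho> by blast
qed

text \<open>The \<open>k\<close>-th element of \<open>F\<close>, counted from 0, is at least
  \<open>k\<close>. In the application, \<open>s \<le> r\<close> is what makes the weights
  decrease.\<close>

lemma sum_decseq_le:
  fixes w :: "nat \<Rightarrow> real"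
  assumes "decseq w" "finite F"
  shows "sum w F \<le> sum w {..<card F}"
  using assms(2)
proof (induction rule: finite_linorder_max_induct)
  case (insert b A)
  have "card A \<le> b" using card_mono[of "{..<b}" A] insert by auto
  then have "w b \<le> w (card A)" using assms(1) by (auto simp: decseq_def)
  then show ?case using insert by (auto simp: card_insert_if)
qed simp

text \<open>Telescoping, written over all \<open>q < M\<close> so that \<open>a\<close> appears as a
  combination of indicators of the segments \<open>{..q}\<close> and sums can be
  interchanged.\<close>

lemma layer_representation:
  fixes a :: "nat \<Rightarrow> real"
  assumes "a M = 0" "i \<le> M"
  shows "a i = (\<Sum>q<M. if i \<le> q then a q - a (Suc q) else 0)"
proof -
  have "(\<Sum>q<M. if i \<le> q then a q - a (Suc q) else 0) = (\<Sum>q\<in>{i..<M}. a q - a (Suc q))"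
    by (rule sum.mono_neutral_cong_right) auto
  also have "\<dots> = - (\<Sum>q\<in>{i..<M}. a (Suc q) - a q)" by (simp flip: sum_negf)
  also have "\<dots> = a i" using assms by (simp add: sum_Suc_diff')
  finally show ?thesis by simp
qed

text \<open>Both sequences are positive combinations of indicators of initial segments, for which the
  estimate is the submultiplicativity of the partial sums of \<open>w\<close>.\<close>

lemma weighted_product_sum_le:
  fixes w a b :: "nat \<Rightarrow> real" and p :: "nat \<Rightarrow> nat \<times> nat"
  assumes w: "decseq w" "\<And>n. 0 \<le> w n"
    and W: "\<And>m n. sum w {..<m * n} \<le> C * (sum w {..<m} * sum w {..<n})"
    and a: "decseq a" "\<And>n. 0 \<le> a n" and b: "decseq b" "\<And>n. 0 \<le> b n"
    and S: "finite S" "inj_on p S" "p ` S \<subseteq> {..<M} \<times> {..<M}"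
  shows "(\<Sum>k\<in>S. w k * (a (fst (p k)) * b (snd (p k)))) \<le> C * ((\<Sum>k<M. w k * a k) * (\<Sum>k<M. w k * b k))"
proof -
  \<comment> \<open>Dropping to 0 at \<open>M\<close> makes the layer sum finite, and the increments
    of a nonnegative decreasing sequence stay nonnegative.\<close>
  define cut where "cut f q = (if q < M then f q else 0)" for f :: "nat \<Rightarrow> real" and q
  define D where "D f q = cut f q - cut f (Suc q)" for f q
  have D0: "0 \<le> D f q" if "decseq f" "\<And>n. 0 \<le> f n" for f q
    using that decseq_SucD[OF that(1)] by (auto simp: D_def cut_def)
  have layer: "f i = (\<Sum>q<M. if i \<le> q then D f q else 0)" if "i < M" for f i
  proof -
    have "f i = cut f i" using that by (simp add: cut_def)
    also have "\<dots> = (\<Sum>q<M. if i \<le> q then D f q else 0)"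
      unfolding D_def by (rule layer_representation) (use that in \<open>simp_all add: cut_def\<close>)
    finally show ?thesis .
  qed
  \<comment> \<open>Abel summation. The bound is \<open>Suc q\<close> because the segment
    \<open>{..q}\<close> has \<open>q + 1\<close> elements.\<close>
  have sumD: "(\<Sum>q<M. D f q * sum w {..<Suc q}) = (\<Sum>k<M. w k * f k)" for f
  proof -
    have "(\<Sum>k<M. w k * f k) = (\<Sum>k<M. \<Sum>q<M. if k \<le> q then D f q * w k else 0)"
      by (intro sum.cong refl) (subst layer, auto simp: sum_distrib_left intro!: sum.cong)
    also have "\<dots> = (\<Sum>q<M. \<Sum>k<M. if k \<le> q then D f q * w k else 0)" by (rule sum.swap)
    also have "\<dots> = (\<Sum>q<M. D f q * sum w {..<Suc q})"
    proof (rule sum.cong[OF refl])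
      fix q assume "q \<in> {..<M}"
      then have "(\<Sum>k<M. if k \<le> q then D f q * w k else 0) = (\<Sum>k<Suc q. D f q * w k)"
        by (intro sum.mono_neutral_cong_right) auto
      then show "(\<Sum>k<M. if k \<le> q then D f q * w k else 0) = D f q * sum w {..<Suc q}"
        by (simp only: sum_distrib_left)
    qed
    finally show ?thesis by simp
  qed
  \<comment> \<open>\<open>T q q'\<close> collects the indices sent into a rectangle of
    \<open>Suc q * Suc q'\<close> points; injectivity of \<open>p\<close> bounds its size, and the
    decreasing weights then bound its weight.\<close>
  define T where "T q q' = {k\<in>S. fst (p k) \<le> q \<and> snd (p k) \<le> q'}" for q q'
  have T: "sum w (T q q') \<le> C * (sum w {..<Suc q} * sum w {..<Suc q'})" for q q'
  proof -
    have "card (T q q') = card (p ` T q q')"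
      using S(2) by (intro card_image[symmetric]) (auto simp: T_def inj_on_def)
    also have "\<dots> \<le> card ({..<Suc q} \<times> {..<Suc q'})"
      by (intro card_mono image_subsetI) (auto simp: T_def mem_Times_iff less_Suc_eq_le)
    finally have "card (T q q') \<le> Suc q * Suc q'" by simp
    moreover have "sum w (T q q') \<le> sum w {..<card (T q q')}"
      using w(1) S(1) by (intro sum_decseq_le) (simp_all add: T_def)
    ultimately have "sum w (T q q') \<le> sum w {..<Suc q * Suc q'}"
      using w(2) sum_mono2[of "{..<Suc q * Suc q'}" "{..<card (T q q')}" w] by force
    then show ?thesis using W order_trans by blast
  qed
  have "(\<Sum>k\<in>S. w k * (a (fst (p k)) * b (snd (p k)))) =
      (\<Sum>k\<in>S. \<Sum>q<M. \<Sum>q'<M. if k \<in> T q q' then D a q * D b q' * w k else 0)"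
  proof (rule sum.cong[OF refl])
    fix k assume k: "k \<in> S"
    then have "fst (p k) < M" "snd (p k) < M" using S(3) by auto
    then have "w k * (a (fst (p k)) * b (snd (p k))) = w k * ((\<Sum>q<M. if fst (p k) \<le> q then D a q else 0) *
        (\<Sum>q'<M. if snd (p k) \<le> q' then D b q' else 0))"
      using layer[of "fst (p k)" a] layer[of "snd (p k)" b] by simp
    also have "\<dots> = (\<Sum>q<M. \<Sum>q'<M. w k * ((if fst (p k) \<le> q then D a q else 0) *
        (if snd (p k) \<le> q' then D b q' else 0)))"
      unfolding sum_product by (simp only: sum_distrib_left)
    also have "\<dots> = (\<Sum>q<M. \<Sum>q'<M. if k \<in> T q q' then D a q * D b q' * w k else 0)"
      using k by (intro sum.cong refl) (simp add: T_def)
    finally show "w k * (a (fst (p k)) * b (snd (p k))) = \<dots>" .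
  qed
  also have "\<dots> = (\<Sum>q<M. \<Sum>k\<in>S. \<Sum>q'<M. if k \<in> T q q' then D a q * D b q' * w k else 0)"
    by (rule sum.swap)
  also have "\<dots> = (\<Sum>q<M. \<Sum>q'<M. \<Sum>k\<in>S. if k \<in> T q q' then D a q * D b q' * w k else 0)"
    by (intro sum.cong refl sum.swap)
  also have "\<dots> = (\<Sum>q<M. \<Sum>q'<M. D a q * D b q' * sum w (T q q'))"
  proof (intro sum.cong refl)
    fix q q'
    have "(\<Sum>k\<in>S. if k \<in> T q q' then D a q * D b q' * w k else 0) = (\<Sum>k\<in>T q q'. D a q * D b q' * w k)"
      using S(1) by (intro sum.mono_neutral_cong_right) (auto simp: T_def)
    then show "(\<Sum>k\<in>S. if k \<in> T q q' then D a q * D b q' * w k else 0) = D a q * D b q' * sum w (T q q')"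
      by (simp only: sum_distrib_left)
  qed
  also have "\<dots> \<le> (\<Sum>q<M. \<Sum>q'<M. D a q * D b q' * (C * (sum w {..<Suc q} * sum w {..<Suc q'})))"
    by (intro sum_mono mult_left_mono T mult_nonneg_nonneg D0 a b)
  also have "\<dots> = (\<Sum>q<M. \<Sum>q'<M. C * ((D a q * sum w {..<Suc q}) * (D b q' * sum w {..<Suc q'})))"
    by (intro sum.cong refl) (simp only: ac_simps)
  also have "\<dots> = C * ((\<Sum>q<M. D a q * sum w {..<Suc q}) * (\<Sum>q<M. D b q * sum w {..<Suc q}))"
    by (simp only: sum_product[of "\<lambda>q. D a q * sum w {..<Suc q}"] sum_distrib_left[of C])
  finally show ?thesis unfolding sumD .
qed

text \<open>A discrete comparison with the integral of \<open>t powr (\<theta> - 1)\<close>: each of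
  the \<open>n\<close> terms is at least the last one, and by the mean value theorem each is at most
  the corresponding increment of \<open>t powr \<theta> / \<theta>\<close>.\<close>

lemma sum_powr_bounds:
  assumes "0 < \<theta>" "\<theta> \<le> 1"
  shows "real n powr \<theta> \<le> (\<Sum>k<n. real (Suc k) powr (\<theta> - 1))"
    and "(\<Sum>k<n. real (Suc k) powr (\<theta> - 1)) \<le> real n powr \<theta> / \<theta>"
proof -
  have "(\<Sum>k<n. real n powr (\<theta> - 1)) \<le> (\<Sum>k<n. real (Suc k) powr (\<theta> - 1))"
    using assms by (intro sum_mono powr_mono2') auto
  moreover have "real n * real n powr (\<theta> - 1) = real n powr \<theta>"
    by (cases "n = 0") (simp_all add: powr_diff)
  ultimately show "real n powr \<theta> \<le> (\<Sum>k<n. real (Suc k) powr (\<theta> - 1))" by simp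
  show "(\<Sum>k<n. real (Suc k) powr (\<theta> - 1)) \<le> real n powr \<theta> / \<theta>"
  proof (induction n)
    case (Suc n)
    have "real (Suc n) powr (\<theta> - 1) \<le> (real (Suc n) powr \<theta> - real n powr \<theta>) / \<theta>"
    proof (cases "n = 0")
      case False
      have "\<exists>z. real n < z \<and> z < real (Suc n) \<and> real (Suc n) powr \<theta> - real n powr \<theta> =
          (real (Suc n) - real n) * (\<theta> * z powr (\<theta> - 1))"
        using False by (intro MVT2) (auto intro!: derivative_eq_intros simp: has_real_derivative_powr)
      then obtain z where z: "real n < z" "z < real (Suc n)"
        "real (Suc n) powr \<theta> - real n powr \<theta> = \<theta> * z powr (\<theta> - 1)" by auto
      have "real (Suc n) powr (\<theta> - 1) \<le> z powr (\<theta> - 1)"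
        using assms z False by (intro powr_mono2') auto
      then show ?thesis using z(3) assms by (simp add: field_simps)
    qed (use assms in \<open>simp add: field_simps\<close>)
    then show ?case using Suc by (simp add: diff_divide_distrib)
  qed simp
qed

text \<open>The partial sums are comparable to \<open>n powr \<theta>\<close>, which is
  multiplicative in \<open>n\<close>. For \<open>\<theta> = s / r\<close> the constant becomes
  \<open>r / s\<close>.\<close>

lemma sum_powr_submultiplicative:
  assumes "0 < \<theta>" "\<theta> \<le> 1"
  shows "(\<Sum>k<m * n. real (Suc k) powr (\<theta> - 1)) \<le>
    1 / \<theta> * ((\<Sum>k<m. real (Suc k) powr (\<theta> - 1)) * (\<Sum>k<n. real (Suc k) powr (\<theta> - 1)))"
proof -
  have "(\<Sum>k<m * n. real (Suc k) powr (\<theta> - 1)) \<le> real (m * n) powr \<theta> / \<theta>"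
    by (rule sum_powr_bounds[OF assms])
  also have "\<dots> = 1 / \<theta> * (real m powr \<theta> * real n powr \<theta>)" by (simp add: powr_mult)
  also have "\<dots> \<le> 1 / \<theta> * ((\<Sum>k<m. real (Suc k) powr (\<theta> - 1)) * (\<Sum>k<n. real (Suc k) powr (\<theta> - 1)))"
    using assms by (intro mult_left_mono mult_mono sum_powr_bounds sum_nonneg) auto
  finally show ?thesis .
qed

lemma LIMSEQ_zeroI:
  fixes c :: "nat \<Rightarrow> real"
  assumes "\<And>n. 0 \<le> c n" "\<And>e. e > 0 \<Longrightarrow> finite {n. c n \<ge> e}"
  shows "c \<longlonglongrightarrow> 0"
proof (rule LIMSEQ_I)
  fix e :: real assume "e > 0"
  obtain N where "\<forall>n\<in>{n. c n \<ge> e}. n < N"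
    using assms(2)[OF \<open>e > 0\<close>] unfolding finite_nat_set_iff_bounded by blast
  then have "\<forall>n\<ge>N. norm (c n - 0) < e" using assms(1) by (force simp: not_le)
  then show "\<exists>no. \<forall>n\<ge>no. norm (c n - 0) < e" by blast
qed

text \<open>The diagonal of the tensor product of two diagonal operators. \<open>prod_decode\<close>
  lists the index pairs without regard to the size of the entries, so the sequence need not
  decrease.\<close>

definition tensor_seq :: "(nat \<Rightarrow> real) \<Rightarrow> (nat \<Rightarrow> real) \<Rightarrow> nat \<Rightarrow> real" where
  "tensor_seq \<sigma> \<tau> n = \<sigma> (fst (prod_decode n)) * \<tau> (snd (prod_decode n))"

definition lorentz_seq :: "real \<Rightarrow> real \<Rightarrow> (nat \<Rightarrow> real) \<Rightarrow> bool" where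
  "lorentz_seq r s \<sigma> \<longleftrightarrow> decseq \<sigma> \<and> (\<forall>n. 0 \<le> \<sigma> n) \<and> \<sigma> \<longlonglongrightarrow> 0 \<and>
     summable (\<lambda>n. real (Suc n) powr (s / r - 1) * \<sigma> n powr s)"

lemma tensor_seq_tendsto_0:
  assumes "lorentz_seq r s \<sigma>" "lorentz_seq r s \<tau>"
  shows "tensor_seq \<sigma> \<tau> \<longlonglongrightarrow> 0"
proof (rule LIMSEQ_zeroI)
  note \<sigma> = assms(1)[unfolded lorentz_seq_def] and \<tau> = assms(2)[unfolded lorentz_seq_def]
  show "0 \<le> tensor_seq \<sigma> \<tau> n" for n using \<sigma> \<tau> by (simp add: tensor_seq_def)
  fix e :: real assume e: "e > 0"
  \<comment> \<open>Adding 1 to the largest entry keeps the bound positive, so that division by it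
    is possible even for the zero sequence.\<close>
  define A where "A = \<sigma> 0 + 1"
  define B where "B = \<tau> 0 + 1"
  have AB: "A > 0" "B > 0" using \<sigma> \<tau> by (auto simp: A_def B_def add_nonneg_pos)
  have le: "\<sigma> n \<le> A" "\<tau> n \<le> B" for n
    using decseqD[of \<sigma> 0 n] decseqD[of \<tau> 0 n] \<sigma> \<tau> by (auto simp: A_def B_def)
  have "\<sigma> i \<ge> e / B \<and> \<tau> j \<ge> e / A" if "\<sigma> i * \<tau> j \<ge> e" for i j
  proof -
    have "\<sigma> i * \<tau> j \<le> \<sigma> i * B" "\<sigma> i * \<tau> j \<le> A * \<tau> j"
      using le \<sigma> \<tau> by (auto intro: mult_left_mono mult_right_mono)
    then show ?thesis using that AB by (auto simp: field_simps)
  qed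
  then have "{n. e \<le> tensor_seq \<sigma> \<tau> n} \<subseteq> prod_encode ` ({i. \<sigma> i \<ge> e / B} \<times> {j. \<tau> j \<ge> e / A})"
    by (auto simp: tensor_seq_def image_iff) (metis prod.collapse prod_decode_inverse)
  moreover have "finite ({i. \<sigma> i \<ge> e / B} \<times> {j. \<tau> j \<ge> e / A})"
    using \<sigma> \<tau> e AB by (intro finite_cartesian_product finite_level_set(2)) auto
  ultimately show "finite {n. e \<le> tensor_seq \<sigma> \<tau> n}" by (meson finite_imageI finite_subset)
qed

text \<open>Each positive \<open>\<rho> k\<close> has its own index pair, so the partial sums of the
  rearranged series are weighted sums over distinct pairs, to which
  \<open>weighted_product_sum_le\<close> applies with the \<open>s\<close>-th powers.\<close>

lemma lorentz_seq_tensor: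
  assumes rs: "0 < s" "s \<le> r" and \<sigma>: "lorentz_seq r s \<sigma>" and \<tau>: "lorentz_seq r s \<tau>"
  obtains \<rho> where "lorentz_seq r s \<rho>"
    "\<And>a. a > 0 \<Longrightarrow> card {n. \<rho> n = a} = card {n. tensor_seq \<sigma> \<tau> n = a}"
proof -
  let ?c = "tensor_seq \<sigma> \<tau>" and ?w = "\<lambda>n. real (Suc n) powr (s / r - 1)"
  note lim = tensor_seq_tendsto_0[OF \<sigma> \<tau>]
  have \<theta>: "0 < s / r" "s / r \<le> 1" using rs by auto
  obtain \<rho> where \<rho>: "decseq \<rho>" "\<And>n. 0 \<le> \<rho> n" "\<rho> \<longlonglongrightarrow> 0"
    "\<And>a. a > 0 \<Longrightarrow> card {n. \<rho> n = a} = card {n. ?c n = a}"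
    using decreasing_rearrangement[OF lim] by blast
  obtain p where p: "bij_betw p {n\<in>UNIV. \<rho> n > 0} {n\<in>UNIV. ?c n > 0}"
    "\<And>n. n \<in> UNIV \<Longrightarrow> \<rho> n > 0 \<Longrightarrow> ?c (p n) = \<rho> n"
    by (rule bij_betw_level_sets[of UNIV \<rho> UNIV ?c])
      (use \<rho> finite_level_set(3)[OF \<rho>(3)] finite_level_set(3)[OF lim] in \<open>simp_all\<close>)
  have dec: "decseq (\<lambda>n. f n powr s)" if "lorentz_seq r s f" for f
    using that rs by (auto simp: lorentz_seq_def decseq_def intro!: powr_mono2)
  have sum_le: "(\<Sum>k<M. ?w k * f k powr s) \<le> (\<Sum>k. ?w k * f k powr s)" if "lorentz_seq r s f" for f M
    using that by (intro sum_le_suminf) (auto simp: lorentz_seq_def)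
  have "(\<Sum>k<n. ?w k * \<rho> k powr s) \<le> 1 / (s / r) * ((\<Sum>k. ?w k * \<sigma> k powr s) * (\<Sum>k. ?w k * \<tau> k powr s))" for n
  proof -
    \<comment> \<open>Only positive values are matched with pairs; the other terms vanish because
      \<open>0 powr s = 0\<close>.\<close>
    define S where "S = {k. k < n \<and> \<rho> k > 0}"
    have fin: "finite S" by (simp add: S_def)
    define q where "q k = prod_decode (p k)" for k
    have "inj_on p S" using bij_betw_imp_inj_on[OF p(1)] by (auto simp: S_def inj_on_def)
    then have inj: "inj_on q S" by (simp add: q_def inj_on_def prod_decode_eq)
    \<comment> \<open>\<open>prod_encode\<close> dominates both components, so a bound on the
      finitely many codes yields a square containing all pairs.\<close>
    have "\<exists>M. q ` S \<subseteq> {..<M} \<times> {..<M}"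
    proof -
      obtain M where M: "p k < M" if "k \<in> S" for k
        using finite_imageI[OF fin, of p] by (auto simp: finite_nat_set_iff_bounded)
      have "q k \<in> {..<M} \<times> {..<M}" if "k \<in> S" for k
        using M[OF that] le_prod_encode_1[of "fst (q k)" "snd (q k)"] le_prod_encode_2[of "snd (q k)" "fst (q k)"]
        by (simp add: mem_Times_iff q_def)
      then show ?thesis by blast
    qed
    then obtain M where M: "q ` S \<subseteq> {..<M} \<times> {..<M}" by blast
    have "(\<Sum>k<n. ?w k * \<rho> k powr s) = (\<Sum>k\<in>S. ?w k * \<rho> k powr s)"
    proof (rule sum.mono_neutral_right)
      show "\<forall>i\<in>{..<n} - S. ?w i * \<rho> i powr s = 0"
        using \<rho>(2) by (force simp: S_def order.order_iff_strict)
    qed (auto simp: S_def)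
    also have "\<dots> = (\<Sum>k\<in>S. ?w k * (\<sigma> (fst (q k)) powr s * \<tau> (snd (q k)) powr s))"
    proof (rule sum.cong[OF refl])
      fix k assume "k \<in> S"
      then have "\<rho> k = \<sigma> (fst (q k)) * \<tau> (snd (q k))"
        using p(2)[of k] by (simp add: S_def q_def tensor_seq_def)
      then show "?w k * \<rho> k powr s = ?w k * (\<sigma> (fst (q k)) powr s * \<tau> (snd (q k)) powr s)"
        using \<sigma> \<tau> by (simp add: powr_mult lorentz_seq_def)
    qed
    also have "\<dots> \<le> 1 / (s / r) * ((\<Sum>k<M. ?w k * \<sigma> k powr s) * (\<Sum>k<M. ?w k * \<tau> k powr s))"
      using \<theta> by (intro weighted_product_sum_le[OF _ _ sum_powr_submultiplicative[OF \<theta>] dec[OF \<sigma>] _ dec[OF \<tau>] _ fin inj M])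
        (auto simp: decseq_def intro!: powr_mono2')
    also have "\<dots> \<le> 1 / (s / r) * ((\<Sum>k. ?w k * \<sigma> k powr s) * (\<Sum>k. ?w k * \<tau> k powr s))"
      using \<theta> \<sigma> \<tau> rs by (intro mult_left_mono mult_mono sum_le suminf_nonneg sum_nonneg)
        (auto simp: lorentz_seq_def)
    finally show ?thesis .
  qed
  then have "summable (\<lambda>n. ?w n * \<rho> n powr s)" by (intro summableI_nonneg_bounded) auto
  then show ?thesis using that[of \<rho>] \<rho> by (auto simp: lorentz_seq_def)
qed

section \<open>Diagonal operators on \<open>\<ell>\<^sub>2\<close>\<close>

lemma ell2_coord_add [simp]: "ell2_coord (x + y) n = ell2_coord x n + ell2_coord y n"
  by (simp add: plus_ell2.rep_eq)

lemma ell2_coord_scaleC [simp]: "ell2_coord (c *\<^sub>C x) n = c * ell2_coord x n"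
  by (simp add: scaleC_ell2.rep_eq)

lemma ell2_coord_zero [simp]: "ell2_coord 0 n = 0"
  by (simp add: zero_ell2.rep_eq)

lemma ell2_coord_diff [simp]: "ell2_coord (x - y) n = ell2_coord x n - ell2_coord y n"
  by (simp only: minus_ell2_def plus_ell2.rep_eq uminus_ell2.rep_eq diff_conv_add_uminus)

lemma ell2_coord_sum: "ell2_coord (sum f A) n = (\<Sum>a\<in>A. ell2_coord (f a) n)"
  by (induction A rule: infinite_finite_induct) simp_all

lemma ell2_eqI: "(\<And>n. ell2_coord x n = ell2_coord y n) \<Longrightarrow> x = y"
  by (simp add: ell2_coord_inject[symmetric] ext)

lemma ell2_coord_Abs: "summable (\<lambda>n. (cmod (x n))\<^sup>2) \<Longrightarrow> ell2_coord (Abs_ell2 x) = x"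
  by (simp add: Abs_ell2_inverse)

lemma ell2_summable: "summable (\<lambda>n. (cmod (ell2_coord x n))\<^sup>2)"
  using ell2_coord[of x] by simp

lemma ell2_norm_sq: "(norm x)\<^sup>2 = (\<Sum>n. (cmod (ell2_coord x n))\<^sup>2)"
  by (simp add: norm_ell2.rep_eq suminf_nonneg ell2_summable)

lemma ell2_sum_le: "finite F \<Longrightarrow> (\<Sum>n\<in>F. (cmod (ell2_coord x n))\<^sup>2) \<le> (norm x)\<^sup>2"
  unfolding ell2_norm_sq by (rule sum_le_suminf[OF ell2_summable]) auto

lemma ell2_norm_leI:
  assumes "0 \<le> B" "\<And>N. (\<Sum>n<N. (cmod (ell2_coord x n))\<^sup>2) \<le> B\<^sup>2"
  shows "norm x \<le> B"
proof (rule power2_le_imp_le[OF _ assms(1)])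
  show "(norm x)\<^sup>2 \<le> B\<^sup>2" unfolding ell2_norm_sq by (rule suminf_le_const[OF ell2_summable assms(2)])
qed

lemma bounded_clinear_ell2_coord: "bounded_clinear (\<lambda>x. ell2_coord x n)"
proof (rule bounded_clinearI[where K = 1])
  fix x
  have "(cmod (ell2_coord x n))\<^sup>2 \<le> (norm x)\<^sup>2" using ell2_sum_le[of "{n}" x] by simp
  from power2_le_imp_le[OF this] show "norm (ell2_coord x n) \<le> 1 * norm x" by simp
qed (simp_all add: scaleC_complex_def)

text \<open>One bound on the partial sums supplies both the square summability that
  \<open>Abs_ell2\<close> presupposes and the norm estimate.\<close>

lemma ell2_bound_Abs:
  assumes "0 \<le> B" "\<And>N. (\<Sum>n<N. (cmod (x n))\<^sup>2) \<le> B\<^sup>2"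
  shows "ell2_coord (Abs_ell2 x) = x" "norm (Abs_ell2 x) \<le> B"
proof -
  show *: "ell2_coord (Abs_ell2 x) = x"
    by (rule ell2_coord_Abs, rule summableI_nonneg_bounded[OF _ assms(2)]) simp
  show "norm (Abs_ell2 x) \<le> B"
    by (intro ell2_norm_leI assms(1)) (simp add: * assms(2))
qed

definition unit_ell2 :: "nat \<Rightarrow> ell2" where
  "unit_ell2 k = Abs_ell2 (\<lambda>n. if n = k then 1 else 0)"

lemma ell2_coord_unit: "ell2_coord (unit_ell2 k) n = (if n = k then 1 else 0)"
proof -
  have "ell2_coord (unit_ell2 k) = (\<lambda>n. if n = k then 1 else 0)"
    unfolding unit_ell2_def
    by (rule ell2_coord_Abs, rule summable_finite[of "{k}"]) auto
  then show ?thesis by simp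
qed

lemma cinner_unit_right: "cinner x (unit_ell2 k) = ell2_coord x k"
proof -
  have "cinner x (unit_ell2 k) = (\<Sum>n. if n = k then ell2_coord x k else 0)"
    unfolding cinner_ell2.rep_eq by (rule suminf_cong) (simp add: ell2_coord_unit)
  then show ?thesis by (simp add: sums_unique[OF sums_single, symmetric])
qed

text \<open>Only for bounded \<open>c\<close> is the argument of \<open>Abs_ell2\<close> guaranteed
  to be square summable.\<close>

definition diag_op :: "(nat \<Rightarrow> real) \<Rightarrow> ell2 \<Rightarrow> ell2" where
  "diag_op c x = Abs_ell2 (\<lambda>n. complex_of_real (c n) * ell2_coord x n)"

lemma diag_op_bound:
  assumes "0 \<le> M" "\<And>n. \<bar>c n\<bar> \<le> M"
  shows "ell2_coord (diag_op c x) n = complex_of_real (c n) * ell2_coord x n"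
    and "norm (diag_op c x) \<le> M * norm x"
proof -
  have "(\<Sum>n<N. (cmod (complex_of_real (c n) * ell2_coord x n))\<^sup>2) \<le> (M * norm x)\<^sup>2" for N
  proof -
    have "(\<Sum>n<N. (cmod (complex_of_real (c n) * ell2_coord x n))\<^sup>2) \<le> (\<Sum>n<N. M\<^sup>2 * (cmod (ell2_coord x n))\<^sup>2)"
      using assms by (auto simp: norm_mult power_mult_distrib intro!: sum_mono mult_right_mono)
        (metis abs_le_square_iff abs_of_nonneg power2_abs)
    also have "\<dots> \<le> (M * norm x)\<^sup>2"
      unfolding sum_distrib_left[symmetric] power_mult_distrib by (intro mult_left_mono ell2_sum_le) auto
    finally show ?thesis .
  qed
  from ell2_bound_Abs[OF _ this] assms(1)
  show "ell2_coord (diag_op c x) n = complex_of_real (c n) * ell2_coord x n"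
    and "norm (diag_op c x) \<le> M * norm x" by (simp_all add: diag_op_def)
qed

lemma bounded_clinear_diag_op:
  assumes "0 \<le> M" "\<And>n. \<bar>c n\<bar> \<le> M"
  shows "bounded_clinear (diag_op c)"
  by (rule bounded_clinearI[where K = M])
    (auto intro!: ell2_eqI diag_op_bound(2)[OF assms] simp: diag_op_bound(1)[OF assms] algebra_simps)

lemma null_seq_bound:
  fixes c :: "nat \<Rightarrow> real"
  assumes "c \<longlonglongrightarrow> 0"
  obtains M where "0 \<le> M" "\<And>n. \<bar>c n\<bar> \<le> M"
proof -
  have "Bseq c" using assms convergent_imp_Bseq convergent_def by blast
  then show ?thesis using that by (auto simp: Bseq_def intro: less_imp_le)
qed

text \<open>A continuous image of a polydisc, built up one disc at a time. The sum over
  \<open>F\<close> ignores the coefficient at \<open>k\<close>, so \<open>z(k := u)\<close> serves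
  as witness.\<close>

lemma compact_box:
  fixes v :: "nat \<Rightarrow> 'a::complex_normed_vector"
  assumes "finite F" "0 \<le> M"
  shows "compact {\<Sum>n\<in>F. z n *\<^sub>C v n | z. \<forall>n. cmod (z n) \<le> M}"
  using assms(1)
proof (induction F)
  case empty
  have "{(\<Sum>n\<in>{}. z n *\<^sub>C v n :: 'a) | z. \<forall>n. cmod (z n) \<le> M} = {0}"
    using assms(2) by (auto intro!: exI[of _ "\<lambda>_. 0"])
  then show ?case by simp
next
  case (insert k F)
  let ?Q = "{\<Sum>n\<in>F. z n *\<^sub>C v n | z. \<forall>n. cmod (z n) \<le> M}"
  have "{\<Sum>n\<in>insert k F. z n *\<^sub>C v n | z. \<forall>n. cmod (z n) \<le> M} =
      (\<lambda>(u, x). u *\<^sub>C v k + x) ` (cball 0 M \<times> ?Q)" (is "?L = ?R")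
  proof (intro equalityI subsetI)
    fix y assume "y \<in> ?L"
    then obtain z where "\<forall>n. cmod (z n) \<le> M" "y = (\<Sum>n\<in>insert k F. z n *\<^sub>C v n)" by blast
    then show "y \<in> ?R" using insert.hyps
      by (intro image_eqI[of _ _ "(z k, \<Sum>n\<in>F. z n *\<^sub>C v n)"]) auto
  next
    fix y assume "y \<in> ?R"
    then obtain u z where "cmod u \<le> M" "\<forall>n. cmod (z n) \<le> M" "y = u *\<^sub>C v k + (\<Sum>n\<in>F. z n *\<^sub>C v n)" by auto
    moreover have "(\<Sum>n\<in>F. z n *\<^sub>C v n) = (\<Sum>n\<in>F. (z(k := u)) n *\<^sub>C v n)"
      using insert.hyps by (intro sum.cong) auto
    ultimately show "y \<in> ?L" using insert.hyps
      by (intro CollectI exI[of _ "z(k := u)"]) auto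
  qed
  moreover have "continuous_on (cball 0 M \<times> ?Q) (\<lambda>(u, x). u *\<^sub>C v k + x)"
    unfolding case_prod_unfold
    by (intro continuous_intros bounded_linear.continuous_on[OF bounded_linear_scaleC_left])
  ultimately show ?case
    using compact_continuous_image[OF _ compact_Times[OF compact_cball insert.IH]] by simp
qed

text \<open>Finite nets of the approximating compact sets give finite nets of \<open>S\<close>.
  Approximating the image of the ball in this way stands in for approximation by finite-rank
  operators.\<close>

lemma compact_closure_if_approx:
  fixes S :: "'a::{real_normed_vector, complete_space} set"
  assumes "\<And>e. e > 0 \<Longrightarrow> \<exists>Q. compact Q \<and> (\<forall>x\<in>S. \<exists>y\<in>Q. norm (x - y) \<le> e)"
  shows "compact (closure S)"
  unfolding compact_eq_totally_bounded
proof (intro conjI allI impI)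
  show "complete (closure S)" by (simp add: complete_eq_closed)
  fix e :: real assume "e > 0"
  then obtain Q where Q: "compact Q" "\<And>x. x \<in> S \<Longrightarrow> \<exists>y\<in>Q. norm (x - y) \<le> e/4"
    using assms[of "e/4"] by auto
  obtain k where k: "finite k" "Q \<subseteq> (\<Union>x\<in>k. ball x (e/4))"
    using Q(1) \<open>e > 0\<close> unfolding compact_eq_totally_bounded by (meson divide_pos_pos zero_less_numeral)
  \<comment> \<open>The net and the approximation each cost \<open>e/4\<close>. Closed balls of
    radius \<open>e/2\<close> survive passage to the closure and still lie in open balls of radius
    \<open>e\<close>.\<close>
  have "S \<subseteq> (\<Union>x\<in>k. cball x (e/2))"
  proof
    fix x assume "x \<in> S"
    then obtain y where "y \<in> Q" "dist x y \<le> e/4" using Q(2) by (auto simp: dist_norm)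
    then obtain z where z: "z \<in> k" "dist z y < e/4" using k by auto
    then have "dist z x \<le> e/2" using \<open>dist x y \<le> e/4\<close> dist_triangle2[of z x y] by simp
    then show "x \<in> (\<Union>x\<in>k. cball x (e/2))" using z by auto
  qed
  then have "closure S \<subseteq> (\<Union>x\<in>k. cball x (e/2))"
    using k(1) by (intro closure_minimal) auto
  also have "\<dots> \<subseteq> (\<Union>x\<in>k. ball x e)" using \<open>e > 0\<close> by force
  finally show "\<exists>k. finite k \<and> closure S \<subseteq> (\<Union>x\<in>k. ball x e)" using k(1) by blast
qed

text \<open>Only finitely many entries have modulus at least \<open>e\<close>; their coordinates
  stay in a compact polydisc, and the remainder is a diagonal operator of norm at most
  \<open>e\<close>.\<close>

lemma compact_op_diag_op:
  assumes lim: "c \<longlonglongrightarrow> 0"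
  shows "compact_op (diag_op c)"
proof -
  obtain M where M: "0 \<le> M" "\<And>n. \<bar>c n\<bar> \<le> M" using null_seq_bound[OF lim] by blast
  have "compact (closure (diag_op c ` cball 0 1))"
  proof (rule compact_closure_if_approx)
    fix e :: real assume e: "e > 0"
    define F where "F = {n. \<bar>c n\<bar> \<ge> e}"
    have "(\<lambda>n. \<bar>c n\<bar>) \<longlonglongrightarrow> 0" using tendsto_rabs[OF lim] by simp
    then have F: "finite F" unfolding F_def using e by (rule finite_level_set)
    let ?Q = "{\<Sum>n\<in>F. z n *\<^sub>C unit_ell2 n | z. \<forall>n. cmod (z n) \<le> M}"
    have "\<exists>y\<in>?Q. norm (diag_op c x - y) \<le> e" if "norm x \<le> 1" for x
    proof
      define z where "z n = complex_of_real (c n) * ell2_coord x n" for n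
      have "cmod (ell2_coord x n) \<le> 1" for n
      proof -
        have "(cmod (ell2_coord x n))\<^sup>2 \<le> (norm x)\<^sup>2" using ell2_sum_le[of "{n}" x] by simp
        then show ?thesis using that by (meson norm_ge_zero order_trans power2_le_imp_le)
      qed
      then have "cmod (z n) \<le> M * 1" for n
        unfolding z_def norm_mult using M by (intro mult_mono) auto
      then show "(\<Sum>n\<in>F. z n *\<^sub>C unit_ell2 n) \<in> ?Q" by auto
      define d where "d n = (if n \<in> F then 0 else c n)" for n
      have d: "\<bar>d n\<bar> \<le> e" for n using e by (auto simp: d_def F_def)
      have "ell2_coord (\<Sum>n\<in>F. z n *\<^sub>C unit_ell2 n) m = (if m \<in> F then z m else 0)" for m
        using F by (simp add: ell2_coord_sum ell2_coord_unit if_distrib cong: if_cong)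
      then have "diag_op c x - (\<Sum>n\<in>F. z n *\<^sub>C unit_ell2 n) = diag_op d x"
        by (intro ell2_eqI)
          (simp add: diag_op_bound(1)[OF M] diag_op_bound(1)[OF less_imp_le[OF e] d] z_def d_def)
      moreover have "norm (diag_op d x) \<le> e * norm x" by (rule diag_op_bound(2)[OF less_imp_le[OF e] d])
      ultimately show "norm (diag_op c x - (\<Sum>n\<in>F. z n *\<^sub>C unit_ell2 n)) \<le> e"
        using mult_left_mono[OF that less_imp_le[OF e]] by simp
    qed
    then show "\<exists>Q. compact Q \<and> (\<forall>x\<in>diag_op c ` cball 0 1. \<exists>y\<in>Q. norm (x - y) \<le> e)"
      using compact_box[OF F M(1)] by (intro exI[of _ ?Q]) auto
  qed
  then show ?thesis unfolding compact_op_def using bounded_clinear_diag_op[of M c] M by blast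
qed

lemma cadjoint_diag_op:
  assumes "0 \<le> M" "\<And>n. \<bar>c n\<bar> \<le> M"
  shows "cadjoint (diag_op c) = diag_op c"
  by (rule cadjoint_eqI[OF bounded_clinear_diag_op[OF assms]])
    (simp add: cinner_ell2.rep_eq diag_op_bound(1)[OF assms] ac_simps)

text \<open>As \<open>c\<close> is nonnegative, \<open>c n\<close> equals \<open>a\<close> once the
  squares agree, so the eigenspace consists of the vectors supported on the level set, with the unit
  vectors there as orthonormal basis.\<close>

lemma cdim_diag_op_eigenspace:
  assumes lim: "c \<longlonglongrightarrow> 0" and c: "\<And>n. 0 \<le> c n" and a: "a > 0"
  shows "cdim {x. cadjoint (diag_op c) (diag_op c x) = a\<^sup>2 *\<^sub>R x} = card {n. c n = a}"
proof -
  obtain M where M: "0 \<le> M" "\<And>n. \<bar>c n\<bar> \<le> M" using null_seq_bound[OF lim] by blast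
  note coord = diag_op_bound(1)[OF M]
  have fin: "finite {n. c n = a}" by (rule finite_level_set(3)[OF lim a])
  have "complex_of_real (c n) * (complex_of_real (c n) * t) = complex_of_real (a\<^sup>2) * t \<longleftrightarrow> c n = a \<or> t = 0" for n t
  proof -
    have "complex_of_real (c n) * (complex_of_real (c n) * t) = complex_of_real ((c n)\<^sup>2) * t"
      by (simp add: power2_eq_square)
    moreover have "(c n)\<^sup>2 = a\<^sup>2 \<longleftrightarrow> c n = a" using c[of n] a by (simp add: power2_eq_iff_nonneg)
    ultimately show ?thesis by (metis mult_right_cancel mult_zero_right of_real_eq_iff)
  qed
  then have E: "{x. cadjoint (diag_op c) (diag_op c x) = a\<^sup>2 *\<^sub>R x} = {x. \<forall>n. c n \<noteq> a \<longrightarrow> ell2_coord x n = 0}"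
    unfolding cadjoint_diag_op[OF M] scaleR_scaleC
    by (auto simp: ell2_coord_inject[symmetric] fun_eq_iff coord simp del: of_real_power)
  have inj: "inj_on unit_ell2 A" for A
    by (rule inj_onI) (metis ell2_coord_unit zero_neq_one)
  have "cdim {x. \<forall>n. c n \<noteq> a \<longrightarrow> ell2_coord x n = 0} = card (unit_ell2 ` {n. c n = a})"
  proof (rule cdim_eq_card_orthonormal)
    show "orthonormal (unit_ell2 ` {n. c n = a})"
      using inj[of UNIV] by (auto simp: orthonormal_def cinner_unit_right ell2_coord_unit dest: injD)
    show "finite (unit_ell2 ` {n. c n = a})" using fin by simp
    show "unit_ell2 ` {n. c n = a} \<subseteq> {x. \<forall>n. c n \<noteq> a \<longrightarrow> ell2_coord x n = 0}"
      by (auto simp: ell2_coord_unit)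
    show "complex_vector.subspace {x. \<forall>n. c n \<noteq> a \<longrightarrow> ell2_coord x n = 0}"
      by (simp add: complex_vector.subspace_def)
    fix x assume "x \<in> {x. \<forall>n. c n \<noteq> a \<longrightarrow> ell2_coord x n = 0}"
      "\<And>y. y \<in> unit_ell2 ` {n. c n = a} \<Longrightarrow> cinner x y = 0"
    then show "x = 0" by (intro ell2_eqI) (force simp: cinner_unit_right)
  qed
  then show ?thesis unfolding E by (simp add: card_image[OF inj])
qed

text \<open>The rearranged sequence qualifies as singular numbers because its multiplicities are
  right; the operator keeps its unsorted diagonal, whose product structure the factorization of
  \<open>T\<^sub>f\<close> uses.\<close>

lemma diag_op_in_lorentz_schatten:
  assumes "0 < s" "s \<le> r" "lorentz_seq r s \<sigma>" "lorentz_seq r s \<tau>"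
  shows "diag_op (tensor_seq \<sigma> \<tau>) \<in> lorentz_schatten r s"
proof -
  note lim = tensor_seq_tendsto_0[OF assms(3,4)]
  have c0: "0 \<le> tensor_seq \<sigma> \<tau> n" for n
    using assms(3,4) by (simp add: tensor_seq_def lorentz_seq_def)
  obtain \<rho> where \<rho>: "lorentz_seq r s \<rho>"
    "\<And>a. a > 0 \<Longrightarrow> card {n. \<rho> n = a} = card {n. tensor_seq \<sigma> \<tau> n = a}"
    using lorentz_seq_tensor[OF assms] by blast
  then have "singular_numbers (diag_op (tensor_seq \<sigma> \<tau>)) \<rho>"
    unfolding singular_numbers_def by (auto simp: lorentz_seq_def cdim_diag_op_eigenspace[OF lim c0])
  then show ?thesis
    using \<rho>(1) compact_op_diag_op[OF lim] by (auto simp: lorentz_schatten_def lorentz_seq_def)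
qed

text \<open>The singular value decomposition reads \<open>U = W D V\<close>, where \<open>V\<close>
  takes coefficients against \<open>e\<close> and \<open>W\<close> sums a series in
  \<open>f\<close>. Both are contractions and are absorbed into the outer operators, which replaces
  the given Hilbert space by \<open>ell2\<close>.\<close>

lemma lorentz_schatten_factorization:
  assumes "factors_through_lorentz_schatten r s TYPE('h::chilbert_space) S"
  obtains \<sigma> A B where "lorentz_seq r s \<sigma>" "bounded_clinear A" "bounded_clinear B"
    "\<And>x. S x = B (diag_op \<sigma> (A x))"
proof -
  obtain A' :: "_ \<Rightarrow> 'h" and U :: "'h \<Rightarrow> 'h" and B' where
    A': "bounded_clinear A'" and U: "U \<in> lorentz_schatten r s" and B': "bounded_clinear B'" and S: "S = B' \<circ> U \<circ> A'"
    using assms unfolding factors_through_lorentz_schatten_def by blast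
  obtain \<sigma> where \<sigma>: "singular_numbers U \<sigma>" "lorentz_seq r s \<sigma>" and U: "compact_op U"
    using U by (auto simp: lorentz_schatten_def lorentz_seq_def singular_numbers_def)
  interpret compact_operator U by unfold_locales (rule U)
  obtain e f where ef: "suborthonormal e" "suborthonormal f"
    "\<And>x. (\<lambda>n. (complex_of_real (\<sigma> n) * cinner x (e n)) *\<^sub>C f n) sums U x"
    using singular_value_decomposition[OF \<sigma>(1)] by blast
  define V where "V x = Abs_ell2 (\<lambda>n. cinner x (e n))" for x
  define W where "W z = (\<Sum>n. ell2_coord z n *\<^sub>C f n)" for z
  have V: "ell2_coord (V x) n = cinner x (e n)" "norm (V x) \<le> norm x" for x n
    using ell2_bound_Abs[of "norm x" "\<lambda>n. cinner x (e n)"] bessel_inequality[OF ef(1)]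
    by (simp_all add: V_def)
  have W: "(\<lambda>n. ell2_coord z n *\<^sub>C f n) sums W z" for z
    unfolding W_def by (intro summable_sums suborthonormal_series[OF ef(2)] ell2_summable)
  have "bounded_clinear V"
    by (rule bounded_clinearI[where K = 1])
      (auto intro!: ell2_eqI simp: V cinner_add_left cinner_scaleC_left)
  moreover have "bounded_clinear W"
  proof (rule bounded_clinearI[where K = 1])
    show "W (x + y) = W x + W y" for x y
      using sums_unique2[OF W[of "x + y"]] sums_add[OF W W, of x y] by (simp add: scaleC_add_left)
    show "W (c *\<^sub>C x) = c *\<^sub>C W x" for c x
      using sums_unique2[OF W[of "c *\<^sub>C x"]] bounded_linear.sums[OF bounded_linear_scaleC W, of c x]
      by (simp add: scaleC_scaleC)
    have "(norm (W x))\<^sup>2 \<le> (norm x)\<^sup>2" for x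
      unfolding ell2_norm_sq W_def by (rule suborthonormal_series[OF ef(2) ell2_summable])
    from power2_le_imp_le[OF this] show "norm (W x) \<le> 1 * norm x" for x by simp
  qed
  moreover have "U x = W (diag_op \<sigma> (V x))" for x
  proof -
    have "\<sigma> \<longlonglongrightarrow> 0" using \<sigma>(2) by (simp add: lorentz_seq_def)
    then obtain M where M: "0 \<le> M" "\<And>n. \<bar>\<sigma> n\<bar> \<le> M" using null_seq_bound by blast
    show ?thesis
      using sums_unique2[OF ef(3)[of x] W[of "diag_op \<sigma> (V x)", unfolded diag_op_bound(1)[OF M] V]] by simp
  qed
  ultimately show ?thesis
    using that[of \<sigma> "\<lambda>x. V (A' x)" "\<lambda>z. B' (W z)"] \<sigma>(2) S A' B'
    by (simp add: bounded_clinear_compose)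
qed

section \<open>Vector measures\<close>

lemma vm_not_borel: "E \<notin> sets borel \<Longrightarrow> measure_of_vm \<mu> E = 0"
  and vm_countably_additive: "countably_additive_vm (measure_of_vm \<mu>)"
  and vm_variation_finite: "variation (measure_of_vm \<mu>) UNIV < \<infinity>"
  and vm_regular: "regular_vm (measure_of_vm \<mu>)"
  using measure_of_vm[of \<mu>] by auto

lemma vm_empty [simp]: "measure_of_vm \<mu> {} = 0"
proof -
  have "(\<lambda>n::nat. measure_of_vm \<mu> {}) sums measure_of_vm \<mu> (\<Union>n::nat. {})"
    using vm_countably_additive[of \<mu>] by (auto simp: countably_additive_vm_def disjoint_family_on_def)
  then have "summable (\<lambda>n::nat. measure_of_vm \<mu> {})" by (rule sums_summable)
  then show ?thesis using summable_LIMSEQ_zero LIMSEQ_const_iff by blast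
qed

text \<open>An enumeration of \<open>I\<close>, padded with empty sets, reduces this to countable
  additivity.\<close>

lemma vm_additive:
  assumes "finite I" "\<And>i. i \<in> I \<Longrightarrow> A i \<in> sets borel" "disjoint_family_on A I"
  shows "measure_of_vm \<mu> (\<Union>i\<in>I. A i) = (\<Sum>i\<in>I. measure_of_vm \<mu> (A i))"
proof -
  obtain h where h: "bij_betw h {..<card I} I" using assms(1) bij_betw_from_nat_into_finite by blast
  define F where "F n = (if n < card I then A (h n) else {})" for n
  have hI: "h n \<in> I" if "n < card I" for n using h that by (auto simp: bij_betw_def)
  have "range F \<subseteq> sets borel" using assms(2) hI by (auto simp: F_def)
  moreover have "disjoint_family F"
    unfolding disjoint_family_on_def
  proof (intro ballI impI)
    fix m n :: nat assume "m \<noteq> n"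
    then have "h m \<noteq> h n" if "m < card I" "n < card I"
      using h that by (auto simp: bij_betw_def dest: inj_onD)
    then show "F m \<inter> F n = {}" using assms(3) hI by (auto simp: F_def disjoint_family_on_def)
  qed
  ultimately have "(\<lambda>n. measure_of_vm \<mu> (F n)) sums measure_of_vm \<mu> (\<Union>n. F n)"
    using vm_countably_additive by (auto simp: countably_additive_vm_def)
  moreover have "(\<lambda>n. measure_of_vm \<mu> (F n)) sums (\<Sum>n<card I. measure_of_vm \<mu> (F n))"
    by (rule sums_finite) (auto simp: F_def)
  ultimately have "measure_of_vm \<mu> (\<Union>n. F n) = (\<Sum>n<card I. measure_of_vm \<mu> (F n))"
    by (rule sums_unique2)
  also have "\<dots> = (\<Sum>n<card I. measure_of_vm \<mu> (A (h n)))"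
    by (rule sum.cong) (simp_all add: F_def)
  also have "\<dots> = (\<Sum>i\<in>I. measure_of_vm \<mu> (A i))"
    by (rule sum.reindex_bij_betw[OF h])
  finally have "measure_of_vm \<mu> (\<Union>n. F n) = (\<Sum>i\<in>I. measure_of_vm \<mu> (A i))" .
  moreover have "(\<Union>n. F n) = (\<Union>i\<in>I. A i)"
  proof -
    have "(\<Union>n. F n) = (\<Union>n<card I. A (h n))" by (auto simp: F_def split: if_splits)
    also have "\<dots> = (\<Union>i\<in>h ` {..<card I}. A i)" by simp
    finally show ?thesis using h by (simp only: bij_betw_def)
  qed
  ultimately show ?thesis by simp
qed

section \<open>Total variation through finite Borel partitions\<close>

lemma ennreal_norm_vmeasure: "ennreal (norm \<mu>) = variation (measure_of_vm \<mu>) UNIV"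
  using vm_variation_finite[of \<mu>] by (simp add: norm_vmeasure_def)

text \<open>\<open>variation\<close> uses sets of nonempty blocks rather than families. Empty
  members are therefore discarded; the remaining ones are distinct by disjointness and partition
  their union.\<close>

lemma sum_norm_vm_le:
  assumes "finite I" "\<And>i. i \<in> I \<Longrightarrow> A i \<in> sets borel" "disjoint_family_on A I"
  shows "(\<Sum>i\<in>I. norm (measure_of_vm \<mu> (A i))) \<le> norm \<mu>"
proof -
  define J where "J = {i\<in>I. A i \<noteq> {}}"
  have inj: "inj_on A J"
    using assms(3) by (fastforce simp: J_def inj_on_def disjoint_family_on_def)
  define E where "E = (\<Union>i\<in>I. A i)"
  have E: "E \<in> sets borel" unfolding E_def using assms by (intro sets.finite_UN) auto
  have part: "partition_on E (A ` J)"
    unfolding partition_on_def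
  proof (intro conjI disjointI)
    fix B C assume "B \<in> A ` J" "C \<in> A ` J" "B \<noteq> C"
    then obtain i j where "B = A i" "C = A j" "i \<in> I" "j \<in> I" "i \<noteq> j" by (auto simp: J_def)
    then show "B \<inter> C = {}" using disjoint_family_onD[OF assms(3)] by simp
  qed (auto simp: E_def J_def)
  have "ennreal (\<Sum>i\<in>I. norm (measure_of_vm \<mu> (A i))) = ennreal (\<Sum>i\<in>J. norm (measure_of_vm \<mu> (A i)))"
    using assms(1) by (intro arg_cong[of _ _ ennreal] sum.mono_neutral_right) (auto simp: J_def)
  also have "\<dots> = (\<Sum>B\<in>A ` J. ennreal (norm (measure_of_vm \<mu> B)))"
    by (simp add: sum.reindex[OF inj] sum_ennreal)
  also have "\<dots> \<le> variation (measure_of_vm \<mu>) E"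
    unfolding variation_def using part assms by (intro SUP_upper) (auto simp: J_def)
  also have "\<dots> \<le> variation (measure_of_vm \<mu>) UNIV" using E by (intro variation_mono) auto
  finally show ?thesis by (simp flip: ennreal_norm_vmeasure)
qed

definition borel_partition :: "'g::topological_space set set \<Rightarrow> bool" where
  "borel_partition P \<longleftrightarrow> finite P \<and> P \<subseteq> sets borel \<and> partition_on UNIV P"

lemma sum_norm_partition_le:
  assumes "borel_partition P"
  shows "(\<Sum>A\<in>P. norm (measure_of_vm \<mu> A)) \<le> norm \<mu>"
  using sum_norm_vm_le[of P "\<lambda>A. A" \<mu>] assms
  by (auto simp: borel_partition_def partition_on_def disjoint_def disjoint_family_on_def)

lemma norm_vmeasure_less_partition:
  assumes "c < norm \<mu>"
  obtains P where "borel_partition P" "c < (\<Sum>A\<in>P. norm (measure_of_vm \<mu> A))"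
proof -
  have "\<exists>P. borel_partition P \<and> c < (\<Sum>A\<in>P. norm (measure_of_vm \<mu> A))"
  proof (rule ccontr)
    assume "\<not> ?thesis"
    then have le: "(\<Sum>A\<in>P. norm (measure_of_vm \<mu> A)) \<le> c" if "borel_partition P" for P
      using that by (auto simp: not_less)
    have "borel_partition {UNIV}" by (auto simp: borel_partition_def partition_on_def)
    from le[OF this] have "0 \<le> c" by (simp add: order_trans[OF norm_ge_zero])
    have "variation (measure_of_vm \<mu>) UNIV \<le> ennreal c"
      unfolding variation_def
      by (rule SUP_least) (use le in \<open>simp add: borel_partition_def sum_ennreal ennreal_leI\<close>)
    then show False using assms \<open>0 \<le> c\<close> by (simp flip: ennreal_norm_vmeasure)
  qed
  then show ?thesis using that by blast
qed

text \<open>Each block of \<open>P\<close> is cut by the blocks of \<open>Q\<close>, and the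
  triangle inequality is applied to the pieces.\<close>

lemma sum_norm_refine_le:
  assumes P: "borel_partition P" and Q: "borel_partition Q"
  shows "(\<Sum>A\<in>P. norm (measure_of_vm \<mu> A)) \<le> (\<Sum>C\<in>(\<lambda>(A, B). A \<inter> B) ` (P \<times> Q) - {{}}. norm (measure_of_vm \<mu> C))"
proof -
  have PQ: "disjoint P" "disjoint Q" "\<Union>Q = UNIV" "finite P" "finite Q" "P \<subseteq> sets borel" "Q \<subseteq> sets borel"
    using P Q by (auto simp: borel_partition_def partition_on_def)
  have "norm (measure_of_vm \<mu> A) \<le> (\<Sum>B\<in>Q. norm (measure_of_vm \<mu> (A \<inter> B)))" if "A \<in> P" for A
  proof -
    have "A = (\<Union>B\<in>Q. A \<inter> B)" using PQ(3) by auto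
    then have "measure_of_vm \<mu> A = measure_of_vm \<mu> (\<Union>B\<in>Q. A \<inter> B)" by simp
    also have "\<dots> = (\<Sum>B\<in>Q. measure_of_vm \<mu> (A \<inter> B))"
    proof (rule vm_additive)
      show "disjoint_family_on (\<lambda>B. A \<inter> B) Q"
        using disjointD[OF PQ(2)] by (fastforce simp: disjoint_family_on_def)
    qed (use PQ that in auto)
    finally show ?thesis by (simp add: norm_sum)
  qed
  then have "(\<Sum>A\<in>P. norm (measure_of_vm \<mu> A)) \<le> (\<Sum>A\<in>P. \<Sum>B\<in>Q. norm (measure_of_vm \<mu> (A \<inter> B)))"
    by (rule sum_mono)
  also have "\<dots> = (\<Sum>AB\<in>P \<times> Q. norm (measure_of_vm \<mu> ((\<lambda>(A, B). A \<inter> B) AB)))"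
    by (simp add: sum.cartesian_product case_prod_unfold)
  also have "\<dots> = (\<Sum>C\<in>(\<lambda>(A, B). A \<inter> B) ` (P \<times> Q). norm (measure_of_vm \<mu> C))"
  \<comment> \<open>Different pairs can have the same intersection only if it is empty, and then its
    measure is 0.\<close>
  proof (rule sum.reindex_nontrivial[unfolded comp_def, symmetric])
    fix x y assume xy: "x \<in> P \<times> Q" "y \<in> P \<times> Q" "x \<noteq> y" "(\<lambda>(A, B). A \<inter> B) x = (\<lambda>(A, B). A \<inter> B) y"
    then have "fst x \<inter> fst y = {} \<or> snd x \<inter> snd y = {}"
      using disjointD[OF PQ(1), of "fst x" "fst y"] disjointD[OF PQ(2), of "snd x" "snd y"]
      by (metis mem_Times_iff prod_eq_iff)
    then have "(\<lambda>(A, B). A \<inter> B) x = {}" using xy(4) by (auto simp: case_prod_unfold)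
    then show "norm (measure_of_vm \<mu> ((\<lambda>(A, B). A \<inter> B) x)) = 0" by simp
  qed (use PQ in simp)
  also have "\<dots> = (\<Sum>C\<in>(\<lambda>(A, B). A \<inter> B) ` (P \<times> Q) - {{}}. norm (measure_of_vm \<mu> C))"
    using PQ by (intro sum.mono_neutral_right) auto
  finally show ?thesis .
qed

lemma borel_partition_refine:
  assumes P: "borel_partition P" and Q: "borel_partition Q"
  shows "borel_partition ((\<lambda>(A, B). A \<inter> B) ` (P \<times> Q) - {{}})"
proof -
  have PQ: "disjoint P" "disjoint Q" "\<Union>P = UNIV" "\<Union>Q = UNIV" "finite P" "finite Q"
    "P \<subseteq> sets borel" "Q \<subseteq> sets borel"
    using P Q by (auto simp: borel_partition_def partition_on_def)
  have "\<Union>(X - {{}}) = \<Union>X" for X :: "'a set set" by auto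
  moreover have "\<Union>((\<lambda>(A, B). A \<inter> B) ` (P \<times> Q)) = \<Union>P \<inter> \<Union>Q" by auto
  ultimately have "\<Union>((\<lambda>(A, B). A \<inter> B) ` (P \<times> Q) - {{}}) = UNIV" using PQ(3,4) by simp
  moreover have dis: "disjoint ((\<lambda>(A, B). A \<inter> B) ` (P \<times> Q))"
  proof (rule disjointI)
    fix C D assume "C \<in> (\<lambda>(A, B). A \<inter> B) ` (P \<times> Q)" "D \<in> (\<lambda>(A, B). A \<inter> B) ` (P \<times> Q)" "C \<noteq> D"
    then obtain A B A' B' where *: "C = A \<inter> B" "D = A' \<inter> B'" "A \<in> P" "A' \<in> P" "B \<in> Q" "B' \<in> Q"
      by auto
    then have "A \<noteq> A' \<or> B \<noteq> B'" using \<open>C \<noteq> D\<close> by auto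
    then have "A \<inter> A' = {} \<or> B \<inter> B' = {}"
      using disjointD[OF PQ(1) *(3,4)] disjointD[OF PQ(2) *(5,6)] by auto
    then show "C \<inter> D = {}" using *(1,2) by auto
  qed
  moreover have "disjoint ((\<lambda>(A, B). A \<inter> B) ` (P \<times> Q) - {{}})"
    by (rule pairwise_subset[OF dis]) simp
  moreover have "(\<lambda>(A, B). A \<inter> B) ` (P \<times> Q) - {{}} \<subseteq> sets borel" using PQ(7,8) by auto
  ultimately show ?thesis
    using PQ(3-6) by (simp add: borel_partition_def partition_on_def)
qed

text \<open>Refinement never lowers a variation sum, so near-optimal partitions can be merged one
  measure at a time. A single partition for all coordinates reduces Minkowski's inequality to finite
  sums.\<close>

lemma common_borel_partition:
  fixes \<mu> :: "nat \<Rightarrow> ('g::t2_space, 'x::complex_normed_vector) vmeasure"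
  assumes "\<And>j. j < N \<Longrightarrow> c j < norm (\<mu> j)"
  obtains P where "borel_partition P" "\<And>j. j < N \<Longrightarrow> c j < (\<Sum>A\<in>P. norm (measure_of_vm (\<mu> j) A))"
proof -
  have "\<exists>P. borel_partition P \<and> (\<forall>j<N. c j < (\<Sum>A\<in>P. norm (measure_of_vm (\<mu> j) A)))"
    using assms
  proof (induction N)
    case 0
    have "borel_partition {UNIV}" by (auto simp: borel_partition_def partition_on_def)
    then show ?case by blast
  next
    case (Suc N)
    then obtain P where P: "borel_partition P" "\<And>j. j < N \<Longrightarrow> c j < (\<Sum>A\<in>P. norm (measure_of_vm (\<mu> j) A))"
      by auto
    obtain Q where Q: "borel_partition Q" "c N < (\<Sum>A\<in>Q. norm (measure_of_vm (\<mu> N) A))"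
      using norm_vmeasure_less_partition[of "c N" "\<mu> N"] Suc.prems by blast
    let ?R = "(\<lambda>(A, B). A \<inter> B) ` (P \<times> Q) - {{}}"
    have "?R = (\<lambda>(A, B). A \<inter> B) ` (Q \<times> P) - {{}}" by (auto simp: image_iff Int_commute)
    then have "c j < (\<Sum>A\<in>?R. norm (measure_of_vm (\<mu> j) A))" if "j < Suc N" for j
      using that P(2) Q(2) sum_norm_refine_le[OF P(1) Q(1), of "\<mu> j"] sum_norm_refine_le[OF Q(1) P(1), of "\<mu> j"]
      by (cases "j = N") (force simp: less_Suc_eq)+
    then show ?case using borel_partition_refine[OF P(1) Q(1)] by blast
  qed
  then show ?thesis using that by blast
qed

section \<open>Images of vector measures under bounded operators\<close>

lemma variation_map_le:
  assumes "0 \<le> K" "\<And>x. norm (T x) \<le> K * norm x"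
  shows "variation (\<lambda>E. T (\<mu> E)) E \<le> ennreal K * variation \<mu> E"
proof -
  have "(\<Sum>A\<in>P. ennreal (norm (T (\<mu> A)))) \<le> ennreal K * variation \<mu> E"
    if "finite P" "P \<subseteq> sets borel" "partition_on E P" for P
  proof -
    have "(\<Sum>A\<in>P. ennreal (norm (T (\<mu> A)))) \<le> (\<Sum>A\<in>P. ennreal K * ennreal (norm (\<mu> A)))"
      using assms by (intro sum_mono) (simp add: ennreal_leI flip: ennreal_mult)
    also have "\<dots> = ennreal K * (\<Sum>A\<in>P. ennreal (norm (\<mu> A)))" by (simp only: sum_distrib_left)
    also have "\<dots> \<le> ennreal K * variation \<mu> E"
      unfolding variation_def using that by (intro mult_left_mono SUP_upper) auto
    finally show ?thesis .
  qed
  then show ?thesis by (subst variation_def) (auto intro!: SUP_least)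
qed

definition vm_map :: "('x::complex_normed_vector \<Rightarrow> 'y::complex_normed_vector) \<Rightarrow>
    ('g::t2_space, 'x) vmeasure \<Rightarrow> ('g, 'y) vmeasure" where
  "vm_map T \<mu> = Abs_vmeasure (\<lambda>E. T (measure_of_vm \<mu> E))"

text \<open>\<open>Abs_vmeasure\<close> is legitimate here because variations grow at most by the
  factor \<open>K\<close>: they stay finite, and regularity at level \<open>e\<close> follows from
  that of \<open>\<mu>\<close> at level \<open>e / K\<close>.\<close>

lemma measure_of_vm_map:
  fixes \<mu> :: "('g::t2_space, 'x::complex_normed_vector) vmeasure"
  assumes T: "bounded_clinear T"
  shows "measure_of_vm (vm_map T \<mu>) = (\<lambda>E. T (measure_of_vm \<mu> E))"
proof -
  let ?m = "measure_of_vm \<mu>"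
  obtain K where K: "0 < K" "\<And>x. norm (T x) \<le> K * norm x" using bounded_clinear_bound[OF T] by blast
  note var = variation_map_le[OF less_imp_le[OF K(1)], of T, OF K(2)]
  have "countably_additive_vm (\<lambda>E. T (?m E))"
    using vm_countably_additive[of \<mu>] T unfolding countably_additive_vm_def bounded_clinear_def
    by (auto intro: bounded_linear.sums)
  moreover have "variation (\<lambda>E. T (?m E)) UNIV < \<infinity>"
    by (rule order.strict_trans1[OF var])
      (use vm_variation_finite[of \<mu>] in \<open>simp add: ennreal_mult_less_top\<close>)
  moreover have "regular_vm (\<lambda>E. T (?m E))"
    unfolding regular_vm_def
  proof (intro ballI allI impI)
    fix E :: "'g set" and e :: real assume E: "E \<in> sets borel" and e: "e > 0"
    obtain L V where LV: "compact L" "L \<subseteq> E" "open V" "E \<subseteq> V" "variation ?m (V - L) < ennreal (e / K)"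
      using vm_regular[of \<mu>] E e K(1) unfolding regular_vm_def by (meson divide_pos_pos)
    have "variation (\<lambda>E. T (?m E)) (V - L) \<le> ennreal K * variation ?m (V - L)" by (rule var)
    also have "\<dots> < ennreal K * ennreal (e / K)"
      using LV(5) K(1) by (intro ennreal_mult_strict_left_mono) auto
    also have "\<dots> = ennreal e" using K(1) e by (simp flip: ennreal_mult)
    finally show "\<exists>L V. compact L \<and> L \<subseteq> E \<and> open V \<and> E \<subseteq> V \<and> variation (\<lambda>E. T (?m E)) (V - L) < ennreal e"
      using LV by blast
  qed
  ultimately show ?thesis
    unfolding vm_map_def by (intro Abs_vmeasure_inverse) (auto simp: vm_not_borel bounded_clinear_zero[OF T])
qed

lemma vmeasure_eqI: "(\<And>E. measure_of_vm \<mu> E = measure_of_vm \<nu> E) \<Longrightarrow> \<mu> = \<nu>"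
  by (simp add: measure_of_vm_inject[symmetric] ext)

lemma vm_map_add: "bounded_clinear T \<Longrightarrow> vm_map T (\<mu> + \<nu>) = vm_map T \<mu> + vm_map T \<nu>"
  by (rule vmeasure_eqI) (simp add: measure_of_vm_map plus_vmeasure.rep_eq bounded_clinear_add)

lemma vm_map_scaleC: "bounded_clinear T \<Longrightarrow> vm_map T (c *\<^sub>C \<mu>) = c *\<^sub>C vm_map T \<mu>"
  by (rule vmeasure_eqI) (simp add: measure_of_vm_map scaleC_vmeasure.rep_eq bounded_clinear_scaleC)

lemma norm_vm_map_le:
  assumes T: "bounded_clinear T" and K: "0 \<le> K" "\<And>x. norm (T x) \<le> K * norm x"
  shows "norm (vm_map T \<mu>) \<le> K * norm \<mu>"
proof -
  have "ennreal (norm (vm_map T \<mu>)) \<le> ennreal K * ennreal (norm \<mu>)"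
    unfolding ennreal_norm_vmeasure measure_of_vm_map[OF T] by (rule variation_map_le[OF K])
  then show ?thesis using K(1) by (simp flip: ennreal_mult)
qed

text \<open>Minkowski's inequality, which takes the place of the Radon--Nikodym property of Hilbert space.\<close>

lemma sum_norm_coord_vm_le:
  fixes \<nu> :: "('g::t2_space, ell2) vmeasure"
  shows "(\<Sum>j<N. (norm (vm_map (\<lambda>x. ell2_coord x j) \<nu>))\<^sup>2) \<le> (norm \<nu>)\<^sup>2"
proof -
  define \<mu> where "\<mu> j = vm_map (\<lambda>x. ell2_coord x j) \<nu>" for j
  have \<mu>: "measure_of_vm (\<mu> j) A = ell2_coord (measure_of_vm \<nu> A) j" for j A
    by (simp add: \<mu>_def measure_of_vm_map[OF bounded_clinear_ell2_coord])
  have "L2_set (\<lambda>j. norm (\<mu> j)) {..<N} \<le> norm \<nu>"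
  proof (rule field_le_epsilon)
    fix e :: real assume "e > 0"
    \<comment> \<open>The error \<open>d\<close> is committed in each of the \<open>N\<close>
      coordinates; the extra 1 covers \<open>N = 0\<close>.\<close>
    define d where "d = e / (real N + 1)"
    have d: "d > 0" using \<open>e > 0\<close> by (simp add: d_def)
    obtain P where P: "borel_partition P"
      "\<And>j. j < N \<Longrightarrow> norm (\<mu> j) - d < (\<Sum>A\<in>P. norm (measure_of_vm (\<mu> j) A))"
      using common_borel_partition[of N "\<lambda>j. norm (\<mu> j) - d" \<mu>] d by auto
    have "L2_set (\<lambda>j. norm (\<mu> j)) {..<N} \<le> L2_set (\<lambda>j. (\<Sum>A\<in>P. norm (measure_of_vm (\<mu> j) A)) + d) {..<N}"
      using P(2) by (intro L2_set_mono) (auto simp: less_diff_eq intro: less_imp_le dest: P(2))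
    also have "\<dots> \<le> L2_set (\<lambda>j. \<Sum>A\<in>P. norm (measure_of_vm (\<mu> j) A)) {..<N} + L2_set (\<lambda>j. d) {..<N}"
      by (rule L2_set_triangle_ineq)
    \<comment> \<open>Minkowski: the l2-norm over the coordinates moves inside the sum over blocks,
      where it is at most the norm of the vector \<open>measure_of_vm \<nu> A\<close>.\<close>
    also have "L2_set (\<lambda>j. \<Sum>A\<in>P. norm (measure_of_vm (\<mu> j) A)) {..<N} \<le>
        (\<Sum>A\<in>P. L2_set (\<lambda>j. norm (measure_of_vm (\<mu> j) A)) {..<N})"
    proof -
      have "finite P" using P(1) by (simp add: borel_partition_def)
      then show ?thesis
      proof (induction P)
        case (insert A P)
        then show ?case
          using L2_set_triangle_ineq[of "\<lambda>j. norm (measure_of_vm (\<mu> j) A)"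
              "\<lambda>j. \<Sum>A\<in>P. norm (measure_of_vm (\<mu> j) A)" "{..<N}"] by simp
      qed (simp add: L2_set_def)
    qed
    also have "\<dots> \<le> (\<Sum>A\<in>P. norm (measure_of_vm \<nu> A))"
      unfolding L2_set_def \<mu> by (intro sum_mono real_le_lsqrt) (auto simp: sum_nonneg ell2_sum_le)
    also have "\<dots> \<le> norm \<nu>" by (rule sum_norm_partition_le[OF P(1)])
    also have "L2_set (\<lambda>j. d) {..<N} \<le> (\<Sum>j<N. d)" using d by (intro L2_set_le_sum) auto
    also have "(\<Sum>j<N. d) \<le> e" using \<open>e > 0\<close> by (simp add: d_def field_simps)
    finally show "L2_set (\<lambda>j. norm (\<mu> j)) {..<N} \<le> norm \<nu> + e" by simp
  qed
  then have "(L2_set (\<lambda>j. norm (\<mu> j)) {..<N})\<^sup>2 \<le> (norm \<nu>)\<^sup>2" by (intro power_mono) auto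
  then show ?thesis by (simp add: L2_set_def sum_nonneg \<mu>_def)
qed

section \<open>Integration of scalar functions\<close>

lemma ex_small_multiple:
  fixes e x :: real
  assumes "0 < e" "0 \<le> x"
  shows "\<exists>d>0. 2 * d * x < e"
proof (intro exI conjI)
  have pos: "0 < 2 * x + 2" using assms(2) by simp
  then show "0 < e / (2 * x + 2)" using assms(1) by simp
  have "e * (2 * x) < e * (2 * x + 2)" using assms(1) by simp
  then show "2 * (e / (2 * x + 2)) * x < e" using pos by (simp add: pos_divide_less_eq ac_simps)
qed

text \<open>On the common cells \<open>A (c, d)\<close> both integrals become sums over the same
  sets. A nonempty cell contains a point, so its two values differ by at most \<open>e\<close>;
  empty cells have measure 0.\<close>

lemma simple_vm_integral_diff_le:
  assumes \<psi>: "simple_function borel \<psi>1" "simple_function borel \<psi>2"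
    and le: "\<And>x. cmod (\<psi>1 x - \<psi>2 x) \<le> e"
  shows "norm (simple_vm_integral (measure_of_vm \<mu>) \<psi>1 - simple_vm_integral (measure_of_vm \<mu>) \<psi>2) \<le> e * norm \<mu>"
proof -
  define A where "A = (\<lambda>(c, d). \<psi>1 -` {c} \<inter> \<psi>2 -` {d})"
  have fin: "finite (range \<psi>1)" "finite (range \<psi>2)"
    and meas: "\<psi>1 -` {c} \<in> sets borel" "\<psi>2 -` {c} \<in> sets borel" for c
    using \<psi> simple_functionD[OF \<psi>(1)] simple_functionD[OF \<psi>(2)] by auto
  have A: "A p \<in> sets borel" for p using meas by (auto simp: A_def case_prod_unfold)
  have dis: "disjoint_family_on A S" for S by (auto simp: A_def disjoint_family_on_def)
  have 1: "measure_of_vm \<mu> (\<psi>1 -` {c}) = (\<Sum>d\<in>range \<psi>2. measure_of_vm \<mu> (A (c, d)))" for c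
  proof -
    have *: "\<psi>1 -` {c} = (\<Union>d\<in>range \<psi>2. A (c, d))" by (auto simp: A_def)
    show ?thesis
      unfolding * by (rule vm_additive[OF fin(2) A]) (auto simp: A_def disjoint_family_on_def)
  qed
  have 2: "measure_of_vm \<mu> (\<psi>2 -` {d}) = (\<Sum>c\<in>range \<psi>1. measure_of_vm \<mu> (A (c, d)))" for d
  proof -
    have *: "\<psi>2 -` {d} = (\<Union>c\<in>range \<psi>1. A (c, d))" by (auto simp: A_def)
    show ?thesis
      unfolding * by (rule vm_additive[OF fin(1) A]) (auto simp: A_def disjoint_family_on_def)
  qed
  have "simple_vm_integral (measure_of_vm \<mu>) \<psi>1 = (\<Sum>c\<in>range \<psi>1. \<Sum>d\<in>range \<psi>2. c *\<^sub>C measure_of_vm \<mu> (A (c, d)))"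
    unfolding simple_vm_integral_def 1 by (simp add: complex_vector.scale_sum_right)
  moreover have "simple_vm_integral (measure_of_vm \<mu>) \<psi>2 = (\<Sum>c\<in>range \<psi>1. \<Sum>d\<in>range \<psi>2. d *\<^sub>C measure_of_vm \<mu> (A (c, d)))"
    unfolding simple_vm_integral_def 2 complex_vector.scale_sum_right by (rule sum.swap)
  ultimately have "simple_vm_integral (measure_of_vm \<mu>) \<psi>1 - simple_vm_integral (measure_of_vm \<mu>) \<psi>2 =
      (\<Sum>p\<in>range \<psi>1 \<times> range \<psi>2. (fst p - snd p) *\<^sub>C measure_of_vm \<mu> (A p))"
    by (simp add: sum_subtractf[symmetric] complex_vector.scale_left_diff_distrib sum.cartesian_product
        case_prod_unfold)
  also have "norm \<dots> \<le> (\<Sum>p\<in>range \<psi>1 \<times> range \<psi>2. e * norm (measure_of_vm \<mu> (A p)))"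
  proof (intro sum_norm_le)
    fix p
    show "norm ((fst p - snd p) *\<^sub>C measure_of_vm \<mu> (A p)) \<le> e * norm (measure_of_vm \<mu> (A p))"
    proof (cases "A p = {}")
      case False
      then obtain x where "\<psi>1 x = fst p" "\<psi>2 x = snd p" by (auto simp: A_def case_prod_unfold)
      then show ?thesis using le[of x] by (auto simp: norm_scaleC intro: mult_right_mono)
    qed simp
  qed
  also have "\<dots> = e * (\<Sum>p\<in>range \<psi>1 \<times> range \<psi>2. norm (measure_of_vm \<mu> (A p)))"
    by (simp only: sum_distrib_left)
  also have "\<dots> \<le> e * norm \<mu>"
    using order_trans[OF norm_ge_zero le] fin A dis
    by (intro mult_left_mono sum_norm_vm_le) auto
  finally show ?thesis .
qed

text \<open>The estimate for simple functions survives uniform limits. With \<open>e = 0\<close> it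
  makes the integral unique and justifies \<open>THE\<close>; with small \<open>e\<close> it gives
  continuity of convolutions.\<close>

lemma has_vm_integral_diff_le:
  assumes "has_vm_integral (measure_of_vm \<mu>) \<phi>1 I1" "has_vm_integral (measure_of_vm \<mu>) \<phi>2 I2"
    and le: "\<And>x. cmod (\<phi>1 x - \<phi>2 x) \<le> e"
  shows "norm (I1 - I2) \<le> e * norm \<mu>"
proof -
  obtain \<psi>1 where 1: "\<And>n. simple_function borel (\<psi>1 n)" "uniform_limit UNIV \<psi>1 \<phi>1 sequentially"
    "(\<lambda>n. simple_vm_integral (measure_of_vm \<mu>) (\<psi>1 n)) \<longlonglongrightarrow> I1"
    using assms(1) by (auto simp: has_vm_integral_def)
  obtain \<psi>2 where 2: "\<And>n. simple_function borel (\<psi>2 n)" "uniform_limit UNIV \<psi>2 \<phi>2 sequentially"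
    "(\<lambda>n. simple_vm_integral (measure_of_vm \<mu>) (\<psi>2 n)) \<longlonglongrightarrow> I2"
    using assms(2) by (auto simp: has_vm_integral_def)
  \<comment> \<open>Each of the two approximating sequences contributes an error \<open>d\<close>,
    which is made arbitrarily small at the end.\<close>
  have bound: "norm (I1 - I2) \<le> (e + 2 * d) * norm \<mu>" if "d > 0" for d
  proof (rule tendsto_upperbound)
    show "(\<lambda>n. norm (simple_vm_integral (measure_of_vm \<mu>) (\<psi>1 n) - simple_vm_integral (measure_of_vm \<mu>) (\<psi>2 n)))
      \<longlonglongrightarrow> norm (I1 - I2)"
      by (intro tendsto_intros 1 2)
    have "\<forall>\<^sub>F n in sequentially. (\<forall>x\<in>UNIV. dist (\<psi>1 n x) (\<phi>1 x) < d) \<and> (\<forall>x\<in>UNIV. dist (\<psi>2 n x) (\<phi>2 x) < d)"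
      by (intro eventually_conj uniform_limitD[OF 1(2) that] uniform_limitD[OF 2(2) that])
    then show "\<forall>\<^sub>F n in sequentially. norm (simple_vm_integral (measure_of_vm \<mu>) (\<psi>1 n) -
        simple_vm_integral (measure_of_vm \<mu>) (\<psi>2 n)) \<le> (e + 2 * d) * norm \<mu>"
    proof (rule eventually_mono)
      fix n assume n: "(\<forall>x\<in>UNIV. dist (\<psi>1 n x) (\<phi>1 x) < d) \<and> (\<forall>x\<in>UNIV. dist (\<psi>2 n x) (\<phi>2 x) < d)"
      have "cmod (\<psi>1 n x - \<psi>2 n x) \<le> e + 2 * d" for x
      proof -
        have "cmod (\<psi>1 n x - \<psi>2 n x) = cmod ((\<psi>1 n x - \<phi>1 x) + (\<phi>1 x - \<phi>2 x) - (\<psi>2 n x - \<phi>2 x))" by simp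
        also have "\<dots> \<le> cmod (\<psi>1 n x - \<phi>1 x) + cmod (\<phi>1 x - \<phi>2 x) + cmod (\<psi>2 n x - \<phi>2 x)"
          by (intro order_trans[OF norm_triangle_ineq4] add_right_mono norm_triangle_ineq)
        also have "\<dots> \<le> d + e + d"
          using n le[of x] by (intro add_mono) (auto simp: dist_norm intro: less_imp_le)
        finally show ?thesis by simp
      qed
      then show "norm (simple_vm_integral (measure_of_vm \<mu>) (\<psi>1 n) -
        simple_vm_integral (measure_of_vm \<mu>) (\<psi>2 n)) \<le> (e + 2 * d) * norm \<mu>"
        by (rule simple_vm_integral_diff_le[OF 1(1) 2(1)])
    qed
  qed simp
  show ?thesis
  proof (rule field_le_epsilon)
    fix u :: real assume "u > 0"
    obtain d where d: "d > 0" "2 * d * norm \<mu> < u" using ex_small_multiple[OF \<open>u > 0\<close>, of "norm \<mu>"] by auto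
    show "norm (I1 - I2) \<le> e * norm \<mu> + u" using bound[OF d(1)] d(2) by (simp add: algebra_simps)
  qed
qed

text \<open>Real and imaginary part are rounded down to multiples of
  \<open>1 / real (Suc n)\<close>, whence the 2; boundedness of \<open>\<phi>\<close> leaves
  finitely many grid points.\<close>

lemma uniform_simple_approximation:
  fixes \<phi> :: "'g::topological_space \<Rightarrow> complex"
  assumes \<phi>: "\<phi> \<in> borel_measurable borel" and bdd: "\<And>x. cmod (\<phi> x) \<le> B"
  obtains \<psi> where "\<And>n. simple_function borel (\<psi> n)" "\<And>n x. cmod (\<psi> n x - \<phi> x) \<le> 2 / real (Suc n)"
proof -
  define q :: "nat \<Rightarrow> real \<Rightarrow> real" where "q n t = of_int \<lfloor>real (Suc n) * t\<rfloor> / real (Suc n)" for n t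
  define \<psi> where "\<psi> n x = Complex (q n (Re (\<phi> x))) (q n (Im (\<phi> x)))" for n x
  have q: "\<bar>q n t - t\<bar> \<le> 1 / real (Suc n)" for n t
  proof -
    have "q n t - t = (of_int \<lfloor>real (Suc n) * t\<rfloor> - real (Suc n) * t) / real (Suc n)"
      by (simp add: q_def field_simps)
    moreover have "\<bar>of_int \<lfloor>real (Suc n) * t\<rfloor> - real (Suc n) * t\<bar> \<le> 1" by linarith
    ultimately show ?thesis by (simp add: divide_right_mono del: of_nat_Suc)
  qed
  have "cmod (\<psi> n x - \<phi> x) \<le> 2 / real (Suc n)" for n x
  proof -
    have "cmod (\<psi> n x - \<phi> x) \<le> \<bar>Re (\<psi> n x - \<phi> x)\<bar> + \<bar>Im (\<psi> n x - \<phi> x)\<bar>" by (rule cmod_le)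
    also have "\<dots> \<le> 1 / real (Suc n) + 1 / real (Suc n)"
      unfolding \<psi>_def minus_complex.sel complex.sel by (intro add_mono q)
    finally show ?thesis by simp
  qed
  moreover have "simple_function borel (\<psi> n)" for n
  proof (rule simple_function_borel_measurable)
    show "\<psi> n \<in> borel_measurable borel"
      unfolding \<psi>_def q_def Complex_eq using \<phi> by measurable
    define Z where "Z = {- \<lceil>real (Suc n) * B\<rceil> .. \<lceil>real (Suc n) * B\<rceil>}"
    have Z: "\<lfloor>real (Suc n) * t\<rfloor> \<in> Z" if "\<bar>t\<bar> \<le> B" for t
    proof -
      have "\<bar>real (Suc n) * t\<bar> \<le> real (Suc n) * B"
        using that by (simp add: abs_mult mult_left_mono del: of_nat_Suc)
      then show ?thesis unfolding Z_def by (simp del: of_nat_Suc) linarith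
    qed
    have "range (\<psi> n) \<subseteq> (\<lambda>(i, j). Complex (of_int i / real (Suc n)) (of_int j / real (Suc n))) ` (Z \<times> Z)"
    proof
      fix y assume "y \<in> range (\<psi> n)"
      then obtain x where y: "y = \<psi> n x" by blast
      have "\<bar>Re (\<phi> x)\<bar> \<le> B" "\<bar>Im (\<phi> x)\<bar> \<le> B"
        using bdd[of x] abs_Re_le_cmod[of "\<phi> x"] abs_Im_le_cmod[of "\<phi> x"] by linarith+
      then show "y \<in> (\<lambda>(i, j). Complex (of_int i / real (Suc n)) (of_int j / real (Suc n))) ` (Z \<times> Z)"
        using Z unfolding y \<psi>_def q_def by (intro image_eqI[of _ _ "(_, _)"]) auto
    qed
    then show "finite (\<psi> n ` space borel)" by (simp add: Z_def finite_subset)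
  qed
  ultimately show ?thesis using that by blast
qed

text \<open>Completeness of the value space gives the simple integrals a limit, and uniqueness
  identifies it with the value picked by \<open>THE\<close>.\<close>

lemma has_vm_integral_vm_integral:
  fixes \<mu> :: "('g::t2_space, 'x::cbanach) vmeasure"
  assumes \<phi>: "\<phi> \<in> borel_measurable borel" "\<And>x. cmod (\<phi> x) \<le> B"
  shows "has_vm_integral (measure_of_vm \<mu>) \<phi> (vm_integral (measure_of_vm \<mu>) \<phi>)"
proof -
  obtain \<psi> where \<psi>: "\<And>n. simple_function borel (\<psi> n)" "\<And>n x. cmod (\<psi> n x - \<phi> x) \<le> 2 / real (Suc n)"
    using uniform_simple_approximation[OF \<phi>] by blast
  have lim: "(\<lambda>n. 2 / real (Suc n)) \<longlonglongrightarrow> 0"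
    using tendsto_mult[OF tendsto_const LIMSEQ_Suc[OF lim_1_over_n], of 2] by simp
  have "uniform_limit UNIV \<psi> \<phi> sequentially"
  proof (rule uniform_limitI)
    fix e :: real assume "e > 0"
    have "\<forall>\<^sub>F n in sequentially. 2 / real (Suc n) < e" using lim \<open>e > 0\<close> by (rule order_tendstoD)
    then show "\<forall>\<^sub>F n in sequentially. \<forall>x\<in>UNIV. dist (\<psi> n x) (\<phi> x) < e"
      by (rule eventually_mono) (use \<psi>(2) in \<open>auto simp: dist_norm intro: le_less_trans\<close>)
  qed
  moreover have "Cauchy (\<lambda>n. simple_vm_integral (measure_of_vm \<mu>) (\<psi> n))"
  proof (rule metric_CauchyI)
    fix e :: real assume e: "e > 0"
    obtain d where d: "d > 0" "2 * d * norm \<mu> < e" using ex_small_multiple[OF e, of "norm \<mu>"] by auto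
    have "\<forall>\<^sub>F n in sequentially. 2 / real (Suc n) < d" using lim d(1) by (rule order_tendstoD)
    then obtain N where N: "\<And>n. n \<ge> N \<Longrightarrow> 2 / real (Suc n) < d" by (auto simp: eventually_sequentially)
    have "dist (simple_vm_integral (measure_of_vm \<mu>) (\<psi> m)) (simple_vm_integral (measure_of_vm \<mu>) (\<psi> n)) < e"
      if "m \<ge> N" "n \<ge> N" for m n
    proof -
      have "cmod (\<psi> m x - \<psi> n x) \<le> 2 * d" for x
      proof -
        have "cmod (\<psi> m x - \<psi> n x) \<le> cmod (\<psi> m x - \<phi> x) + cmod (\<psi> n x - \<phi> x)"
          using norm_triangle_ineq4[of "\<psi> m x - \<phi> x" "\<psi> n x - \<phi> x"] by simp
        then show ?thesis using \<psi>(2)[of m x] \<psi>(2)[of n x] N[OF that(1)] N[OF that(2)] by linarith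
      qed
      from simple_vm_integral_diff_le[OF \<psi>(1) \<psi>(1) this, of \<mu>] show ?thesis
        using d(2) by (simp add: dist_norm)
    qed
    then show "\<exists>M. \<forall>m\<ge>M. \<forall>n\<ge>M. dist (simple_vm_integral (measure_of_vm \<mu>) (\<psi> m))
        (simple_vm_integral (measure_of_vm \<mu>) (\<psi> n)) < e" by blast
  qed
  ultimately obtain I where I: "has_vm_integral (measure_of_vm \<mu>) \<phi> I"
    using \<psi>(1) unfolding has_vm_integral_def by (meson Cauchy_convergent convergent_def)
  show ?thesis
    unfolding vm_integral_def
  proof (rule theI)
    fix J assume "has_vm_integral (measure_of_vm \<mu>) \<phi> J"
    from has_vm_integral_diff_le[OF this I, of 0] show "J = I" by simp
  qed (rule I)
qed

lemma vm_integral_eqI: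
  assumes "has_vm_integral (measure_of_vm \<mu>) \<phi> I"
  shows "vm_integral (measure_of_vm \<mu>) \<phi> = I"
  unfolding vm_integral_def
proof (rule the_equality)
  show "has_vm_integral (measure_of_vm \<mu>) \<phi> I" by (rule assms)
  fix J assume "has_vm_integral (measure_of_vm \<mu>) \<phi> J"
  from has_vm_integral_diff_le[OF this assms, of 0] show "J = I" by simp
qed

text \<open>The same simple functions serve both integrals. Coordinate functionals and the part
  \<open>B\<^sub>2 D\<^sub>\<tau>\<close> of \<open>T\<close> are taken out of integrals in this
  way.\<close>

lemma vm_integral_map:
  fixes \<mu> :: "('g::t2_space, 'x::cbanach) vmeasure"
  assumes L: "bounded_clinear L" and \<phi>: "\<phi> \<in> borel_measurable borel" "\<And>x. cmod (\<phi> x) \<le> B"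
  shows "vm_integral (\<lambda>E. L (measure_of_vm \<mu> E)) \<phi> = L (vm_integral (measure_of_vm \<mu>) \<phi>)"
proof -
  obtain \<psi> where \<psi>: "\<And>n. simple_function borel (\<psi> n)" "uniform_limit UNIV \<psi> \<phi> sequentially"
    "(\<lambda>n. simple_vm_integral (measure_of_vm \<mu>) (\<psi> n)) \<longlonglongrightarrow> vm_integral (measure_of_vm \<mu>) \<phi>"
    using has_vm_integral_vm_integral[OF \<phi>, of \<mu>] by (auto simp: has_vm_integral_def)
  have "simple_vm_integral (measure_of_vm (vm_map L \<mu>)) (\<psi> n) = L (simple_vm_integral (measure_of_vm \<mu>) (\<psi> n))" for n
    by (simp add: simple_vm_integral_def measure_of_vm_map[OF L] bounded_clinear_sum[OF L] bounded_clinear_scaleC[OF L])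
  moreover have "(\<lambda>n. L (simple_vm_integral (measure_of_vm \<mu>) (\<psi> n))) \<longlonglongrightarrow> L (vm_integral (measure_of_vm \<mu>) \<phi>)"
    using L by (intro bounded_linear.tendsto[OF _ \<psi>(3)]) (simp add: bounded_clinear_def)
  ultimately have "has_vm_integral (measure_of_vm (vm_map L \<mu>)) \<phi> (L (vm_integral (measure_of_vm \<mu>) \<phi>))"
    unfolding has_vm_integral_def using \<psi>(1,2) by (intro exI[of _ \<psi>]) simp
  from vm_integral_eqI[OF this] show ?thesis by (simp add: measure_of_vm_map[OF L])
qed

section \<open>The factorization of \<open>T\<^sub>f\<close>\<close>

lemma convolution_kernel_measurable:
  fixes f :: "'g::{topological_ab_group_add,t2_space} \<Rightarrow>\<^sub>C complex"
  shows "(\<lambda>h. f (g - h)) \<in> borel_measurable borel" "cmod (f (g - h)) \<le> norm f"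
proof -
  have "continuous_on UNIV (\<lambda>h. f (g - h))"
    by (rule continuous_on_compose2[OF continuous_on_apply_bcontfun]) (auto intro!: continuous_intros)
  then show "(\<lambda>h. f (g - h)) \<in> borel_measurable borel" by (rule borel_measurable_continuous_onI)
qed (rule norm_bounded)

text \<open>\<open>Bcontfun\<close> is meaningful only on bounded continuous functions. Compactness
  makes \<open>f (g - h)\<close> continuous in \<open>g\<close> uniformly in \<open>h\<close>, and
  the integral estimate carries this over to the convolution.\<close>

lemma apply_convolution_op:
  fixes f :: "'g::{topological_ab_group_add,t2_space} \<Rightarrow>\<^sub>C complex"
  assumes G: "compact (UNIV :: 'g set)"
  shows "apply_bcontfun (convolution_op f \<mu>) g = vm_integral (measure_of_vm \<mu>) (\<lambda>h. f (g - h))"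
proof -
  define F where "F g = vm_integral (measure_of_vm \<mu>) (\<lambda>h. f (g - h))" for g
  have int: "has_vm_integral (measure_of_vm \<mu>) (\<lambda>h. f (g - h)) (F g)" for g
    unfolding F_def by (rule has_vm_integral_vm_integral) (rule convolution_kernel_measurable)+
  have cont: "continuous_on UNIV F"
    unfolding continuous_on_def
  proof (intro ballI tendstoI)
    fix g0 :: 'g and e :: real assume "e > 0"
    then obtain d where d: "d > 0" "2 * d * norm \<mu> < e"
      using ex_small_multiple[of e "norm \<mu>"] by auto
    have "continuous_on (UNIV \<times> UNIV) (\<lambda>p :: 'g \<times> 'g. fst p - snd p)"
      by (intro continuous_intros)
    from continuous_on_compose2[OF continuous_on_apply_bcontfun[of UNIV f] this]
    have "continuous_on (UNIV \<times> UNIV) (\<lambda>(g, h). f (g - h))"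
      by (simp add: case_prod_unfold)
    then obtain X0 where X0: "g0 \<in> X0" "open X0"
      "\<forall>x\<in>X0 \<inter> UNIV. \<forall>t\<in>UNIV. dist ((\<lambda>(g, h). f (g - h)) (x, t)) ((\<lambda>(g, h). f (g - h)) (g0, t)) \<le> d"
      by (rule continuous_on_prod_compactE[OF _ G UNIV_I d(1), of _ g0])
    have "dist (F x) (F g0) < e" if "x \<in> X0" for x
    proof -
      have "norm (F x - F g0) \<le> d * norm \<mu>"
        using X0(3) that by (intro has_vm_integral_diff_le[OF int int]) (auto simp: dist_norm)
      also have "\<dots> \<le> 2 * d * norm \<mu>" using d(1) by simp
      finally show ?thesis using d(2) by (simp add: dist_norm)
    qed
    then show "\<forall>\<^sub>F x in at g0 within UNIV. dist (F x) (F g0) < e"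
      using X0(1,2) unfolding eventually_at_topological by blast
  qed
  moreover have "bounded (range F)"
    by (rule compact_imp_bounded[OF compact_continuous_image[OF cont G]])
  ultimately have "apply_bcontfun (Bcontfun F) = F" by (intro Bcontfun_inverse) (simp add: bcontfun_def)
  then show ?thesis unfolding convolution_op_def F_def[symmetric] by simp
qed

text \<open>In the array of pairs \<open>(i, j)\<close> the index \<open>i\<close> belongs to
  \<open>\<sigma>\<close> and \<open>j\<close> to \<open>\<tau>\<close>; a row fixes the second
  component.\<close>

definition row_ell2 :: "nat \<Rightarrow> ell2 \<Rightarrow> ell2" where
  "row_ell2 j z = Abs_ell2 (\<lambda>i. ell2_coord z (prod_encode (i, j)))"

lemma ell2_coord_row: "ell2_coord (row_ell2 j z) i = ell2_coord z (prod_encode (i, j))"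
proof -
  have "(\<Sum>i<M. (cmod (ell2_coord z (prod_encode (i, j))))\<^sup>2) \<le> (norm z)\<^sup>2" for M
  proof -
    have "(\<Sum>i<M. (cmod (ell2_coord z (prod_encode (i, j))))\<^sup>2) =
        (\<Sum>n\<in>(\<lambda>i. prod_encode (i, j)) ` {..<M}. (cmod (ell2_coord z n))\<^sup>2)"
      by (subst sum.reindex) (auto simp: inj_on_def prod_encode_eq)
    also have "\<dots> \<le> (norm z)\<^sup>2" by (rule ell2_sum_le) simp
    finally show ?thesis .
  qed
  from ell2_bound_Abs(1)[OF norm_ge_zero this] show ?thesis by (simp add: row_ell2_def)
qed

text \<open>The entries of a finite rectangle of the array are distinct coordinates of
  \<open>z\<close>.\<close>

lemma sum_norm_row_le: "(\<Sum>j<N. (norm (row_ell2 j z))\<^sup>2) \<le> (norm z)\<^sup>2"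
proof -
  have "(\<Sum>j<N. (norm (row_ell2 j z))\<^sup>2) = (\<Sum>i. \<Sum>j<N. (cmod (ell2_coord (row_ell2 j z) i))\<^sup>2)"
    unfolding ell2_norm_sq by (rule suminf_sum[symmetric]) (rule ell2_summable)
  also have "\<dots> \<le> (norm z)\<^sup>2"
  proof (rule suminf_le_const)
    show "summable (\<lambda>i. \<Sum>j<N. (cmod (ell2_coord (row_ell2 j z) i))\<^sup>2)"
      by (intro summable_sum ell2_summable)
    fix M
    have "(\<Sum>i<M. \<Sum>j<N. (cmod (ell2_coord (row_ell2 j z) i))\<^sup>2) =
        (\<Sum>n\<in>prod_encode ` ({..<M} \<times> {..<N}). (cmod (ell2_coord z n))\<^sup>2)"
      by (subst sum.reindex[OF inj_prod_encode])
        (simp add: sum.cartesian_product ell2_coord_row case_prod_unfold)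
    also have "\<dots> \<le> (norm z)\<^sup>2" by (rule ell2_sum_le) simp
    finally show "(\<Sum>i<M. \<Sum>j<N. (cmod (ell2_coord (row_ell2 j z) i))\<^sup>2) \<le> (norm z)\<^sup>2" .
  qed
  finally show ?thesis .
qed

text \<open>The amplification of \<open>B\<close> by the identity of \<open>ell2\<close>, evaluated
  at \<open>g\<close>.\<close>

definition apply_rows :: "(ell2 \<Rightarrow> 'g::topological_space \<Rightarrow>\<^sub>C complex) \<Rightarrow> ell2 \<Rightarrow> 'g \<Rightarrow> ell2" where
  "apply_rows B z g = Abs_ell2 (\<lambda>j. apply_bcontfun (B (row_ell2 j z)) g)"

context
  fixes B :: "ell2 \<Rightarrow> ('g::topological_space \<Rightarrow>\<^sub>C complex)" and L :: real
  assumes B: "bounded_clinear B" and L: "0 \<le> L" "\<And>x. norm (B x) \<le> L * norm x"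
begin

lemma apply_le: "(cmod (apply_bcontfun (B x) g))\<^sup>2 \<le> L\<^sup>2 * (norm x)\<^sup>2"
proof -
  have "cmod (apply_bcontfun (B x) g) \<le> L * norm x" by (rule order_trans[OF norm_bounded L(2)])
  from power_mono[OF this norm_ge_zero, of 2] show ?thesis by (simp only: power_mult_distrib)
qed

text \<open>At a fixed \<open>g\<close>, evaluation after \<open>B\<close> is a functional of norm
  at most \<open>L\<close>, so the squares over the rows add up. The sup norm of the target is used
  here.\<close>

lemma apply_rows_bound:
  shows "ell2_coord (apply_rows B z g) j = apply_bcontfun (B (row_ell2 j z)) g"
    and "norm (apply_rows B z g) \<le> L * norm z"
proof -
  have "(\<Sum>j<N. (cmod (apply_bcontfun (B (row_ell2 j z)) g))\<^sup>2) \<le> (L * norm z)\<^sup>2" for N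
  proof -
    have "(\<Sum>j<N. (cmod (apply_bcontfun (B (row_ell2 j z)) g))\<^sup>2) \<le> (\<Sum>j<N. L\<^sup>2 * (norm (row_ell2 j z))\<^sup>2)"
      by (intro sum_mono apply_le)
    also have "\<dots> \<le> (L * norm z)\<^sup>2"
      unfolding sum_distrib_left[symmetric] power_mult_distrib
      by (intro mult_left_mono sum_norm_row_le) simp
    finally show ?thesis .
  qed
  from ell2_bound_Abs[OF _ this] L(1)
  show "ell2_coord (apply_rows B z g) j = apply_bcontfun (B (row_ell2 j z)) g"
    "norm (apply_rows B z g) \<le> L * norm z" by (simp_all add: apply_rows_def)
qed

text \<open>The partial sums over \<open>j\<close> are continuous, and the tail is controlled by the
  norms of the remaining rows, a bound free of \<open>g\<close>; so the limit is uniform.\<close>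

lemma continuous_apply_rows: "continuous_on UNIV (apply_rows B z)"
proof (rule uniform_limit_theorem[of _ "\<lambda>N g. \<Sum>j<N. apply_bcontfun (B (row_ell2 j z)) g *\<^sub>C unit_ell2 j" sequentially])
  show "\<forall>\<^sub>F N in sequentially. continuous_on UNIV (\<lambda>g. \<Sum>j<N. apply_bcontfun (B (row_ell2 j z)) g *\<^sub>C unit_ell2 j)"
    by (intro always_eventually allI continuous_on_sum bounded_linear.continuous_on[OF bounded_linear_scaleC_left])
      (rule continuous_on_apply_bcontfun)
  define S where "S N = (\<Sum>j<N. (norm (row_ell2 j z))\<^sup>2)" for N
  have "summable (\<lambda>j. (norm (row_ell2 j z))\<^sup>2)"
    by (rule summableI_nonneg_bounded[OF _ sum_norm_row_le]) simp
  define Z where "Z = (\<Sum>j. (norm (row_ell2 j z))\<^sup>2)"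
  have SZ: "S \<longlonglongrightarrow> Z" "S N \<le> Z" for N
    unfolding S_def Z_def using \<open>summable _\<close> by (auto intro: summable_LIMSEQ sum_le_suminf)
  have le: "norm (apply_rows B z g - (\<Sum>j<N. apply_bcontfun (B (row_ell2 j z)) g *\<^sub>C unit_ell2 j))
      \<le> sqrt (L\<^sup>2 * (Z - S N))" for N g
  proof (rule ell2_norm_leI)
    show "0 \<le> sqrt (L\<^sup>2 * (Z - S N))" using SZ(2)[of N] by simp
    fix M
    have coord: "ell2_coord (apply_rows B z g - (\<Sum>j<N. apply_bcontfun (B (row_ell2 j z)) g *\<^sub>C unit_ell2 j)) k =
        (if k < N then 0 else apply_bcontfun (B (row_ell2 k z)) g)" for k
      by (simp add: apply_rows_bound(1) ell2_coord_sum ell2_coord_unit if_distrib cong: if_cong)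
    \<comment> \<open>With \<open>max M N\<close> the interval sum is a difference of partial sums
      also when \<open>M < N\<close>, where the left side is 0.\<close>
    have "(\<Sum>k<M. (cmod (if k < N then 0 else apply_bcontfun (B (row_ell2 k z)) g))\<^sup>2) \<le>
        (\<Sum>k\<in>{N..<max M N}. L\<^sup>2 * (norm (row_ell2 k z))\<^sup>2)"
    proof -
      have "(\<Sum>k<M. (cmod (if k < N then 0 else apply_bcontfun (B (row_ell2 k z)) g))\<^sup>2) =
          (\<Sum>k\<in>{N..<M}. (cmod (apply_bcontfun (B (row_ell2 k z)) g))\<^sup>2)"
        by (rule sum.mono_neutral_cong_right) auto
      also have "\<dots> \<le> (\<Sum>k\<in>{N..<M}. L\<^sup>2 * (norm (row_ell2 k z))\<^sup>2)" by (intro sum_mono apply_le)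
      also have "\<dots> \<le> (\<Sum>k\<in>{N..<max M N}. L\<^sup>2 * (norm (row_ell2 k z))\<^sup>2)" by (rule sum_mono2) auto
      finally show ?thesis .
    qed
    also have "\<dots> = L\<^sup>2 * (S (max M N) - S N)"
      unfolding S_def sum_distrib_left[symmetric]
      by (subst sum_diff_nat_ivl[of 0 N "max M N", simplified, symmetric]) (auto simp: atLeast0LessThan)
    also have "\<dots> \<le> L\<^sup>2 * (Z - S N)" using SZ(2) by (intro mult_left_mono) auto
    finally show "(\<Sum>k<M. (cmod (ell2_coord (apply_rows B z g -
        (\<Sum>j<N. apply_bcontfun (B (row_ell2 j z)) g *\<^sub>C unit_ell2 j)) k))\<^sup>2) \<le> (sqrt (L\<^sup>2 * (Z - S N)))\<^sup>2"
      unfolding coord using SZ(2)[of N] by simp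
  qed
  show "uniform_limit UNIV (\<lambda>N g. \<Sum>j<N. apply_bcontfun (B (row_ell2 j z)) g *\<^sub>C unit_ell2 j) (apply_rows B z) sequentially"
  proof (rule uniform_limitI)
    fix e :: real assume "e > 0"
    have "(\<lambda>N. sqrt (L\<^sup>2 * (Z - S N))) \<longlonglongrightarrow> sqrt (L\<^sup>2 * (Z - Z))" by (intro tendsto_intros SZ)
    then have "\<forall>\<^sub>F N in sequentially. sqrt (L\<^sup>2 * (Z - S N)) < e"
      using \<open>e > 0\<close> by (auto intro: order_tendstoD)
    then show "\<forall>\<^sub>F N in sequentially. \<forall>g\<in>UNIV. dist (\<Sum>j<N. apply_bcontfun (B (row_ell2 j z)) g *\<^sub>C unit_ell2 j) (apply_rows B z g) < e"
      by (rule eventually_mono) (use le in \<open>auto simp: dist_norm norm_minus_commute intro: le_less_trans\<close>)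
  qed
qed simp

lemma apply_rows_add: "apply_rows B (z + z') g = apply_rows B z g + apply_rows B z' g"
proof (rule ell2_eqI)
  fix j
  have "row_ell2 j (z + z') = row_ell2 j z + row_ell2 j z'" by (rule ell2_eqI) (simp add: ell2_coord_row)
  then show "ell2_coord (apply_rows B (z + z') g) j = ell2_coord (apply_rows B z g + apply_rows B z' g) j"
    by (simp add: apply_rows_bound(1) bounded_clinear_add[OF B] plus_bcontfun.rep_eq)
qed

lemma apply_rows_scaleC: "apply_rows B (c *\<^sub>C z) g = c *\<^sub>C apply_rows B z g"
proof (rule ell2_eqI)
  fix j
  have "row_ell2 j (c *\<^sub>C z) = c *\<^sub>C row_ell2 j z" by (rule ell2_eqI) (simp add: ell2_coord_row)
  then show "ell2_coord (apply_rows B (c *\<^sub>C z) g) j = ell2_coord (c *\<^sub>C apply_rows B z g) j"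
    by (simp add: apply_rows_bound(1) bounded_clinear_scaleC[OF B] scaleC_bcontfun.rep_eq scaleC_complex_def)
qed

lemma bounded_clinear_apply_rows:
  fixes B' :: "ell2 \<Rightarrow> 'y::complex_normed_vector"
  assumes B': "bounded_clinear B'"
  shows "bounded_clinear (\<lambda>z. Bcontfun (\<lambda>g. B' (apply_rows B z g)))"
proof -
  obtain K where K: "0 < K" "\<And>x. norm (B' x) \<le> K * norm x" using bounded_clinear_bound[OF B'] by blast
  have le: "norm (B' (apply_rows B z g)) \<le> K * L * norm z" for z g
  proof -
    have "norm (B' (apply_rows B z g)) \<le> K * norm (apply_rows B z g)" by (rule K)
    also have "\<dots> \<le> K * (L * norm z)" using K(1) by (intro mult_left_mono apply_rows_bound) simp
    finally show ?thesis by (simp only: mult.assoc)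
  qed
  have "(\<lambda>g. B' (apply_rows B z g)) \<in> bcontfun" for z
    unfolding bcontfun_def
  proof (intro CollectI conjI)
    show "continuous_on UNIV (\<lambda>g. B' (apply_rows B z g))"
      using B' by (intro bounded_linear.continuous_on[OF _ continuous_apply_rows]) (simp add: bounded_clinear_def)
    show "bounded (range (\<lambda>g. B' (apply_rows B z g)))"
      by (rule boundedI[where B = "K * L * norm z"]) (use le in auto)
  qed
  then have eq: "apply_bcontfun (Bcontfun (\<lambda>g. B' (apply_rows B z g))) = (\<lambda>g. B' (apply_rows B z g))" for z
    by (rule Bcontfun_inverse)
  show ?thesis
  proof (rule bounded_clinearI)
    show "norm (Bcontfun (\<lambda>g. B' (apply_rows B z g))) \<le> K * L * norm z" for z
      by (rule norm_bound) (simp add: eq le)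
    show "Bcontfun (\<lambda>g. B' (apply_rows B (z + z') g)) =
        Bcontfun (\<lambda>g. B' (apply_rows B z g)) + Bcontfun (\<lambda>g. B' (apply_rows B z' g))" for z z'
      by (rule bcontfun_eqI, unfold eq plus_bcontfun.rep_eq)
        (simp add: apply_rows_add bounded_clinear_add[OF B'])
    show "Bcontfun (\<lambda>g. B' (apply_rows B (c *\<^sub>C z) g)) = c *\<^sub>C Bcontfun (\<lambda>g. B' (apply_rows B z g))" for c z
      by (rule bcontfun_eqI, unfold eq scaleC_bcontfun.rep_eq)
        (simp add: apply_rows_scaleC bounded_clinear_scaleC[OF B'])
  qed
qed

end

definition coord_vm :: "nat \<Rightarrow> ('g::t2_space, ell2) vmeasure \<Rightarrow> ('g, complex) vmeasure" where
  "coord_vm j = vm_map (\<lambda>x. ell2_coord x j)"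

text \<open>The counterpart of \<open>apply_rows\<close> on the domain side: \<open>A\<close> acts
  on every coordinate measure, and the pair \<open>(i, j)\<close> codes coordinate \<open>i\<close>
  of the \<open>j\<close>-th image.\<close>

definition tensor_coords :: "(('g::t2_space, complex) vmeasure \<Rightarrow> ell2) \<Rightarrow> ('g, ell2) vmeasure \<Rightarrow> ell2" where
  "tensor_coords A \<nu> = Abs_ell2 (\<lambda>n. ell2_coord (A (coord_vm (snd (prod_decode n)) \<nu>)) (fst (prod_decode n)))"

text \<open>Codes below \<open>N\<close> come from pairs in an \<open>N\<close> by \<open>N\<close>
  square. Summing the square row by row leaves the norms of the coordinate measures, which
  \<open>sum_norm_coord_vm_le\<close> bounds.\<close>

lemma tensor_coords:
  assumes A: "bounded_clinear A"
  shows "ell2_coord (tensor_coords A \<nu>) n = ell2_coord (A (coord_vm (snd (prod_decode n)) \<nu>)) (fst (prod_decode n))"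
    and "bounded_clinear (tensor_coords A)"
proof -
  obtain K where K: "0 < K" "\<And>x. norm (A x) \<le> K * norm x" using bounded_clinear_bound[OF A] by blast
  let ?a = "\<lambda>\<nu> n. ell2_coord (A (coord_vm (snd (prod_decode n)) \<nu>)) (fst (prod_decode n))"
  have "(\<Sum>n<N. (cmod (?a \<nu> n))\<^sup>2) \<le> (K * norm \<nu>)\<^sup>2" for N \<nu>
  proof -
    let ?b = "\<lambda>(i, j). (cmod (ell2_coord (A (coord_vm j \<nu>)) i))\<^sup>2"
    have "(\<Sum>n<N. (cmod (?a \<nu> n))\<^sup>2) = (\<Sum>p\<in>prod_decode ` {..<N}. ?b p)"
      by (subst sum.reindex[OF inj_prod_decode]) (simp add: case_prod_unfold)
    also have "\<dots> \<le> (\<Sum>p\<in>{..<N} \<times> {..<N}. ?b p)"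
    proof (rule sum_mono2)
      show "prod_decode ` {..<N} \<subseteq> {..<N} \<times> {..<N}"
      proof
        fix p assume "p \<in> prod_decode ` {..<N}"
        then have "prod_encode p < N" by auto
        then show "p \<in> {..<N} \<times> {..<N}"
          using le_prod_encode_1[of "fst p" "snd p"] le_prod_encode_2[of "snd p" "fst p"]
          by (simp add: mem_Times_iff)
      qed
    qed (auto simp: case_prod_unfold)
    also have "\<dots> = (\<Sum>j<N. \<Sum>i<N. (cmod (ell2_coord (A (coord_vm j \<nu>)) i))\<^sup>2)"
      unfolding sum.cartesian_product[symmetric] by (rule sum.swap)
    also have "\<dots> \<le> (\<Sum>j<N. (norm (A (coord_vm j \<nu>)))\<^sup>2)"
      by (intro sum_mono ell2_sum_le) simp
    also have "\<dots> \<le> (\<Sum>j<N. K\<^sup>2 * (norm (coord_vm j \<nu>))\<^sup>2)"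
      using K by (intro sum_mono) (simp flip: power_mult_distrib)
    also have "\<dots> = K\<^sup>2 * (\<Sum>j<N. (norm (coord_vm j \<nu>))\<^sup>2)" by (simp only: sum_distrib_left)
    also have "\<dots> \<le> (K * norm \<nu>)\<^sup>2"
      unfolding power_mult_distrib coord_vm_def by (intro mult_left_mono sum_norm_coord_vm_le) simp
    finally show ?thesis .
  qed
    from ell2_bound_Abs[OF _ this] K(1)
  have coord: "ell2_coord (tensor_coords A \<nu>) n = ?a \<nu> n" and le: "norm (tensor_coords A \<nu>) \<le> K * norm \<nu>" for \<nu> n
    by (simp_all add: tensor_coords_def)
  show "ell2_coord (tensor_coords A \<nu>) n = ?a \<nu> n" by (rule coord)
  show "bounded_clinear (tensor_coords A)"
    by (rule bounded_clinearI[where K = K])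
      (auto intro!: ell2_eqI le simp: coord coord_vm_def vm_map_add[OF bounded_clinear_ell2_coord]
        vm_map_scaleC[OF bounded_clinear_ell2_coord] bounded_clinear_add[OF A] bounded_clinear_scaleC[OF A])
qed

theorem theorem5p9:
  fixes f :: "'g::{topological_ab_group_add,t2_space} \<Rightarrow>\<^sub>C complex"
    and T :: "'x::cbanach \<Rightarrow> 'y::cbanach"
    and r s :: real
  assumes "compact (UNIV :: 'g set)"
    and "bounded_clinear T"
    and "0 < s" and "s \<le> r"
    and "convolution_op f \<noteq> (\<lambda>_. 0)" and "T \<noteq> (\<lambda>_. 0)"
    and "factors_through_lorentz_schatten r s TYPE('h1::chilbert_space) (convolution_op f)"
    and "factors_through_lorentz_schatten r s TYPE('h2::chilbert_space) T"
  shows "factors_through_lorentz_schatten r s TYPE(ell2) (vector_convolution_op T f)"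
proof -
  obtain \<sigma> A1 B1 where \<sigma>: "lorentz_seq r s \<sigma>" and A1: "bounded_clinear A1" and B1: "bounded_clinear B1"
    and f: "\<And>\<mu>. convolution_op f \<mu> = B1 (diag_op \<sigma> (A1 \<mu>))"
    using lorentz_schatten_factorization[OF assms(7)] by blast
  obtain \<tau> A2 B2 where \<tau>: "lorentz_seq r s \<tau>" and A2: "bounded_clinear A2" and B2: "bounded_clinear B2"
    and T: "\<And>x. T x = B2 (diag_op \<tau> (A2 x))"
    using lorentz_schatten_factorization[OF assms(8)] by blast
  obtain L where L: "0 \<le> L" "\<And>x. norm (B1 x) \<le> L * norm x"
    using bounded_clinear_bound[OF B1] less_imp_le by metis
  obtain M1 where M1: "0 \<le> M1" "\<And>n. \<bar>\<sigma> n\<bar> \<le> M1" using \<sigma> null_seq_bound by (metis lorentz_seq_def)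
  obtain M2 where M2: "0 \<le> M2" "\<And>n. \<bar>\<tau> n\<bar> \<le> M2" using \<tau> null_seq_bound by (metis lorentz_seq_def)
  let ?c = "tensor_seq \<sigma> \<tau>"
  obtain M where M: "0 \<le> M" "\<And>n. \<bar>?c n\<bar> \<le> M" using null_seq_bound[OF tensor_seq_tendsto_0[OF \<sigma> \<tau>]] by blast
  define A where "A \<mu> = tensor_coords A1 (vm_map A2 \<mu>)" for \<mu> :: "('g, 'x) vmeasure"
  define B where "B z = Bcontfun (\<lambda>g. B2 (apply_rows B1 z g))" for z
  obtain K2 where K2: "0 < K2" "\<And>x. norm (A2 x) \<le> K2 * norm x" using bounded_clinear_bound[OF A2] by blast
  have map: "bounded_clinear (vm_map A2 :: ('g, 'x) vmeasure \<Rightarrow> _)"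
    by (rule bounded_clinearI[where K = K2])
      (simp_all add: vm_map_add[OF A2] vm_map_scaleC[OF A2] norm_vm_map_le[OF A2 less_imp_le[OF K2(1)] K2(2)])
  have A: "bounded_clinear A" unfolding A_def by (rule bounded_clinear_compose[OF tensor_coords(2)[OF A1] map])
  have B: "bounded_clinear B" unfolding B_def by (rule bounded_clinear_apply_rows[OF B1 L B2])
  have "vector_convolution_op T f \<mu> = B (diag_op ?c (A \<mu>))" for \<mu>
  proof -
    have "vm_integral (\<lambda>E. T (measure_of_vm \<mu> E)) (\<lambda>t. f (g - t)) = B2 (apply_rows B1 (diag_op ?c (A \<mu>)) g)" for g
    proof -
      define \<nu> where "\<nu> = vm_map A2 \<mu>"
      define I where "I = vm_integral (measure_of_vm \<nu>) (\<lambda>t. f (g - t))"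
      note meas = convolution_kernel_measurable[of f g]
      have "apply_rows B1 (diag_op ?c (A \<mu>)) g = diag_op \<tau> I"
      proof (rule ell2_eqI)
        fix j
        \<comment> \<open>On row \<open>j\<close> the factor \<open>\<tau> j\<close> is constant, so
          the diagonal operator acts as \<open>\<tau> j\<close> times
          \<open>diag_op \<sigma>\<close>, and \<open>B1\<close> reproduces the convolution with
          \<open>coord_vm j \<nu>\<close>.\<close>
        have "row_ell2 j (diag_op ?c (A \<mu>)) = complex_of_real (\<tau> j) *\<^sub>C diag_op \<sigma> (A1 (coord_vm j \<nu>))"
          by (rule ell2_eqI)
            (simp add: ell2_coord_row diag_op_bound(1)[OF M] diag_op_bound(1)[OF M1] A_def \<nu>_def tensor_coords(1)[OF A1]
              tensor_seq_def)
        then have "B1 (row_ell2 j (diag_op ?c (A \<mu>))) = complex_of_real (\<tau> j) *\<^sub>C convolution_op f (coord_vm j \<nu>)"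
          by (simp add: bounded_clinear_scaleC[OF B1] f)
        then have "ell2_coord (apply_rows B1 (diag_op ?c (A \<mu>)) g) j =
            complex_of_real (\<tau> j) * vm_integral (measure_of_vm (coord_vm j \<nu>)) (\<lambda>t. f (g - t))"
          by (simp add: apply_rows_bound(1)[OF B1 L] scaleC_bcontfun.rep_eq scaleC_complex_def
              apply_convolution_op[OF assms(1)])
        also have "vm_integral (measure_of_vm (coord_vm j \<nu>)) (\<lambda>t. f (g - t)) = ell2_coord I j"
          unfolding coord_vm_def measure_of_vm_map[OF bounded_clinear_ell2_coord] I_def
          by (rule vm_integral_map[OF bounded_clinear_ell2_coord meas])
        finally show "ell2_coord (apply_rows B1 (diag_op ?c (A \<mu>)) g) j = ell2_coord (diag_op \<tau> I) j"
          by (simp add: diag_op_bound(1)[OF M2])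
      qed
      \<comment> \<open>\<open>A2\<close> is already absorbed in \<open>\<nu>\<close>, so only the
        remaining factor of \<open>T\<close> is taken out of the integral.\<close>
      moreover have "vm_integral (\<lambda>E. T (measure_of_vm \<mu> E)) (\<lambda>t. f (g - t)) = B2 (diag_op \<tau> I)"
        using vm_integral_map[OF bounded_clinear_compose[OF B2 bounded_clinear_diag_op[OF M2]] meas, where \<mu> = \<nu>]
        by (simp add: I_def T \<nu>_def measure_of_vm_map[OF A2])
      ultimately show ?thesis by simp
    qed
    then show ?thesis by (simp add: vector_convolution_op_def B_def)
  qed
  then show ?thesis
    unfolding factors_through_lorentz_schatten_def
    using A B diag_op_in_lorentz_schatten[OF assms(3,4) \<sigma> \<tau>]
    by (intro exI[of _ A] exI[of _ "diag_op ?c"] exI[of _ B]) (auto simp: fun_eq_iff)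
qed

end
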